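(* Let $L=\{<,\ldots\}$ be a countable first order language containing a binary relation symbol $<$, and let $T$ be a complete $L$-theory with Skolem functions in which $<$ is interpreted as a linear order. Suppose $T$ satisfies the inaccessibility scheme. Let $\kappa$ be a regular cardinal and let $M$ be a $\kappa$-saturated model of $T$ with $cof(M)=\kappa$. Then for every regular cardinal $\lambda\leq\kappa$, $M$ has an elementary end extension $N$ such that $|N|=|M|$ and $cof(N)=\lambda$.
   Context: For a formula $\varphi(\bar{x},\bar{t})$ and tuples $\bar{y}_0,\bar{y}_1$ of the same length as $\bar{x}$, write $E_{\varphi}(\bar{y}_0,\bar{y}_1;z_0)$ for the formula $(\forall \bar{t}<z_0)(\varphi(\bar{y}_0,\bar{t})\leftrightarrow\varphi(\bar{y}_1,\bar{t}))$; here $\bar{t}<z_0$ means every coordinate of $\bar{t}$ is $<z_0$. $T$ satisfies the inaccessibility scheme if for every formula $\varphi(\bar{x},\bar{t})$ of $L$ (with $\bar{x}$ a tuple of any finite length), $T\models (\forall z_0)(\exists z_1>z_0)(\forall\bar{y}_0)(\exists\bar{y}_1<z_1)E_{\varphi}(\bar{y}_0,\bar{y}_1;z_0)$. "$T$ has Skolem functions" means that for every formula $\theta(y,\bar{x})$ there is a term $\tau(\bar{x})$ of $L$ with $T\models \forall\bar{x}(\exists y\,\theta(y,\bar{x})\to\theta(\tau(\bar{x}),\bar{x}))$. For a regular cardinal $\kappa$, $cof(M)=\kappa$ means $\kappa$ is the least cardinal such that there is a strictly increasing sequence of length $\kappa$ cofinal in $(M,<)$. $N$ is an elementary end extension of $M$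 if $M\preceq N$ and every element of $N$ that is $<$ some element of $M$ belongs to $M$. $|M|$ denotes the cardinality of $M$. *)

theory Defs
  imports Main
begin

text \<open>Symbols are natural numbers, so every language is countable.\<close>

record lang =
  funs   :: "nat set"
  rels   :: "nat set"
  farity :: "nat \<Rightarrow> nat"
  rarity :: "nat \<Rightarrow> nat"
  ltsym  :: nat

definition language :: "lang \<Rightarrow> bool" where
  "language L \<longleftrightarrow> ltsym L \<in> rels L \<and> rarity L (ltsym L) = 2"

datatype trm = Var nat | Fn nat "trm list"

datatype fm = Eq trm trm | Rel nat "trm list" | Neg fm | Conj fm fm | Ex nat fm

fun wf_trm :: "lang \<Rightarrow> trm \<Rightarrow> bool" where
  "wf_trm L (Var v) = True"
| "wf_trm L (Fn f ts) =
     (f \<in> funs L \<and> length ts = farity L f \<and> (\<forall>t\<in>set ts. wf_trm L t))"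

fun wf_fm :: "lang \<Rightarrow> fm \<Rightarrow> bool" where
  "wf_fm L (Eq s t) = (wf_trm L s \<and> wf_trm L t)"
| "wf_fm L (Rel r ts) = (r \<in> rels L \<and> length ts = rarity L r \<and> (\<forall>t\<in>set ts. wf_trm L t))"
| "wf_fm L (Neg \<phi>) = wf_fm L \<phi>"
| "wf_fm L (Conj \<phi> \<psi>) = (wf_fm L \<phi> \<and> wf_fm L \<psi>)"
| "wf_fm L (Ex v \<phi>) = wf_fm L \<phi>"

fun fv_trm :: "trm \<Rightarrow> nat set" where
  "fv_trm (Var v) = {v}"
| "fv_trm (Fn f ts) = (\<Union>t\<in>set ts. fv_trm t)"

fun fv :: "fm \<Rightarrow> nat set" where
  "fv (Eq s t) = fv_trm s \<union> fv_trm t"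
| "fv (Rel r ts) = (\<Union>t\<in>set ts. fv_trm t)"
| "fv (Neg \<phi>) = fv \<phi>"
| "fv (Conj \<phi> \<psi>) = fv \<phi> \<union> fv \<psi>"
| "fv (Ex v \<phi>) = fv \<phi> - {v}"

definition sentence :: "lang \<Rightarrow> fm \<Rightarrow> bool" where
  "sentence L \<phi> \<longleftrightarrow> wf_fm L \<phi> \<and> fv \<phi> = {}"

record 'a struc =
  dom  :: "'a set"
  funi :: "nat \<Rightarrow> 'a list \<Rightarrow> 'a"
  reli :: "nat \<Rightarrow> 'a list \<Rightarrow> bool"

definition is_struc :: "lang \<Rightarrow> 'a struc \<Rightarrow> bool" where
  "is_struc L M \<longleftrightarrow> dom M \<noteq> {} \<and>
     (\<forall>f\<in>funs L. \<forall>xs. length xs = farity L f \<and> set xs \<subseteq> dom M \<longrightarrow> funi M f xs \<in> dom M)"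

fun eval :: "'a struc \<Rightarrow> (nat \<Rightarrow> 'a) \<Rightarrow> trm \<Rightarrow> 'a" where
  "eval M e (Var v) = e v"
| "eval M e (Fn f ts) = funi M f (map (eval M e) ts)"

fun sat :: "'a struc \<Rightarrow> (nat \<Rightarrow> 'a) \<Rightarrow> fm \<Rightarrow> bool" where
  "sat M e (Eq s t) = (eval M e s = eval M e t)"
| "sat M e (Rel r ts) = reli M r (map (eval M e) ts)"
| "sat M e (Neg \<phi>) = (\<not> sat M e \<phi>)"
| "sat M e (Conj \<phi> \<psi>) = (sat M e \<phi> \<and> sat M e \<psi>)"
| "sat M e (Ex v \<phi>) = (\<exists>a\<in>dom M. sat M (e(v := a)) \<phi>)"

definition asg :: "'a struc \<Rightarrow> (nat \<Rightarrow> 'a) \<Rightarrow> bool" where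
  "asg M e \<longleftrightarrow> range e \<subseteq> dom M"

definition assign :: "'a struc \<Rightarrow> nat list \<Rightarrow> 'a list \<Rightarrow> nat \<Rightarrow> 'a" where
  "assign M vs as v = (case map_of (zip vs as) v of Some a \<Rightarrow> a | None \<Rightarrow> (SOME x. x \<in> dom M))"

definition lt :: "lang \<Rightarrow> 'a struc \<Rightarrow> 'a \<Rightarrow> 'a \<Rightarrow> bool" where
  "lt L M a b \<longleftrightarrow> reli M (ltsym L) [a, b]"

definition is_theory :: "lang \<Rightarrow> fm set \<Rightarrow> bool" where
  "is_theory L T \<longleftrightarrow> (\<forall>\<phi>\<in>T. sentence L \<phi>)"

definition is_model :: "lang \<Rightarrow> fm set \<Rightarrow> 'a struc \<Rightarrow> bool" where
  "is_model L T M \<longleftrightarrow> is_struc L M \<and> (\<forall>\<phi>\<in>T. \<forall>e. asg M e \<longrightarrow> sat M e \<phi>)"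

definition entails :: "'a itself \<Rightarrow> lang \<Rightarrow> fm set \<Rightarrow> fm \<Rightarrow> bool" where
  "entails _ L T \<phi> \<longleftrightarrow> (\<forall>N :: 'a struc. is_model L T N \<longrightarrow> (\<forall>e. asg N e \<longrightarrow> sat N e \<phi>))"

definition complete_theory :: "'a itself \<Rightarrow> lang \<Rightarrow> fm set \<Rightarrow> bool" where
  "complete_theory TY L T \<longleftrightarrow> is_theory L T \<and> (\<exists>N :: 'a struc. is_model L T N) \<and>
     (\<forall>\<phi>. sentence L \<phi> \<longrightarrow> entails TY L T \<phi> \<or> entails TY L T (Neg \<phi>))"

definition lt_linear :: "'a itself \<Rightarrow> lang \<Rightarrow> fm set \<Rightarrow> bool" where
  "lt_linear _ L T \<longleftrightarrow> (\<forall>N :: 'a struc. is_model L T N \<longrightarrow>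
     (\<forall>a\<in>dom N. \<not> lt L N a a) \<and>
     (\<forall>a\<in>dom N. \<forall>b\<in>dom N. \<forall>c\<in>dom N. lt L N a b \<and> lt L N b c \<longrightarrow> lt L N a c) \<and>
     (\<forall>a\<in>dom N. \<forall>b\<in>dom N. lt L N a b \<or> a = b \<or> lt L N b a))"

definition has_skolem :: "'a itself \<Rightarrow> lang \<Rightarrow> fm set \<Rightarrow> bool" where
  "has_skolem _ L T \<longleftrightarrow> (\<forall>\<theta> y. wf_fm L \<theta> \<longrightarrow>
     (\<exists>\<tau>. wf_trm L \<tau> \<and> fv_trm \<tau> \<subseteq> fv \<theta> - {y} \<and>
        (\<forall>N :: 'a struc. is_model L T N \<longrightarrow> (\<forall>e. asg N e \<longrightarrow>
           (\<exists>a\<in>dom N. sat N (e(y := a)) \<theta>) \<longrightarrow> sat N (e(y := eval N e \<tau>)) \<theta>))))"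

definition E_phi :: "lang \<Rightarrow> 'a struc \<Rightarrow> fm \<Rightarrow> nat list \<Rightarrow> nat list \<Rightarrow> 'a list \<Rightarrow> 'a list \<Rightarrow> 'a \<Rightarrow> bool" where
  "E_phi L N \<phi> xs ts ys0 ys1 z0 \<longleftrightarrow>
     (\<forall>tv. length tv = length ts \<and> set tv \<subseteq> dom N \<and> (\<forall>t\<in>set tv. lt L N t z0) \<longrightarrow>
        (sat N (assign N (xs @ ts) (ys0 @ tv)) \<phi> \<longleftrightarrow> sat N (assign N (xs @ ts) (ys1 @ tv)) \<phi>))"

definition inaccessibility :: "'a itself \<Rightarrow> lang \<Rightarrow> fm set \<Rightarrow> bool" where
  "inaccessibility _ L T \<longleftrightarrow> (\<forall>\<phi> xs ts. wf_fm L \<phi> \<and> distinct (xs @ ts) \<and> fv \<phi> \<subseteq> set xs \<union> set ts \<longrightarrow>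
     (\<forall>N :: 'a struc. is_model L T N \<longrightarrow>
       (\<forall>z0\<in>dom N. \<exists>z1\<in>dom N. lt L N z0 z1 \<and>
          (\<forall>ys0. length ys0 = length xs \<and> set ys0 \<subseteq> dom N \<longrightarrow>
             (\<exists>ys1. length ys1 = length xs \<and> set ys1 \<subseteq> dom N \<and> (\<forall>y\<in>set ys1. lt L N y z1) \<and>
                 E_phi L N \<phi> xs ts ys0 ys1 z0)))))"

definition regular_cardinal :: "'k rel \<Rightarrow> bool" where
  "regular_cardinal \<kappa> \<longleftrightarrow> Card_order \<kappa> \<and> \<not> finite (Field \<kappa>) \<and> regularCard \<kappa>"

definition incr_cofinal_seq :: "lang \<Rightarrow> 'a struc \<Rightarrow> 'k rel \<Rightarrow> bool" where
  "incr_cofinal_seq L M r \<longleftrightarrow> (\<exists>f. f ` Field r \<subseteq> dom M \<and>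
     (\<forall>i j. (i, j) \<in> r \<and> i \<noteq> j \<longrightarrow> lt L M (f i) (f j)) \<and>
     (\<forall>x\<in>dom M. \<exists>i\<in>Field r. x = f i \<or> lt L M x (f i)))"

text \<open>cof(M) = kappa: kappa is a cardinal with such a sequence, and no smaller cardinal has one
  (every cardinal below kappa is represented as |A| for some A contained in Field kappa).\<close>
definition cof_is :: "lang \<Rightarrow> 'a struc \<Rightarrow> 'k rel \<Rightarrow> bool" where
  "cof_is L M \<kappa> \<longleftrightarrow> Card_order \<kappa> \<and> incr_cofinal_seq L M \<kappa> \<and>
     (\<forall>A. A \<subseteq> Field \<kappa> \<and> ordLess2 (card_of A) \<kappa> \<longrightarrow> \<not> incr_cofinal_seq L M (card_of A))"

text \<open>kappa-saturation: every (1-)type over fewer than kappa parameters which is finitely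
  satisfiable in M is realized in M.  A type is a set of pairs (phi, e): phi(x_0, params)
  with its parameters given by e, all lying in A.\<close>
definition saturated :: "lang \<Rightarrow> 'k rel \<Rightarrow> 'a struc \<Rightarrow> bool" where
  "saturated L \<kappa> M \<longleftrightarrow> (\<forall>A p. A \<subseteq> dom M \<and> ordLess2 (card_of A) \<kappa> \<and>
     (\<forall>(\<phi>, e)\<in>p. wf_fm L \<phi> \<and> (\<forall>v\<in>fv \<phi> - {0}. e v \<in> A)) \<and>
     (\<forall>q. q \<subseteq> p \<and> finite q \<longrightarrow> (\<exists>a\<in>dom M. \<forall>(\<phi>, e)\<in>q. sat M (e(0 := a)) \<phi>)) \<longrightarrow>
     (\<exists>a\<in>dom M. \<forall>(\<phi>, e)\<in>p. sat M (e(0 := a)) \<phi>))"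

text \<open>h is an elementary embedding of M into N whose image is an initial segment of (N,<);
  i.e. N is (an isomorphic copy of) an elementary end extension of M.\<close>
definition elem_end_ext :: "lang \<Rightarrow> 'a struc \<Rightarrow> 'b struc \<Rightarrow> ('a \<Rightarrow> 'b) \<Rightarrow> bool" where
  "elem_end_ext L M N h \<longleftrightarrow> is_struc L N \<and> h ` dom M \<subseteq> dom N \<and>
     (\<forall>\<phi> e. wf_fm L \<phi> \<and> asg M e \<longrightarrow> (sat M e \<phi> \<longleftrightarrow> sat N (h \<circ> e) \<phi>)) \<and>
     (\<forall>b\<in>dom N. \<forall>a\<in>dom M. lt L N b (h a) \<longrightarrow> b \<in> h ` dom M)"

end

theory Submission
  imports Defs "HOL-Library.Nat_Bijection" "HOL-Library.Countable"
begin

text \<open>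
  Write \<open>z \<lless> z'\<close> if for every formula each tuple has a copy below \<open>z'\<close> which is indistinguishable from it
  by that formula with parameters below \<open>z\<close>.  By saturation and the inaccessibility scheme, every \<open>z\<close>
  has arbitrarily large \<open>z'\<close> with \<open>z \<lless> z'\<close>.  If \<open>m \<lless> z \<lless> Z\<close>, then every tuple above \<open>Z\<close> has, for every
  formula, copies over the elements below \<open>m\<close> which are arbitrarily large: a bound on the copies could,
  as \<open>z \<lless> Z\<close>, be found below \<open>Z\<close>.

  Let \<open>m i\<close>, for \<open>i\<close> in \<open>\<kappa>\<close>, be cofinal in \<open>M\<close>, and embed \<open>lam\<close> into \<open>\<kappa>\<close> with image \<open>I\<close>.  Saturation yields by
  recursion on \<open>i\<close> tuples \<open>x i = (x i \<alpha>)\<close>, for \<open>\<alpha>\<close> in \<open>I\<close> below \<open>i\<close>, which lie above \<open>m i\<close>, increase with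
  respect to \<open>\<lless>\<close>, and are such that for \<open>j < i\<close> the tuples \<open>x i\<close> and \<open>x j\<close> have the same type over the
  elements below \<open>m j\<close>.  Hence the truth of a formula about \<open>x i\<close> and parameters in \<open>M\<close> is eventually
  constant in \<open>i\<close>.  The functions \<open>i \<mapsto> \<tau> (x i, a)\<close>, for terms \<open>\<tau>\<close> and parameters \<open>a\<close> from \<open>M\<close>, modulo
  eventual equality, form an elementary extension \<open>N\<close> of \<open>M\<close>, as witnesses are given by Skolem terms.
  A value \<open>\<tau> (x j, a)\<close> below \<open>m j\<close> is itself one of the parameters over which the type is fixed from
  \<open>j\<close> on, so \<open>N\<close> is an end extension; and \<open>x \<alpha> \<lless> x \<beta>\<close> makes the \<open>x \<alpha>\<close> cofinal in \<open>N\<close>.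
\<close>

unbundle cardinal_syntax

section \<open>Syntax: substitution and renaming\<close>

fun subst_trm :: "(nat \<Rightarrow> trm) \<Rightarrow> trm \<Rightarrow> trm" where
  "subst_trm \<sigma> (Var v) = \<sigma> v"
| "subst_trm \<sigma> (Fn f ts) = Fn f (map (subst_trm \<sigma>) ts)"

text \<open>Bound variables are renamed along with the free ones; for injective \<open>r\<close>
  nothing is captured, so no fresh variables have to be chosen.\<close>

fun ren :: "(nat \<Rightarrow> nat) \<Rightarrow> fm \<Rightarrow> fm" where
  "ren r (Eq s t) = Eq (subst_trm (Var \<circ> r) s) (subst_trm (Var \<circ> r) t)"
| "ren r (Rel R ts) = Rel R (map (subst_trm (Var \<circ> r)) ts)"
| "ren r (Neg \<phi>) = Neg (ren r \<phi>)"
| "ren r (Conj \<phi> \<psi>) = Conj (ren r \<phi>) (ren r \<psi>)"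
| "ren r (Ex v \<phi>) = Ex (r v) (ren r \<phi>)"

lemma eval_cong: "(\<And>v. v \<in> fv_trm t \<Longrightarrow> e v = e' v) \<Longrightarrow> eval M e t = eval M e' t"
  by (induction t) (auto intro!: arg_cong[where f = "funi M _"] map_cong)

lemma sat_cong: "(\<And>v. v \<in> fv \<phi> \<Longrightarrow> e v = e' v) \<Longrightarrow> sat M e \<phi> = sat M e' \<phi>"
proof (induction \<phi> arbitrary: e e')
  case (Eq s t)
  then show ?case using eval_cong[of s e e' M] eval_cong[of t e e' M] by auto
next
  case (Rel R ts)
  then have "map (eval M e) ts = map (eval M e') ts" by (auto intro!: eval_cong)
  then show ?case by (metis sat.simps(2))
next
  case (Neg \<phi>)
  then show ?case by (metis sat.simps(3) fv.simps(3))
next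
  case (Conj \<phi> \<psi>)
  then show ?case by (metis sat.simps(4) fv.simps(4) UnCI)
next
  case (Ex v \<phi>)
  have "sat M (e(v := a)) \<phi> = sat M (e'(v := a)) \<phi>" for a
    using Ex.prems by (intro Ex.IH) auto
  then show ?case by simp
qed

lemma finite_fv_trm: "finite (fv_trm t)"
  by (induction t) auto

lemma finite_fv: "finite (fv \<phi>)"
  by (induction \<phi>) (auto simp: finite_fv_trm)

lemma eval_subst_trm: "eval M e (subst_trm \<sigma> t) = eval M (\<lambda>v. eval M e (\<sigma> v)) t"
  by (induction t) (auto simp: o_def cong: map_cong)

lemma wf_subst_trm:
  "wf_trm L t \<Longrightarrow> (\<And>v. v \<in> fv_trm t \<Longrightarrow> wf_trm L (\<sigma> v)) \<Longrightarrow> wf_trm L (subst_trm \<sigma> t)"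
  by (induction t) auto

lemma fv_subst_trm: "fv_trm (subst_trm \<sigma> t) = (\<Union>v\<in>fv_trm t. fv_trm (\<sigma> v))"
  by (induction t) auto

lemma wf_ren: "wf_fm L \<phi> \<Longrightarrow> wf_fm L (ren r \<phi>)"
  by (induction \<phi>) (auto intro!: wf_subst_trm)

lemma fv_ren: "inj r \<Longrightarrow> fv (ren r \<phi>) = r ` fv \<phi>"
  by (induction \<phi>) (auto simp: fv_subst_trm inj_eq)

lemma sat_ren: "inj r \<Longrightarrow> sat M e (ren r \<phi>) = sat M (e \<circ> r) \<phi>"
proof (induction \<phi> arbitrary: e)
  case (Ex v \<phi>)
  have *: "e(r v := a) \<circ> r = (e \<circ> r)(v := a)" for a
    using Ex.prems by (auto simp: inj_eq)
  have "sat M (e(r v := a)) (ren r \<phi>) = sat M ((e \<circ> r)(v := a)) \<phi>" for a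
    using Ex.IH[OF Ex.prems] by (simp only: *)
  then show ?case by (simp only: ren.simps sat.simps)
qed (auto simp: eval_subst_trm o_def cong: map_cong)

lemma eval_in_dom:
  assumes "is_struc L M"
  shows "wf_trm L t \<Longrightarrow> e ` fv_trm t \<subseteq> dom M \<Longrightarrow> eval M e t \<in> dom M"
proof (induction t)
  case (Fn f ts)
  have "set (map (eval M e) ts) \<subseteq> dom M"
    using Fn by auto
  with Fn.prems assms show ?case by (simp add: is_struc_def)
qed auto

text \<open>Prefixing \<open>Ex v (v = w v \<and> ...)\<close> makes \<open>v\<close> take the value
  of \<open>w v\<close>, in place of a capture-avoiding substitution. Since no \<open>w v\<close>
  lies in \<open>S\<close>, the quantifiers added for \<open>S\<close> never bind a representative.
  The condition on \<open>e\<close> reflects that quantifiers range over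
  \<open>dom M\<close>.\<close>

lemma identify_variables:
  assumes "finite S" "S \<inter> w ` S = {}" "wf_fm L \<phi>"
  shows "\<exists>\<phi>'. wf_fm L \<phi>' \<and> fv \<phi>' \<subseteq> fv \<phi> - S \<union> w ` S \<and>
    (\<forall>e. e ` w ` S \<subseteq> dom M \<longrightarrow> sat M e \<phi>' = sat M (\<lambda>v. if v \<in> S then e (w v) else e v) \<phi>)"
  using assms(1,2)
proof (induction S rule: finite_induct)
  case empty
  show ?case using assms(3) by (intro exI[of _ \<phi>]) auto
next
  case (insert v S)
  then obtain \<phi>' where \<phi>': "wf_fm L \<phi>'" "fv \<phi>' \<subseteq> fv \<phi> - S \<union> w ` S"
    "\<And>e. e ` w ` S \<subseteq> dom M \<Longrightarrow> sat M e \<phi>' = sat M (\<lambda>v. if v \<in> S then e (w v) else e v) \<phi>"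
    by auto
  have w: "w v \<noteq> v" "v \<notin> w ` S" "w v \<notin> S" using insert by auto
  show ?case
  proof (intro exI[of _ "Ex v (Conj (Eq (Var v) (Var (w v))) \<phi>')"] conjI allI impI)
    show "wf_fm L (Ex v (Conj (Eq (Var v) (Var (w v))) \<phi>'))" using \<phi>' by simp
    show "fv (Ex v (Conj (Eq (Var v) (Var (w v))) \<phi>')) \<subseteq> fv \<phi> - insert v S \<union> w ` insert v S"
      using \<phi>'(2) by auto
    fix e assume e: "e ` w ` insert v S \<subseteq> dom M"
    have "sat M e (Ex v (Conj (Eq (Var v) (Var (w v))) \<phi>')) = sat M (e(v := e (w v))) \<phi>'"
      using e w by auto
    also have "\<dots> = sat M (\<lambda>u. if u \<in> S then (e(v := e (w v))) (w u) else (e(v := e (w v))) u) \<phi>"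
      using e by (intro \<phi>'(3)) auto
    also have "\<dots> = sat M (\<lambda>u. if u \<in> insert v S then e (w u) else e u) \<phi>"
      using w insert.hyps by (intro sat_cong) auto
    finally show "sat M e (Ex v (Conj (Eq (Var v) (Var (w v))) \<phi>')) =
      sat M (\<lambda>u. if u \<in> insert v S then e (w u) else e u) \<phi>" .
  qed
qed

lemma exists_block_formula:
  assumes "finite S" "wf_fm L \<phi>"
  shows "\<exists>\<phi>'. wf_fm L \<phi>' \<and> fv \<phi>' = fv \<phi> - S \<and>
    (\<forall>e. sat M e \<phi>' = (\<exists>t. t ` S \<subseteq> dom M \<and> sat M (\<lambda>v. if v \<in> S then t v else e v) \<phi>))"
  using assms(1)
proof (induction S rule: finite_induct)
  case empty
  show ?case using assms(2) by (intro exI[of _ \<phi>]) auto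
next
  case (insert v S)
  then obtain \<phi>' where \<phi>': "wf_fm L \<phi>'" "fv \<phi>' = fv \<phi> - S"
    "\<And>e. sat M e \<phi>' = (\<exists>t. t ` S \<subseteq> dom M \<and> sat M (\<lambda>v. if v \<in> S then t v else e v) \<phi>)"
    by auto
  have "sat M e (Ex v \<phi>') =
    (\<exists>t. t ` insert v S \<subseteq> dom M \<and> sat M (\<lambda>u. if u \<in> insert v S then t u else e u) \<phi>)" for e
  proof
    assume "sat M e (Ex v \<phi>')"
    then obtain a t where t: "a \<in> dom M" "t ` S \<subseteq> dom M"
      "sat M (\<lambda>u. if u \<in> S then t u else (e(v := a)) u) \<phi>" using \<phi>'(3) by auto
    have "sat M (\<lambda>u. if u \<in> insert v S then (t(v := a)) u else e u) \<phi>"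
      using t(3) insert.hyps by (subst sat_cong[of _ _ "\<lambda>u. if u \<in> S then t u else (e(v := a)) u"]) auto
    with t show "\<exists>t. t ` insert v S \<subseteq> dom M \<and> sat M (\<lambda>u. if u \<in> insert v S then t u else e u) \<phi>"
      by (intro exI[of _ "t(v := a)"]) auto
  next
    assume "\<exists>t. t ` insert v S \<subseteq> dom M \<and> sat M (\<lambda>u. if u \<in> insert v S then t u else e u) \<phi>"
    then obtain t where t: "t ` insert v S \<subseteq> dom M"
      "sat M (\<lambda>u. if u \<in> insert v S then t u else e u) \<phi>" by auto
    have "sat M (\<lambda>u. if u \<in> S then t u else (e(v := t v)) u) \<phi>"
      using t(2) by (subst sat_cong[of _ _ "\<lambda>u. if u \<in> insert v S then t u else e u"]) auto
    with t show "sat M e (Ex v \<phi>')" using \<phi>'(3) by (auto intro!: bexI[of _ "t v"])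
  qed
  then show ?case using \<phi>' by (intro exI[of _ "Ex v \<phi>'"]) auto
qed

section \<open>Definable predicates of assignments\<close>

text \<open>A predicate of assignments on an arbitrary index type is definable over \<open>C\<close> if it is given by
  a formula whose variables are attached, not necessarily injectively, to indices in \<open>C\<close>.  Allowing
  any index type makes substitution of variables a mere reindexing.\<close>

locale lt_structure =
  fixes L :: lang and M :: "'a struc"
  assumes lang: "language L" and struc: "is_struc L M"
begin

definition dfn :: "'i set \<Rightarrow> (('i \<Rightarrow> 'a) \<Rightarrow> bool) \<Rightarrow> bool" where
  "dfn C P \<longleftrightarrow> (\<exists>\<phi> \<rho>. wf_fm L \<phi> \<and> \<rho> ` fv \<phi> \<subseteq> C \<and>
     (\<forall>e. e ` C \<subseteq> dom M \<longrightarrow> P e = sat M (e \<circ> \<rho>) \<phi>))"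

lemma dom_nonempty: "dom M \<noteq> {}"
  using struc by (simp add: is_struc_def)

lemma dfn_cong: "dfn C P \<Longrightarrow> (\<And>e. e ` C \<subseteq> dom M \<Longrightarrow> P e = Q e) \<Longrightarrow> dfn C Q"
  unfolding dfn_def by metis

lemma dfn_sat: "wf_fm L \<phi> \<Longrightarrow> \<rho> ` fv \<phi> \<subseteq> C \<Longrightarrow> dfn C (\<lambda>e. sat M (e \<circ> \<rho>) \<phi>)"
  unfolding dfn_def by blast

lemma dfn_reindex:
  assumes "dfn C P" "\<sigma> ` C \<subseteq> D"
  shows "dfn D (\<lambda>e. P (\<lambda>i. e (\<sigma> i)))"
proof -
  obtain \<phi> \<rho> where *: "wf_fm L \<phi>" "\<rho> ` fv \<phi> \<subseteq> C" "\<And>e. e ` C \<subseteq> dom M \<Longrightarrow> P e = sat M (e \<circ> \<rho>) \<phi>"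
    using assms(1) unfolding dfn_def by blast
  show ?thesis unfolding dfn_def
  proof (intro exI[of _ \<phi>] exI[of _ "\<sigma> \<circ> \<rho>"] conjI allI impI)
    show "(\<sigma> \<circ> \<rho>) ` fv \<phi> \<subseteq> D" using * assms by fastforce
    fix e assume "e ` D \<subseteq> dom M"
    then have "(\<lambda>i. e (\<sigma> i)) ` C \<subseteq> dom M" using assms by fastforce
    then show "P (\<lambda>i. e (\<sigma> i)) = sat M (e \<circ> (\<sigma> \<circ> \<rho>)) \<phi>" using *(3) by (simp add: o_def)
  qed (fact *)
qed

lemma dfn_mono: "dfn C P \<Longrightarrow> C \<subseteq> D \<Longrightarrow> dfn D P"
  using dfn_reindex[of C P id D] by simp

lemma dfn_support:
  assumes "dfn C P" "e ` C \<subseteq> dom M" "\<And>i. i \<in> C \<Longrightarrow> e i = e' i"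
  shows "P e = P e'"
proof -
  obtain \<phi> \<rho> where *: "wf_fm L \<phi>" "\<rho> ` fv \<phi> \<subseteq> C" "\<And>e. e ` C \<subseteq> dom M \<Longrightarrow> P e = sat M (e \<circ> \<rho>) \<phi>"
    using assms(1) unfolding dfn_def by blast
  have "sat M (e \<circ> \<rho>) \<phi> = sat M (e' \<circ> \<rho>) \<phi>"
    using * assms by (intro sat_cong) auto
  moreover have "e' ` C \<subseteq> dom M" using assms by force
  ultimately show ?thesis using *(3) assms(2) by simp
qed

lemma dfn_not: "dfn C P \<Longrightarrow> dfn C (\<lambda>e. \<not> P e)"
  unfolding dfn_def by (metis fv.simps(3) sat.simps(3) wf_fm.simps(3))

lemma dfn_conj:
  assumes "dfn C P" "dfn C Q"
  shows "dfn C (\<lambda>e. P e \<and> Q e)"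
proof -
  obtain \<phi> \<rho> where P: "wf_fm L \<phi>" "\<rho> ` fv \<phi> \<subseteq> C" "\<And>e. e ` C \<subseteq> dom M \<Longrightarrow> P e = sat M (e \<circ> \<rho>) \<phi>"
    using assms(1) unfolding dfn_def by blast
  obtain \<psi> \<rho>' where Q: "wf_fm L \<psi>" "\<rho>' ` fv \<psi> \<subseteq> C" "\<And>e. e ` C \<subseteq> dom M \<Longrightarrow> Q e = sat M (e \<circ> \<rho>') \<psi>"
    using assms(2) unfolding dfn_def by blast
  \<comment> \<open>Coding by \<open>Inl\<close> and \<open>Inr\<close> makes the variables of the
    two formulas disjoint, so that \<open>\<rho>\<close> and \<open>\<rho>'\<close> can be glued
    into one attachment \<open>r\<close>.\<close>
  define r where "r = (\<lambda>n::nat. case sum_decode n of Inl m \<Rightarrow> \<rho> m | Inr m \<Rightarrow> \<rho>' m)"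
  have inj: "inj (\<lambda>n::nat. sum_encode (Inl n))" "inj (\<lambda>n::nat. sum_encode (Inr n))"
    by (auto simp: inj_def inj_eq[OF inj_sum_encode[of UNIV]])
  have r: "r (sum_encode (Inl n)) = \<rho> n" "r (sum_encode (Inr n)) = \<rho>' n" for n
    by (simp_all add: r_def)
  show ?thesis unfolding dfn_def
    using P Q
    by (intro exI[of _ "Conj (ren (\<lambda>n. sum_encode (Inl n)) \<phi>) (ren (\<lambda>n. sum_encode (Inr n)) \<psi>)"] exI[of _ r])
      (auto simp: wf_ren fv_ren[OF inj(1)] fv_ren[OF inj(2)] sat_ren[OF inj(1)] sat_ren[OF inj(2)] r o_def)
qed

lemma dfn_imp: "dfn C P \<Longrightarrow> dfn C Q \<Longrightarrow> dfn C (\<lambda>e. P e \<longrightarrow> Q e)"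
  using dfn_not[OF dfn_conj[OF _ dfn_not]] by (rule dfn_cong) auto

lemma dfn_iff: "dfn C P \<Longrightarrow> dfn C Q \<Longrightarrow> dfn C (\<lambda>e. P e \<longleftrightarrow> Q e)"
  using dfn_conj[OF dfn_imp[of C P Q] dfn_imp[of C Q P]] by (rule dfn_cong) auto

lemma dfn_eval_eq:
  assumes "wf_trm L \<tau>" "s ` fv_trm \<tau> \<subseteq> C" "i \<in> C"
  shows "dfn C (\<lambda>e. e i = eval M (\<lambda>v. e (s v)) \<tau>)"
proof -
  \<comment> \<open>Variable 0 is attached to \<open>i\<close>; the variables of
    \<open>\<tau>\<close> are shifted by \<open>Suc\<close> to make room for it.\<close>
  have "dfn C (\<lambda>e. sat M (e \<circ> case_nat i s) (Eq (Var 0) (subst_trm (Var \<circ> Suc) \<tau>)))"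
    using assms by (intro dfn_sat) (auto simp: fv_subst_trm intro!: wf_subst_trm)
  then show ?thesis by (rule dfn_cong) (auto simp: eval_subst_trm)
qed

lemma dfn_eq: "i \<in> C \<Longrightarrow> j \<in> C \<Longrightarrow> dfn C (\<lambda>e. e i = e j)"
  using dfn_eval_eq[of "Var 0" "\<lambda>_. j" C i] by simp

lemma dfn_lt:
  assumes "i \<in> C" "j \<in> C"
  shows "dfn C (\<lambda>e. lt L M (e i) (e j))"
proof -
  have "dfn C (\<lambda>e. sat M (e \<circ> (\<lambda>n. if n = 0 then i else j)) (Rel (ltsym L) [Var 0, Var 1]))"
    using assms lang by (intro dfn_sat) (auto simp: language_def)
  then show ?thesis by (rule dfn_cong) (auto simp: lt_def)
qed

text \<open>\<open>C\<close> may be empty, so a formula without free variables is required; the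
  sentence chosen is true because \<open>dom M\<close> is nonempty.\<close>

lemma dfn_True: "dfn C (\<lambda>e. True)"
proof -
  have "dfn C (\<lambda>e. sat M (e \<circ> (\<lambda>_. undefined)) (Ex 0 (Eq (Var 0) (Var 0))))"
    by (intro dfn_sat) auto
  then show ?thesis by (rule dfn_cong) (use dom_nonempty in auto)
qed

lemma dfn_Ball: "finite Q \<Longrightarrow> (\<And>q. q \<in> Q \<Longrightarrow> dfn C (P q)) \<Longrightarrow> dfn C (\<lambda>e. \<forall>q\<in>Q. P q e)"
  by (induction Q rule: finite_induct) (auto simp: dfn_True intro: dfn_conj)

text \<open>Variables attached to one index are identified with a single representative. Blocks of
  indices then correspond to blocks of distinct variables, as block quantification and the scheme
  presuppose.\<close>

lemma dfn_inj:
  assumes "dfn C P"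
  obtains \<phi> \<rho> where "wf_fm L \<phi>" "\<rho> ` fv \<phi> \<subseteq> C" "inj_on \<rho> (fv \<phi>)"
    "\<And>e. e ` C \<subseteq> dom M \<Longrightarrow> P e = sat M (e \<circ> \<rho>) \<phi>"
proof -
  obtain \<phi> \<rho> where *: "wf_fm L \<phi>" "\<rho> ` fv \<phi> \<subseteq> C" "\<And>e. e ` C \<subseteq> dom M \<Longrightarrow> P e = sat M (e \<circ> \<rho>) \<phi>"
    using assms(1) unfolding dfn_def by blast
  \<comment> \<open>\<open>w v\<close> is the chosen representative of the variables sharing the
    index of \<open>v\<close>, and \<open>S\<close> consists of the variables to be
    replaced.\<close>
  define w where "w v = inv_into (fv \<phi>) \<rho> (\<rho> v)" for v
  define S where "S = {v \<in> fv \<phi>. w v \<noteq> v}"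
  have w: "w v \<in> fv \<phi>" "\<rho> (w v) = \<rho> v" if "v \<in> fv \<phi>" for v
    using that by (auto simp: w_def inv_into_into f_inv_into_f)
  have ww: "w (w v) = w v" if "v \<in> fv \<phi>" for v
    using w(2)[OF that] by (simp add: w_def)
  have S: "finite S" "S \<inter> w ` S = {}"
    using finite_fv[of \<phi>] ww by (auto simp: S_def)
  then obtain \<psi> where \<psi>: "wf_fm L \<psi>" "fv \<psi> \<subseteq> fv \<phi> - S \<union> w ` S"
    "\<And>e. e ` w ` S \<subseteq> dom M \<Longrightarrow> sat M e \<psi> = sat M (\<lambda>v. if v \<in> S then e (w v) else e v) \<phi>"
    using identify_variables[OF S *(1), of M] by blast
  have fix': "w v = v \<and> v \<in> fv \<phi>" if "v \<in> fv \<psi>" for v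
    using \<psi>(2) that ww w by (auto simp: S_def)
  show thesis
  proof (rule that[OF \<psi>(1), of \<rho>])
    show "\<rho> ` fv \<psi> \<subseteq> C" using fix' *(2) by blast
    show "inj_on \<rho> (fv \<psi>)"
      by (rule inj_onI) (metis fix' w_def)
    fix e assume e: "e ` C \<subseteq> dom M"
    have "sat M (e \<circ> \<rho>) \<psi> = sat M (\<lambda>v. if v \<in> S then (e \<circ> \<rho>) (w v) else (e \<circ> \<rho>) v) \<phi>"
      using e w *(2) by (intro \<psi>(3)) (force simp: S_def)
    also have "\<dots> = sat M (e \<circ> \<rho>) \<phi>"
      using w by (intro sat_cong) (auto simp: S_def)
    finally show "P e = sat M (e \<circ> \<rho>) \<psi>" using *(3)[OF e] by simp
  qed
qed

text \<open>All indices of \<open>T\<close> are quantified at once, even if \<open>T\<close> is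
  infinite, since the formula sees only finitely many of them. Injectivity of the attachment turns
  values for variables into values for indices.\<close>

lemma dfn_ex:
  assumes "dfn (Inl ` C \<union> Inr ` T) P"
  shows "dfn C (\<lambda>e. \<exists>t. t ` T \<subseteq> dom M \<and> P (case_sum e t))"
proof -
  obtain \<phi> \<rho> where *: "wf_fm L \<phi>" "\<rho> ` fv \<phi> \<subseteq> Inl ` C \<union> Inr ` T" "inj_on \<rho> (fv \<phi>)"
    "\<And>e. e ` (Inl ` C \<union> Inr ` T) \<subseteq> dom M \<Longrightarrow> P e = sat M (e \<circ> \<rho>) \<phi>"
    using dfn_inj[OF assms] by blast
  define S where "S = {v \<in> fv \<phi>. \<rho> v \<in> Inr ` T}"
  obtain a0 where a0: "a0 \<in> dom M" using dom_nonempty by blast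
  have finS: "finite S" using finite_fv[of \<phi>] by (auto simp: S_def)
  obtain \<psi> where \<psi>: "wf_fm L \<psi>" "fv \<psi> = fv \<phi> - S"
    "\<And>e. sat M e \<psi> = (\<exists>t. t ` S \<subseteq> dom M \<and> sat M (\<lambda>v. if v \<in> S then t v else e v) \<phi>)"
    using exists_block_formula[OF finS *(1), of M] by blast
  define r where "r = projl \<circ> \<rho>"
  have r: "\<rho> v = Inl (r v)" "r v \<in> C" if "v \<in> fv \<phi>" "v \<notin> S" for v
    using *(2) that by (auto simp: S_def r_def)
  have S: "\<exists>x\<in>T. \<rho> v = Inr x" if "v \<in> S" for v using that by (auto simp: S_def)
  show ?thesis unfolding dfn_def
  proof (intro exI[of _ \<psi>] exI[of _ r] conjI allI impI)
    show "r ` fv \<psi> \<subseteq> C" using r \<psi>(2) by auto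
    fix e assume e: "e ` C \<subseteq> dom M"
    have P: "P (case_sum e t) = sat M (case_sum e t \<circ> \<rho>) \<phi>" if "t ` T \<subseteq> dom M" for t
      using e that by (intro *(4)) auto
    show "(\<exists>t. t ` T \<subseteq> dom M \<and> P (case_sum e t)) = sat M (e \<circ> r) \<psi>"
    proof
      assume "\<exists>t. t ` T \<subseteq> dom M \<and> P (case_sum e t)"
      then obtain t where t: "t ` T \<subseteq> dom M" "sat M (case_sum e t \<circ> \<rho>) \<phi>" using P by auto
      have "sat M (\<lambda>v. if v \<in> S then (case_sum e t \<circ> \<rho>) v else (e \<circ> r) v) \<phi>"
        using t(2) r by (subst sat_cong[of _ _ "case_sum e t \<circ> \<rho>"]) auto
      moreover have "(case_sum e t \<circ> \<rho>) ` S \<subseteq> dom M" using t(1) S by fastforce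
      ultimately show "sat M (e \<circ> r) \<psi>" using \<psi>(3) by blast
    next
      assume "sat M (e \<circ> r) \<psi>"
      then obtain t where t: "t ` S \<subseteq> dom M" "sat M (\<lambda>v. if v \<in> S then t v else (e \<circ> r) v) \<phi>"
        using \<psi>(3) by blast
      \<comment> \<open>An index to which no variable of \<open>S\<close> is attached receives the
        default \<open>a0\<close>, which keeps \<open>t'\<close> inside
        \<open>dom M\<close>.\<close>
      define t' where "t' x = (if Inr x \<in> \<rho> ` S then t (inv_into S \<rho> (Inr x)) else a0)" for x
      have inj: "inj_on \<rho> S" using *(3) by (rule inj_on_subset) (auto simp: S_def)
      have t': "case_sum e t' (\<rho> v) = t v" if "v \<in> S" for v
        using S[OF that] that inj by (auto simp: t'_def) (metis inv_into_f_f rev_image_eqI)+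
      have "t' ` T \<subseteq> dom M"
        using t(1) a0 by (auto simp: t'_def intro!: inv_into_into)
          (metis (no_types, lifting) image_eqI image_subset_iff inv_into_into)
      moreover have "sat M (case_sum e t' \<circ> \<rho>) \<phi>"
        using t(2) t' r by (subst sat_cong[of _ _ "\<lambda>v. if v \<in> S then t v else (e \<circ> r) v"]) auto
      ultimately show "\<exists>t. t ` T \<subseteq> dom M \<and> P (case_sum e t)" using P by blast
    qed
  qed (fact \<psi>)
qed

lemma dfn_all:
  assumes "dfn (Inl ` C \<union> Inr ` T) P"
  shows "dfn C (\<lambda>e. \<forall>t. t ` T \<subseteq> dom M \<longrightarrow> P (case_sum e t))"
  using dfn_not[OF dfn_ex[OF dfn_not[OF assms]]] by (rule dfn_cong) auto

end

section \<open>The inaccessibility scheme for definable predicates\<close>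

context lt_structure
begin

abbreviation less (infix "\<prec>" 50) where
  "a \<prec> b \<equiv> lt L M a b"

abbreviation below :: "'a \<Rightarrow> 'a set" where
  "below z \<equiv> {u \<in> dom M. u \<prec> z}"

text \<open>The counterpart of \<open>E_phi\<close> for definable predicates: the left part of the
  index type carries the compared tuples, the right part the bounded parameters.\<close>

definition E :: "'t set \<Rightarrow> (('x + 't \<Rightarrow> 'a) \<Rightarrow> bool) \<Rightarrow> ('x \<Rightarrow> 'a) \<Rightarrow> ('x \<Rightarrow> 'a) \<Rightarrow> 'a \<Rightarrow> bool" where
  "E T P x y z \<longleftrightarrow> (\<forall>t. t ` T \<subseteq> below z \<longrightarrow> P (case_sum x t) = P (case_sum y t))"

definition split_sat :: "fm \<Rightarrow> nat set \<Rightarrow> (nat + nat \<Rightarrow> 'a) \<Rightarrow> bool" where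
  "split_sat \<phi> F e = sat M (\<lambda>v. if v \<in> F then e (Inl v) else e (Inr v)) \<phi>"

text \<open>This says that \<open>z'\<close> is a witness at \<open>z\<close> for the instance of
  the inaccessibility scheme given by \<open>\<phi>\<close>, where \<open>F\<close> selects the
  variables that form the tuple.\<close>

definition W :: "fm \<Rightarrow> nat set \<Rightarrow> 'a \<Rightarrow> 'a \<Rightarrow> bool" where
  "W \<phi> F z z' \<longleftrightarrow> z \<prec> z' \<and> (\<forall>y. y ` (F \<inter> fv \<phi>) \<subseteq> dom M \<longrightarrow>
     (\<exists>y'. y' ` (F \<inter> fv \<phi>) \<subseteq> below z' \<and> E (fv \<phi> - F) (split_sat \<phi> F) y y' z))"

definition ll :: "'a \<Rightarrow> 'a \<Rightarrow> bool" (infix "\<lless>" 50) where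
  "z \<lless> z' \<longleftrightarrow> (\<forall>\<phi> F. wf_fm L \<phi> \<longrightarrow> W \<phi> F z z')"

lemma ED: "E T P x y z \<Longrightarrow> t ` T \<subseteq> below z \<Longrightarrow> P (case_sum x t) = P (case_sum y t)"
  by (simp add: E_def)

lemma E_sym: "E T P x y z \<Longrightarrow> E T P y x z"
  by (simp add: E_def)

lemma E_trans: "E T P x y z \<Longrightarrow> E T P y w z \<Longrightarrow> E T P x w z"
  by (simp add: E_def)

lemma E_support:
  assumes "dfn (Inl ` V \<union> Inr ` T) P" "x ` V \<subseteq> dom M" "y ` V \<subseteq> dom M"
    "\<And>v. v \<in> V \<Longrightarrow> x v = x' v" "\<And>v. v \<in> V \<Longrightarrow> y v = y' v" "E T P x y z"
  shows "E T P x' y' z"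
  unfolding E_def
proof (intro allI impI)
  fix t assume t: "t ` T \<subseteq> below z"
  have "P (case_sum x t) = P (case_sum x' t)" "P (case_sum y t) = P (case_sum y' t)"
    using assms t by (auto intro!: dfn_support[OF assms(1)])
  then show "P (case_sum x' t) = P (case_sum y' t)" using ED[OF assms(6) t] by simp
qed

lemma WD:
  assumes "W \<phi> F z z'" "y ` (F \<inter> fv \<phi>) \<subseteq> dom M"
  shows "\<exists>y'. y' ` (F \<inter> fv \<phi>) \<subseteq> below z' \<and> E (fv \<phi> - F) (split_sat \<phi> F) y y' z"
  using assms(1)[unfolded W_def, THEN conjunct2, rule_format, OF assms(2)] .

text \<open>Finiteness of \<open>T\<close> makes the bound on the parameters a finite conjunction.
  The maps \<open>a\<close>, \<open>b\<close> and the index \<open>c\<close> allow each component to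
  become a parameter or an unknown later.\<close>

lemma dfn_E:
  assumes P: "dfn (Inl ` V \<union> Inr ` T) P" and "finite T" "a ` V \<subseteq> C" "b ` V \<subseteq> C" "c \<in> C"
  shows "dfn C (\<lambda>e. E T P (\<lambda>v. e (a v)) (\<lambda>v. e (b v)) (e c))"
proof -
  have re: "dfn (Inl ` C \<union> Inr ` T) (\<lambda>e. P (case_sum (\<lambda>v. e (Inl (f v))) (\<lambda>v. e (Inr v))))"
    if "f ` V \<subseteq> C" for f
  proof -
    have "dfn (Inl ` C \<union> Inr ` T) (\<lambda>e. P (\<lambda>i. e (case_sum (Inl \<circ> f) Inr i)))"
      using that by (intro dfn_reindex[OF P]) auto
    then show ?thesis by (rule dfn_cong) (auto intro!: arg_cong[where f = P] split: sum.split)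
  qed
  have "dfn (Inl ` C \<union> Inr ` T) (\<lambda>e. (\<forall>i\<in>T. e (Inr i) \<prec> e (Inl c)) \<longrightarrow>
     (P (case_sum (\<lambda>v. e (Inl (a v))) (\<lambda>v. e (Inr v))) \<longleftrightarrow>
      P (case_sum (\<lambda>v. e (Inl (b v))) (\<lambda>v. e (Inr v)))))"
    using assms by (intro dfn_imp dfn_iff dfn_Ball dfn_lt re) auto
  from dfn_all[OF this] show ?thesis
    by (rule dfn_cong) (auto simp: E_def image_subset_iff)
qed

lemma dfn_split_sat:
  "wf_fm L \<phi> \<Longrightarrow> dfn (Inl ` (F \<inter> fv \<phi>) \<union> Inr ` (fv \<phi> - F)) (split_sat \<phi> F)"
  by (rule dfn_cong[OF dfn_sat[of \<phi> "\<lambda>v. if v \<in> F then Inl v else Inr v"]])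
    (auto simp: split_sat_def o_def if_distrib[of "_ :: _ \<Rightarrow> 'a"] intro!: sat_cong)

text \<open>\<open>\<lless>\<close> is the conjunction of all \<open>W \<phi> F\<close>;
  definability of each conjunct puts it within reach of saturation.\<close>

lemma dfn_W:
  assumes "wf_fm L \<phi>" "i \<in> C" "j \<in> C"
  shows "dfn C (\<lambda>e. W \<phi> F (e i) (e j))"
proof -
  let ?F = "F \<inter> fv \<phi>"
  let ?C = "Inl ` C \<union> Inr ` ?F"
  have "dfn (Inl ` ?C \<union> Inr ` ?F) (\<lambda>e. (\<forall>v\<in>?F. e (Inr v) \<prec> e (Inl (Inl j))) \<and>
    E (fv \<phi> - F) (split_sat \<phi> F) (\<lambda>v. e (Inl (Inr v))) (\<lambda>v. e (Inr v)) (e (Inl (Inl i))))"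
    using assms finite_fv[of \<phi>]
    by (intro dfn_conj dfn_Ball dfn_lt dfn_E[OF dfn_split_sat]) auto
  from dfn_conj[OF dfn_lt[OF assms(2,3)] dfn_all[OF dfn_ex[OF this]]] show ?thesis
    by (rule dfn_cong) (simp add: W_def image_subset_iff ball_conj_distrib conj_assoc)
qed

end

section \<open>The scheme in a linearly ordered saturated model\<close>

lemma assign_append_map:
  assumes "distinct (xs @ ts)" "v \<in> set (xs @ ts)"
  shows "assign M (xs @ ts) (map f xs @ map g ts) v = (if v \<in> set xs then f v else g v)"
  using assms by (auto simp: assign_def zip_append map_add_def map_of_zip_map)

lemma list_eq_map_lookup:
  assumes "distinct xs" "length ys = length xs"
  shows "ys = map (\<lambda>v. the (map_of (zip xs ys) v)) xs"
  using assms by (auto intro!: nth_equalityI simp: map_of_zip_nth)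

locale saturated_model = lt_structure L M for L and M :: "'a struc" +
  fixes \<kappa> :: "'k rel"
  assumes irrefl: "a \<in> dom M \<Longrightarrow> \<not> a \<prec> a"
    and trans: "a \<in> dom M \<Longrightarrow> b \<in> dom M \<Longrightarrow> c \<in> dom M \<Longrightarrow> a \<prec> b \<Longrightarrow> b \<prec> c \<Longrightarrow> a \<prec> c"
    and total: "a \<in> dom M \<Longrightarrow> b \<in> dom M \<Longrightarrow> a \<prec> b \<or> a = b \<or> b \<prec> a"
    and scheme: "wf_fm L \<phi> \<Longrightarrow> distinct (xs @ ts) \<Longrightarrow> fv \<phi> \<subseteq> set xs \<union> set ts \<Longrightarrow> z0 \<in> dom M \<Longrightarrow>
       \<exists>z1\<in>dom M. z0 \<prec> z1 \<and>
          (\<forall>ys0. length ys0 = length xs \<and> set ys0 \<subseteq> dom M \<longrightarrow>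
             (\<exists>ys1. length ys1 = length xs \<and> set ys1 \<subseteq> dom M \<and> (\<forall>y\<in>set ys1. y \<prec> z1) \<and>
                 E_phi L M \<phi> xs ts ys0 ys1 z0))"
    and card: "Card_order \<kappa>" "infinite (Field \<kappa>)"
    and saturated: "saturated L \<kappa> M"
begin

text \<open>Enumerating \<open>F \<inter> fv \<phi>\<close> and \<open>fv \<phi> - F\<close> as
  lists turns the scheme, which speaks of lists of values, into the statement about
  assignments.\<close>

lemma scheme_W:
  assumes \<phi>: "wf_fm L \<phi>" and z: "z \<in> dom M"
  shows "\<exists>z'\<in>dom M. W \<phi> F z z'"
proof -
  define xs ts where "xs = sorted_list_of_set (F \<inter> fv \<phi>)" and "ts = sorted_list_of_set (fv \<phi> - F)"
  have xs: "set xs = F \<inter> fv \<phi>" "set ts = fv \<phi> - F" "distinct (xs @ ts)"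
    using finite_fv[of \<phi>] by (auto simp: xs_def ts_def)
  have as: "sat M (assign M (xs @ ts) (map y xs @ map t ts)) \<phi> = split_sat \<phi> F (case_sum y t)" for y t
    unfolding split_sat_def
    by (intro sat_cong) (auto simp: assign_append_map[OF xs(3)] xs)
  have fvs: "fv \<phi> \<subseteq> set xs \<union> set ts" using xs by auto
  obtain z' where z': "z' \<in> dom M" "z \<prec> z'"
    "\<forall>ys0. length ys0 = length xs \<and> set ys0 \<subseteq> dom M \<longrightarrow>
       (\<exists>ys1. length ys1 = length xs \<and> set ys1 \<subseteq> dom M \<and> (\<forall>y\<in>set ys1. y \<prec> z') \<and>
                 E_phi L M \<phi> xs ts ys0 ys1 z)"
    using scheme[OF \<phi> xs(3) fvs z] by blast
  have "W \<phi> F z z'"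
    unfolding W_def
  proof (intro conjI allI impI z'(2))
    fix y assume y: "y ` (F \<inter> fv \<phi>) \<subseteq> dom M"
    obtain ys where ys: "length ys = length xs" "set ys \<subseteq> dom M" "\<forall>y\<in>set ys. y \<prec> z'"
      "E_phi L M \<phi> xs ts (map y xs) ys z"
      using z'(3)[rule_format, of "map y xs"] y xs(1) by auto
    define y' where "y' v = the (map_of (zip xs ys) v)" for v
    have y': "ys = map y' xs"
      unfolding y'_def using xs(3) ys(1) by (intro list_eq_map_lookup) auto
    have "E (fv \<phi> - F) (split_sat \<phi> F) y y' z"
      unfolding E_def
    proof (intro allI impI)
      fix t assume "t ` (fv \<phi> - F) \<subseteq> below z"
      then have "length (map t ts) = length ts \<and> set (map t ts) \<subseteq> dom M \<and> (\<forall>u\<in>set (map t ts). u \<prec> z)"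
        using xs by auto
      with ys(4) show "split_sat \<phi> F (case_sum y t) = split_sat \<phi> F (case_sum y' t)"
        unfolding E_phi_def y' as[symmetric] by blast
    qed
    moreover have "y' ` (F \<inter> fv \<phi>) \<subseteq> below z'"
      using ys unfolding y' using xs by auto
    ultimately show "\<exists>y'. y' ` (F \<inter> fv \<phi>) \<subseteq> below z' \<and> E (fv \<phi> - F) (split_sat \<phi> F) y y' z"
      by blast
  qed
  with z' show ?thesis by blast
qed

lemma below_mono: "a \<in> dom M \<Longrightarrow> b \<in> dom M \<Longrightarrow> a \<prec> b \<or> a = b \<Longrightarrow> below a \<subseteq> below b"
  using trans by blast

lemma E_mono:
  assumes "E T P x y b" "a \<in> dom M" "b \<in> dom M" "a \<prec> b \<or> a = b"
  shows "E T P x y a"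
  using assms(1) below_mono[OF assms(2-4)] unfolding E_def by simp

lemma W_mono:
  assumes "W \<phi> F b c" "a \<in> dom M" "b \<in> dom M" "c \<in> dom M" "d \<in> dom M" "a \<prec> b \<or> a = b" "c \<prec> d \<or> c = d"
  shows "W \<phi> F a d"
  unfolding W_def
proof (intro conjI allI impI)
  have "b \<prec> c" using assms(1) by (simp add: W_def)
  then have "a \<prec> c" using assms trans[of a b c] by auto
  then show "a \<prec> d" using assms trans[of a c d] by auto
  fix y assume "y ` (F \<inter> fv \<phi>) \<subseteq> dom M"
  then obtain y' where y': "y' ` (F \<inter> fv \<phi>) \<subseteq> below c" "E (fv \<phi> - F) (split_sat \<phi> F) y y' b"
    using WD[OF assms(1)] by metis
  show "\<exists>y'. y' ` (F \<inter> fv \<phi>) \<subseteq> below d \<and> E (fv \<phi> - F) (split_sat \<phi> F) y y' a"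
    using y' E_mono[OF y'(2) assms(2,3,6)] below_mono[OF assms(4,5,7)]
    by (intro exI[of _ y'] conjI) simp_all
qed

lemma ll_mono:
  assumes "b \<lless> c" "a \<in> dom M" "b \<in> dom M" "c \<in> dom M" "d \<in> dom M" "a \<prec> b \<or> a = b" "c \<prec> d \<or> c = d"
  shows "a \<lless> d"
  using assms(1) W_mono[OF _ assms(2-7)] unfolding ll_def by simp

lemma ll_less: "a \<lless> b \<Longrightarrow> a \<prec> b"
  unfolding ll_def W_def using wf_fm.simps(1)[of L "Var 0" "Var 0"] by (metis wf_trm.simps(1))

text \<open>\<open>\<lless>\<close> is stated for formulas; an injective attachment carries it over
  to definable predicates on arbitrary, possibly infinite, blocks of indices.\<close>

lemma ll_E:
  fixes P :: "('x + 't \<Rightarrow> 'a) \<Rightarrow> bool"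
  assumes ll: "z \<lless> z'" and P: "dfn (Inl ` V \<union> Inr ` T) P" and x: "x ` V \<subseteq> dom M" and z: "z \<in> dom M"
  shows "\<exists>x'. x' ` V \<subseteq> below z' \<and> E T P x x' z"
proof -
  obtain \<phi> \<rho> where \<phi>: "wf_fm L \<phi>" "\<rho> ` fv \<phi> \<subseteq> Inl ` V \<union> Inr ` T" "inj_on \<rho> (fv \<phi>)"
    "\<And>e. e ` (Inl ` V \<union> Inr ` T) \<subseteq> dom M \<Longrightarrow> P e = sat M (e \<circ> \<rho>) \<phi>"
    using dfn_inj[OF P] by metis
  define F where "F = {v \<in> fv \<phi>. \<rho> v \<in> Inl ` V}"
  define y where "y v = x (projl (\<rho> v))" for v
  have F: "\<exists>i\<in>V. \<rho> v = Inl i" if "v \<in> F" for v using that by (auto simp: F_def)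
  have T: "\<exists>i\<in>T. \<rho> v = Inr i" if "v \<in> fv \<phi>" "v \<notin> F" for v using that \<phi>(2) by (auto simp: F_def)
  have "y v \<in> dom M" if "v \<in> F" for v using F[OF that] x by (auto simp: y_def)
  then have "y ` (F \<inter> fv \<phi>) \<subseteq> dom M" by blast
  with WD[of \<phi> F z z' y] obtain y' where
    y': "y' ` (F \<inter> fv \<phi>) \<subseteq> below z'" "E (fv \<phi> - F) (split_sat \<phi> F) y y' z"
    using ll \<phi>(1) unfolding ll_def by metis
  \<comment> \<open>Indices met by no variable are given the value \<open>z\<close>, which is
    legitimate because \<open>z \<lless> z'\<close> entails \<open>z \<prec> z'\<close>.\<close>
  define x' where "x' i = (if Inl i \<in> \<rho> ` F then y' (inv_into F \<rho> (Inl i)) else z)" for i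
  have inj: "inj_on \<rho> F" using \<phi>(3) by (rule inj_on_subset) (auto simp: F_def)
  have x': "x' i = y' v" if "v \<in> F" "\<rho> v = Inl i" for v i
  proof -
    have "inv_into F \<rho> (Inl i) = v" using inv_into_f_f[OF inj that(1)] that(2) by simp
    moreover have "Inl i \<in> \<rho> ` F" using that by (metis imageI)
    ultimately show ?thesis by (simp add: x'_def)
  qed
  have x'V: "x' i \<in> below z'" for i
  proof (cases "Inl i \<in> \<rho> ` F")
    case True
    then obtain v where "v \<in> F" "\<rho> v = Inl i" by (metis imageE)
    moreover have "v \<in> F \<inter> fv \<phi>" using \<open>v \<in> F\<close> by (auto simp: F_def)
    ultimately show ?thesis using x' y'(1) by (simp add: image_subset_iff)
  next
    case False
    then show ?thesis using z ll_less[OF ll] by (simp add: x'_def)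
  qed
  have "E T P x x' z"
    unfolding E_def
  proof (intro allI impI)
    fix t assume t: "t ` T \<subseteq> below z"
    define t' where "t' v = t (projr (\<rho> v))" for v
    have "t' v \<in> below z" if "v \<in> fv \<phi>" "v \<notin> F" for v using T[OF that] t by (auto simp: t'_def)
    then have "t' ` (fv \<phi> - F) \<subseteq> below z" by blast
    from ED[OF y'(2) this]
    have "split_sat \<phi> F (case_sum y t') = split_sat \<phi> F (case_sum y' t')" .
    moreover have "P (case_sum x t) = split_sat \<phi> F (case_sum y t')"
    proof -
      have "P (case_sum x t) = sat M (case_sum x t \<circ> \<rho>) \<phi>" using x t by (intro \<phi>(4)) auto
      also have "\<dots> = split_sat \<phi> F (case_sum y t')"
        unfolding split_sat_def by (intro sat_cong) (auto simp: y_def t'_def dest: F T)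
      finally show ?thesis .
    qed
    moreover have "P (case_sum x' t) = split_sat \<phi> F (case_sum y' t')"
    proof -
      have "P (case_sum x' t) = sat M (case_sum x' t \<circ> \<rho>) \<phi>" using x'V t by (intro \<phi>(4)) auto
      also have "\<dots> = split_sat \<phi> F (case_sum y' t')"
        unfolding split_sat_def
      proof (intro sat_cong)
        fix v assume v: "v \<in> fv \<phi>"
        show "(case_sum x' t \<circ> \<rho>) v = (if v \<in> F then case_sum y' t' (Inl v) else case_sum y' t' (Inr v))"
        proof (cases "v \<in> F")
          case True
          with F obtain i where "\<rho> v = Inl i" by blast
          with x'[OF True] True show ?thesis by simp
        next
          case False
          with T[OF v] show ?thesis by (auto simp: t'_def)
        qed
      qed
      finally show ?thesis .
    qed
    ultimately show "P (case_sum x t) = P (case_sum x' t)" by simp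
  qed
  then show ?thesis using x'V by (intro exI[of _ x'] conjI image_subsetI)
qed

section \<open>Saturation for definable predicates\<close>

lemma finite_ordLess: "finite A \<Longrightarrow> |A| <o \<kappa>"
  using card finite_ordLess_infinite[of "|A|" \<kappa>] card_of_Well_order[of A]
  by (auto simp: Field_card_of card_order_on_well_order_on)

text \<open>Parameters are their own indices, evaluated by \<open>id\<close>; the unknown is the
  single index \<open>Inl ()\<close>. The definition of saturation wants instead a formula with
  unknown 0 and an assignment of the parameters.\<close>

lemma realize1:
  fixes \<Sigma> :: "((unit + 'a \<Rightarrow> 'a) \<Rightarrow> bool) set"
  assumes A: "A \<subseteq> dom M" "|A| <o \<kappa>"
    and \<Sigma>: "\<And>P. P \<in> \<Sigma> \<Longrightarrow> dfn (range Inl \<union> Inr ` A) P"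
    and fin: "\<And>Q. Q \<subseteq> \<Sigma> \<Longrightarrow> finite Q \<Longrightarrow> \<exists>a\<in>dom M. \<forall>P\<in>Q. P (case_sum (\<lambda>_. a) id)"
  shows "\<exists>a\<in>dom M. \<forall>P\<in>\<Sigma>. P (case_sum (\<lambda>_. a) id)"
proof -
  have "\<exists>\<phi> e. wf_fm L \<phi> \<and> (\<forall>v\<in>fv \<phi> - {0}. e v \<in> A) \<and>
    (\<forall>a\<in>dom M. P (case_sum (\<lambda>_. a) id) = sat M (e(0 := a)) \<phi>)" if PS: "P \<in> \<Sigma>" for P
  proof -
    obtain \<phi> \<rho> where \<phi>: "wf_fm L \<phi>" "\<rho> ` fv \<phi> \<subseteq> range Inl \<union> Inr ` A"
      "\<And>e. e ` (range Inl \<union> Inr ` A) \<subseteq> dom M \<Longrightarrow> P e = sat M (e \<circ> \<rho>) \<phi>"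
      using \<Sigma>[OF PS] unfolding dfn_def by blast
    \<comment> \<open>Renaming by \<open>Suc\<close> frees variable 0; \<open>S\<close> collects the
      renamed variables that stand for the unknown, and these are then merged into 0.\<close>
    define S where "S = Suc ` {v \<in> fv \<phi>. \<rho> v \<in> range Inl}"
    have S: "finite S" "S \<inter> (\<lambda>_. 0) ` S = {}" using finite_fv[of \<phi>] by (auto simp: S_def)
    obtain \<psi> where \<psi>: "wf_fm L \<psi>" "fv \<psi> \<subseteq> fv (ren Suc \<phi>) - S \<union> (\<lambda>_. 0) ` S"
      "\<And>e. e ` (\<lambda>_. 0) ` S \<subseteq> dom M \<Longrightarrow>
        sat M e \<psi> = sat M (\<lambda>v. if v \<in> S then e 0 else e v) (ren Suc \<phi>)"
      using identify_variables[OF S wf_ren[OF \<phi>(1)], where M = M] by blast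
    define e where "e v = (case \<rho> (v - 1) of Inl _ \<Rightarrow> undefined | Inr a \<Rightarrow> a)" for v
    have "\<forall>v\<in>fv \<psi> - {0}. e v \<in> A"
    proof
      fix v assume "v \<in> fv \<psi> - {0}"
      then have "v \<in> Suc ` fv \<phi>" "v \<notin> S" using \<psi>(2) by (auto simp: fv_ren)
      then show "e v \<in> A" using \<phi>(2) by (auto simp: S_def e_def image_subset_iff split: sum.splits)
    qed
    moreover have "P (case_sum (\<lambda>_. a) id) = sat M (e(0 := a)) \<psi>" if a: "a \<in> dom M" for a
    proof -
      have "sat M (e(0 := a)) \<psi> =
        sat M (\<lambda>v. if v \<in> S then (e(0 := a)) 0 else (e(0 := a)) v) (ren Suc \<phi>)"
        using a by (intro \<psi>(3)) auto
      also have "\<dots> = sat M (case_sum (\<lambda>_. a) id \<circ> \<rho>) \<phi>"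
        unfolding sat_ren[OF inj_Suc]
        using \<phi>(2) by (intro sat_cong) (auto simp: S_def e_def split: sum.splits)
      also have "\<dots> = P (case_sum (\<lambda>_. a) id)" using a A by (intro \<phi>(3)[symmetric]) auto
      finally show ?thesis by simp
    qed
    ultimately show ?thesis using \<psi>(1) by blast
  qed
  then obtain f g where fg: "\<And>P. P \<in> \<Sigma> \<Longrightarrow> wf_fm L (f P)"
    "\<And>P v. P \<in> \<Sigma> \<Longrightarrow> v \<in> fv (f P) - {0} \<Longrightarrow> g P v \<in> A"
    "\<And>P a. P \<in> \<Sigma> \<Longrightarrow> a \<in> dom M \<Longrightarrow> P (case_sum (\<lambda>_. a) id) = sat M ((g P)(0 := a)) (f P)"
    by metis
  define p where "p P = (f P, g P)" for P
  have real: "(\<forall>(\<phi>, e)\<in>p ` Q. sat M (e(0 := a)) \<phi>) \<longleftrightarrow> (\<forall>P\<in>Q. P (case_sum (\<lambda>_. a) id))"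
    if "Q \<subseteq> \<Sigma>" "a \<in> dom M" for Q a
    using fg(3) that by (auto simp: p_def)
  have "\<exists>a\<in>dom M. \<forall>(\<phi>, e)\<in>p ` \<Sigma>. sat M (e(0 := a)) \<phi>"
  proof (rule saturated[unfolded saturated_def, rule_format, of A "p ` \<Sigma>"], intro conjI allI impI A)
    show "\<forall>(\<phi>, e)\<in>p ` \<Sigma>. wf_fm L \<phi> \<and> (\<forall>v\<in>fv \<phi> - {0}. e v \<in> A)"
      using fg(1,2) by (auto simp: p_def)
    fix q assume "q \<subseteq> p ` \<Sigma> \<and> finite q"
    then obtain Q where Q: "Q \<subseteq> \<Sigma>" "finite Q" "q = p ` Q" by (meson finite_subset_image)
    show "\<exists>a\<in>dom M. \<forall>(\<phi>, e)\<in>q. sat M (e(0 := a)) \<phi>"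
      using fin[OF Q(1,2)] real[OF Q(1)] unfolding Q(3) by blast
  qed
  then show ?thesis using real[of \<Sigma>] by blast
qed

end

section \<open>Realizing types in fewer than \<open>\<kappa>\<close> unknowns\<close>

lemma finite_greatest:
  assumes "finite B" "B \<noteq> {}" "trans R" "total_on B R"
  shows "\<exists>b\<in>B. \<forall>c\<in>B. c = b \<or> (c, b) \<in> R"
  using assms(1,2,4)
proof (induction B rule: finite_ne_induct)
  case (insert x B)
  then obtain b where b: "b \<in> B" "\<forall>c\<in>B. c = b \<or> (c, b) \<in> R"
    by (auto simp: total_on_def)
  have "(x, b) \<in> R \<or> (b, x) \<in> R" using insert b by (auto simp: total_on_def)
  then show ?case
  proof
    assume "(x, b) \<in> R"
    with b show ?thesis by blast
  next
    assume *: "(b, x) \<in> R"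
    have "(c, x) \<in> R" if "c \<in> B" for c using b(2) * that assms(3) by (metis transD)
    then show ?thesis by blast
  qed
qed auto

text \<open>The support is the image of the finitely many free variables, however large
  \<open>C\<close> is. This finiteness lets an invariant about finite sets of conditions pass limit
  stages.\<close>

lemma (in lt_structure) dfn_finite_support:
  assumes "dfn C P"
  shows "\<exists>C'\<subseteq>C. finite C' \<and> (\<forall>e e'. e ` C \<subseteq> dom M \<longrightarrow> e' ` C \<subseteq> dom M \<longrightarrow>
    (\<forall>i\<in>C'. e i = e' i) \<longrightarrow> P e = P e')"
proof -
  obtain \<phi> \<rho> where *: "wf_fm L \<phi>" "\<rho> ` fv \<phi> \<subseteq> C" "\<And>e. e ` C \<subseteq> dom M \<Longrightarrow> P e = sat M (e \<circ> \<rho>) \<phi>"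
    using assms unfolding dfn_def by blast
  show ?thesis
  proof (intro exI[of _ "\<rho> ` fv \<phi>"] conjI allI impI *(2))
    show "finite (\<rho> ` fv \<phi>)" using finite_fv by simp
    fix e e' assume e: "e ` C \<subseteq> dom M" "e' ` C \<subseteq> dom M" "\<forall>i\<in>\<rho> ` fv \<phi>. e i = e' i"
    have "sat M (e \<circ> \<rho>) \<phi> = sat M (e' \<circ> \<rho>) \<phi>" using e by (intro sat_cong) auto
    then show "P e = P e'" using e *(3) by simp
  qed
qed

context saturated_model
begin

text \<open>The unknowns are fixed one after another along a well-order of \<open>J\<close>. The
  value of unknown \<open>x\<close> realizes the 1-type saying that, together with the values
  already chosen, every finite part of \<open>\<Sigma>\<close> can still be completed; its
  parameters are \<open>A\<close> and the fewer than \<open>\<kappa>\<close> earlier values.\<close>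

lemma realize_tuple:
  fixes \<Sigma> :: "(('v + 'a \<Rightarrow> 'a) \<Rightarrow> bool) set"
  assumes A: "A \<subseteq> dom M" "|A| <o \<kappa>" and J: "|J| <o \<kappa>"
    and \<Sigma>: "\<And>P. P \<in> \<Sigma> \<Longrightarrow> dfn (Inl ` J \<union> Inr ` A) P"
    and fin: "\<And>Q. Q \<subseteq> \<Sigma> \<Longrightarrow> finite Q \<Longrightarrow>
      \<exists>X. X ` J \<subseteq> dom M \<and> (\<forall>P\<in>Q. P (case_sum X id))"
  shows "\<exists>X. range X \<subseteq> dom M \<and> (\<forall>P\<in>\<Sigma>. P (case_sum X id))"
proof -
  obtain a0 where a0: "a0 \<in> dom M" using dom_nonempty by blast
  define R where "R = |J| - Id"
  have wo: "Well_order |J|" "Field |J| = J" by (rule card_of_Well_order, rule Field_card_of)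
  have wf: "wf R" using wo unfolding R_def well_order_on_def by blast
  have tot: "\<beta> = \<gamma> \<or> (\<beta>, \<gamma>) \<in> R \<or> (\<gamma>, \<beta>) \<in> R" if "\<beta> \<in> J" "\<gamma> \<in> J" for \<beta> \<gamma>
    using wo that unfolding R_def well_order_on_def linear_order_on_def total_on_def by auto
  have trans: "trans R"
    using wo unfolding R_def well_order_on_def linear_order_on_def partial_order_on_def preorder_on_def
    by (auto intro: trans_diff_Id)
  define good where "good f x Y \<longleftrightarrow> Y ` J \<subseteq> dom M \<and> (\<forall>\<beta>. (\<beta>, x) \<in> R \<longrightarrow> Y \<beta> = f \<beta>)"
    for f :: "'v \<Rightarrow> 'a" and x Y
  \<comment> \<open>The invariant: with \<open>f\<close> before \<open>x\<close> and
    \<open>a\<close> at \<open>x\<close>, each finite part of \<open>\<Sigma>\<close> remains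
    satisfiable. For \<open>x\<close> outside \<open>J\<close> only membership in
    \<open>dom M\<close> is asked.\<close>
  define Pr where "Pr f x a \<longleftrightarrow> a \<in> dom M \<and> (x \<in> J \<longrightarrow> (\<forall>Q. Q \<subseteq> \<Sigma> \<longrightarrow> finite Q \<longrightarrow>
    (\<exists>Y. good f x Y \<and> Y x = a \<and> (\<forall>P\<in>Q. P (case_sum Y id)))))" for f x a
  define supp where "supp C Q \<longleftrightarrow> (\<forall>Y Y'. Y ` J \<subseteq> dom M \<longrightarrow> Y' ` J \<subseteq> dom M \<longrightarrow>
    (\<forall>\<beta>\<in>C \<inter> J. Y \<beta> = Y' \<beta>) \<longrightarrow> (\<forall>P\<in>Q. P (case_sum Y id) = P (case_sum Y' id)))"
    for C :: "'v set" and Q :: "(('v + 'a \<Rightarrow> 'a) \<Rightarrow> bool) set"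
  have suppD: "P (case_sum Y id) = P (case_sum Y' id)"
    if "supp C Q" "P \<in> Q" "Y ` J \<subseteq> dom M" "Y' ` J \<subseteq> dom M" "\<And>\<beta>. \<beta> \<in> C \<Longrightarrow> \<beta> \<in> J \<Longrightarrow> Y \<beta> = Y' \<beta>"
    for C Q P Y Y' using that(1)[unfolded supp_def, rule_format, of Y Y' P] that(2-) by simp
  have supp: "\<exists>C. finite C \<and> supp C Q" if "Q \<subseteq> \<Sigma>" "finite Q" for Q
    using that(2,1)
  proof (induction Q rule: finite_induct)
    case empty
    show ?case by (intro exI[of _ "{}"]) (simp add: supp_def)
  next
    case (insert P Q)
    then obtain C where C: "finite C" "supp C Q" by auto
    have PS: "dfn (Inl ` J \<union> Inr ` A) P" using \<Sigma> insert.prems by simp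
    obtain D where D: "D \<subseteq> Inl ` J \<union> Inr ` A" "finite D"
      "\<And>e e'. e ` (Inl ` J \<union> Inr ` A) \<subseteq> dom M \<Longrightarrow> e' ` (Inl ` J \<union> Inr ` A) \<subseteq> dom M \<Longrightarrow>
        (\<forall>i\<in>D. e i = e' i) \<Longrightarrow> P e = P e'"
      using dfn_finite_support[OF PS] by metis
    have "supp (C \<union> Inl -` D) (insert P Q)"
      unfolding supp_def
    proof (intro allI impI)
      fix Y Y' assume Y: "Y ` J \<subseteq> dom M" "Y' ` J \<subseteq> dom M" "\<forall>\<beta>\<in>(C \<union> Inl -` D) \<inter> J. Y \<beta> = Y' \<beta>"
      have "P (case_sum Y id) = P (case_sum Y' id)"
        using Y A D(1) by (intro D(3)) auto
      moreover have "P' (case_sum Y id) = P' (case_sum Y' id)" if "P' \<in> Q" for P'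
        using Y by (intro suppD[OF C(2) that]) auto
      ultimately show "\<forall>P\<in>insert P Q. P (case_sum Y id) = P (case_sum Y' id)" by blast
    qed
    moreover have "finite (C \<union> Inl -` D)" using C(1) D(2) by (simp add: finite_vimageI)
    ultimately show ?case by blast
  qed
  \<comment> \<open>The invariant survives limits: \<open>Q\<close> depends on finitely many
    unknowns, and the invariant at the greatest of those before \<open>x\<close> supplies a
    completion that agrees with \<open>f\<close> on all of them.\<close>
  have step: "\<exists>Y. good f x Y \<and> (\<forall>P\<in>Q. P (case_sum Y id))"
    if IH: "\<And>y. (y, x) \<in> R \<Longrightarrow> Pr f y (f y)" and Q: "Q \<subseteq> \<Sigma>" "finite Q" for f x Q
  proof -
    obtain C where C: "finite C" "supp C Q" using supp[OF Q] by blast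
    define B where "B = {\<beta> \<in> C \<inter> J. (\<beta>, x) \<in> R}"
    have "\<exists>Y. Y ` J \<subseteq> dom M \<and> (\<forall>\<beta>\<in>B. Y \<beta> = f \<beta>) \<and> (\<forall>P\<in>Q. P (case_sum Y id))"
    proof (cases "B = {}")
      case True
      then show ?thesis using fin[OF Q] by auto
    next
      case False
      moreover have "finite B" "total_on B R" using C(1) tot by (auto simp: B_def total_on_def)
      ultimately obtain b where b: "b \<in> B" "\<forall>c\<in>B. c = b \<or> (c, b) \<in> R"
        using finite_greatest trans by metis
      then have "Pr f b (f b)" "b \<in> J" using IH by (auto simp: B_def)
      then obtain Y where Y: "good f b Y" "Y b = f b" "\<forall>P\<in>Q. P (case_sum Y id)"
        unfolding Pr_def using Q by metis
      then show ?thesis using b(2) by (intro exI[of _ Y]) (auto simp: good_def)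
    qed
    then obtain Y where Y: "Y ` J \<subseteq> dom M" "\<forall>\<beta>\<in>B. Y \<beta> = f \<beta>" "\<forall>P\<in>Q. P (case_sum Y id)" by blast
    define Y' where "Y' \<beta> = (if (\<beta>, x) \<in> R then f \<beta> else Y \<beta>)" for \<beta>
    have "good f x Y'" using Y(1) IH by (auto simp: good_def Y'_def Pr_def)
    moreover have "P (case_sum Y id) = P (case_sum Y' id)" if "P \<in> Q" for P
      using Y \<open>good f x Y'\<close> by (intro suppD[OF C(2) that]) (auto simp: good_def Y'_def B_def)
    ultimately show ?thesis using Y(3) by blast
  qed
  have "\<exists>f. \<forall>x. Pr f x (f x)"
  proof (rule dependent_wf_choice[OF wf])
    fix f g :: "'v \<Rightarrow> 'a" and x r
    assume "\<And>z. (z, x) \<in> R \<Longrightarrow> f z = g z"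
    then show "Pr f x r = Pr g x r" by (simp add: Pr_def good_def)
  next
    fix x and f :: "'v \<Rightarrow> 'a"
    assume IH: "\<And>y. (y, x) \<in> R \<Longrightarrow> Pr f y (f y)"
    show "\<exists>r. Pr f x r"
    proof (cases "x \<in> J")
      case False
      with a0 show ?thesis by (auto simp: Pr_def)
    next
      case True
      define U where "U = {\<beta> \<in> J. (\<beta>, x) \<in> R}"
      define A' where "A' = A \<union> f ` U"
      have fU: "f \<beta> \<in> dom M" if "(\<beta>, x) \<in> R" for \<beta> using IH[OF that] by (simp add: Pr_def)
      have "|f ` U| \<le>o |U|" by (rule card_of_image)
      moreover have "|U| \<le>o |J|" by (rule card_of_mono1) (auto simp: U_def)
      ultimately have "|f ` U| <o \<kappa>" using J by (meson ordLeq_ordLess_trans)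
      then have A': "A' \<subseteq> dom M" "|A'| <o \<kappa>"
        using A fU card by (auto simp: A'_def U_def intro!: card_of_Un_ordLess_infinite_Field)
      \<comment> \<open>Unknown \<open>x\<close> becomes the single unknown of a 1-type, earlier
        unknowns become the parameters \<open>f \<beta>\<close>, and the remaining ones go to the
        block that \<open>Qu\<close> quantifies existentially.\<close>
      define \<sigma> :: "'v + 'a \<Rightarrow> (unit + 'a) + 'v" where "\<sigma> i = (case i of Inr a \<Rightarrow> Inl (Inr a)
        | Inl \<beta> \<Rightarrow> if \<beta> = x then Inl (Inl ()) else if (\<beta>, x) \<in> R then Inl (Inr (f \<beta>)) else Inr \<beta>)" for i
      define Qu where "Qu Q = (\<lambda>e :: unit + 'a \<Rightarrow> 'a.
        \<exists>t. t ` J \<subseteq> dom M \<and> (\<forall>P\<in>Q. P (\<lambda>i. case_sum e t (\<sigma> i))))" for Q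
      have \<sigma>_eq: "(\<lambda>i. case_sum (case_sum (\<lambda>_. a) id) t (\<sigma> i)) =
        case_sum (\<lambda>\<beta>. if \<beta> = x then a else if (\<beta>, x) \<in> R then f \<beta> else t \<beta>) id" for a t
        by (auto simp: \<sigma>_def split: sum.split)
      have "\<exists>a\<in>dom M. \<forall>q\<in>Qu ` {Q. Q \<subseteq> \<Sigma> \<and> finite Q}. q (case_sum (\<lambda>_. a) id)"
      proof (rule realize1[OF A'])
        fix q assume "q \<in> Qu ` {Q. Q \<subseteq> \<Sigma> \<and> finite Q}"
        then obtain Q where Q: "Q \<subseteq> \<Sigma>" "finite Q" "q = Qu Q" by blast
        have "dfn (Inl ` (range Inl \<union> Inr ` A') \<union> Inr ` J) (\<lambda>e. \<forall>P\<in>Q. P (\<lambda>i. e (\<sigma> i)))"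
          using Q(1) by (intro dfn_Ball Q(2) dfn_reindex[OF \<Sigma>]) (auto simp: \<sigma>_def A'_def U_def)
        from dfn_ex[OF this] show "dfn (range Inl \<union> Inr ` A') q" unfolding Q(3) Qu_def .
      next
        fix qs assume qs: "qs \<subseteq> Qu ` {Q. Q \<subseteq> \<Sigma> \<and> finite Q}" "finite qs"
        then obtain \<Q> where \<Q>: "\<Q> \<subseteq> {Q. Q \<subseteq> \<Sigma> \<and> finite Q}" "finite \<Q>" "qs = Qu ` \<Q>"
          by (meson finite_subset_image)
        \<comment> \<open>Finitely many conditions \<open>Qu Q\<close> are met at once by completing
          the union of the sets \<open>Q\<close>, which is again finite.\<close>
        have "\<Union>\<Q> \<subseteq> \<Sigma>" "finite (\<Union>\<Q>)" using \<Q> by auto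
        from step[OF IH this] obtain Y where Y: "good f x Y" "\<forall>P\<in>\<Union>\<Q>. P (case_sum Y id)" by blast
        have Yeq: "case_sum (\<lambda>\<beta>. if \<beta> = x then Y x else if (\<beta>, x) \<in> R then f \<beta> else Y \<beta>) id = case_sum Y id"
          using Y(1) by (auto simp: good_def split: sum.split)
        have "Qu Q (case_sum (\<lambda>_. Y x) id)" if "Q \<in> \<Q>" for Q
          unfolding Qu_def using Y that by (intro exI[of _ Y]) (auto simp: \<sigma>_eq Yeq good_def)
        moreover have "Y x \<in> dom M" using Y(1) True by (auto simp: good_def)
        ultimately show "\<exists>a\<in>dom M. \<forall>q\<in>qs. q (case_sum (\<lambda>_. a) id)"
          unfolding \<Q>(3) by (intro bexI[of _ "Y x"]) auto
      qed
      then obtain a where a: "a \<in> dom M"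
        "\<And>Q. Q \<subseteq> \<Sigma> \<Longrightarrow> finite Q \<Longrightarrow> Qu Q (case_sum (\<lambda>_. a) id)" by blast
      have "Pr f x a"
        unfolding Pr_def
      proof (intro conjI allI impI a(1))
        fix Q assume "Q \<subseteq> \<Sigma>" "finite Q"
        from a(2)[OF this] obtain t where t: "t ` J \<subseteq> dom M"
          "\<forall>P\<in>Q. P (case_sum (\<lambda>\<beta>. if \<beta> = x then a else if (\<beta>, x) \<in> R then f \<beta> else t \<beta>) id)"
          unfolding Qu_def \<sigma>_eq by blast
        moreover have "(x, x) \<notin> R" by (simp add: R_def)
        ultimately show "\<exists>Y. good f x Y \<and> Y x = a \<and> (\<forall>P\<in>Q. P (case_sum Y id))"
          using a(1) fU
          by (intro exI[of _ "\<lambda>\<beta>. if \<beta> = x then a else if (\<beta>, x) \<in> R then f \<beta> else t \<beta>"])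
            (auto simp: good_def)
      qed
      then show ?thesis by blast
    qed
  qed
  then obtain X where X: "\<And>x. Pr X x (X x)" by blast
  \<comment> \<open>Only finitely many coordinates of \<open>X\<close> matter to \<open>P\<close>,
    and the invariant at the greatest one provides a tuple that satisfies \<open>P\<close> and
    agrees with \<open>X\<close> on them.\<close>
  have "P (case_sum X id)" if P: "P \<in> \<Sigma>" for P
  proof -
    obtain C where C: "finite C" "supp C {P}" using supp[of "{P}"] P by auto
    have XJ: "X ` J \<subseteq> dom M" using X by (auto simp: Pr_def)
    have "\<exists>Y. Y ` J \<subseteq> dom M \<and> (\<forall>\<beta>\<in>C \<inter> J. X \<beta> = Y \<beta>) \<and> P (case_sum Y id)"
    proof (cases "C \<inter> J = {}")
      case True
      then show ?thesis using fin[of "{P}"] P by auto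
    next
      case False
      moreover have "finite (C \<inter> J)" "total_on (C \<inter> J) R" using C(1) tot by (auto simp: total_on_def)
      ultimately obtain b where b: "b \<in> C \<inter> J" "\<forall>c\<in>C \<inter> J. c = b \<or> (c, b) \<in> R"
        using finite_greatest trans by metis
      obtain Y where Y: "good X b Y" "Y b = X b" "P (case_sum Y id)"
        using X[of b] b(1) P unfolding Pr_def by (metis IntD2 empty_subsetI finite.emptyI finite.insertI insertI1 insert_subset)
      have "X \<beta> = Y \<beta>" if "\<beta> \<in> C \<inter> J" for \<beta>
        using Y(1,2) b(2) that unfolding good_def by metis
      then show ?thesis using Y by (intro exI[of _ Y]) (simp add: good_def)
    qed
    then obtain Y where "Y ` J \<subseteq> dom M" "\<forall>\<beta>\<in>C \<inter> J. X \<beta> = Y \<beta>" "P (case_sum Y id)" by blast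
    then show ?thesis using suppD[OF C(2), of P X Y] XJ by simp
  qed
  moreover have "range X \<subseteq> dom M" using X by (auto simp: Pr_def)
  ultimately show ?thesis by blast
qed

section \<open>Upper bounds and the existence of \<open>\<lless>\<close>-larger elements\<close>

lemma upper_bound: "finite B \<Longrightarrow> B \<subseteq> dom M \<Longrightarrow> \<exists>u\<in>dom M. \<forall>b\<in>B. b \<prec> u"
proof (induction B rule: finite_induct)
  case empty
  then show ?case using dom_nonempty by auto
next
  case (insert b B)
  then obtain u where u: "u \<in> dom M" "\<forall>c\<in>B. c \<prec> u" by auto
  define w where "w = (if u \<prec> b then b else u)"
  have w: "w \<in> dom M" "u \<prec> w \<or> u = w" "b \<prec> w \<or> b = w" using u insert.prems total[of b u] by (auto simp: w_def)
  \<comment> \<open>Any instance of the scheme yields an element above \<open>w\<close>; a trivial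
    formula is taken.\<close>
  obtain v where v: "v \<in> dom M" "W (Eq (Var 0) (Var 0)) {} w v"
    using scheme_W[of "Eq (Var 0) (Var 0)" w "{}"] w by auto
  then have "w \<prec> v" by (simp add: W_def)
  have "c \<prec> w \<or> c = w" if "c \<in> insert b B" for c
    using that w u insert.prems trans[of c u w] by auto
  then show ?case using v(1) \<open>w \<prec> v\<close> w(1) insert.prems trans[of _ w v] by (intro bexI[of _ v]) blast+
qed

text \<open>Elements of the carrier type also serve as names of parameter indices, and
  \<open>combine\<close> needs fresh ones.\<close>

lemma infinite_UNIV: "infinite (UNIV :: 'a set)"
proof
  assume "finite (UNIV :: 'a set)"
  then have "finite (dom M)" by (rule rev_finite_subset) simp
  then show False using upper_bound[of "dom M"] irrefl by blast
qed

text \<open>Each \<open>W \<phi> F z\<close> persists when its witness is enlarged, so finitely many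
  instances of the scheme are met by every sufficiently large element. Saturation over the
  parameters \<open>z\<close> and \<open>d\<close> then meets all of them.\<close>

lemma exists_ll:
  assumes z: "z \<in> dom M" and d: "d \<in> dom M"
  shows "\<exists>z'\<in>dom M. z \<lless> z' \<and> d \<prec> z'"
proof -
  define w where "w \<phi> F = (\<lambda>e :: unit + 'a \<Rightarrow> 'a. W \<phi> F (e (Inr z)) (e (Inl ())) \<and> e (Inr d) \<prec> e (Inl ()))" for \<phi> F
  define \<Sigma> where "\<Sigma> = {w \<phi> F |\<phi> F. wf_fm L \<phi>}"
  have "\<exists>a\<in>dom M. \<forall>P\<in>\<Sigma>. P (case_sum (\<lambda>_. a) id)"
  proof (rule realize1[of "{z, d}"])
    show "|{z, d}| <o \<kappa>" by (rule finite_ordLess) simp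
    show "dfn (range Inl \<union> Inr ` {z, d}) P" if "P \<in> \<Sigma>" for P
      using that unfolding \<Sigma>_def w_def by (auto intro!: dfn_conj dfn_W dfn_lt)
    fix Q assume Q: "Q \<subseteq> \<Sigma>" "finite Q"
    have "\<forall>P\<in>Q. \<exists>b\<in>dom M. \<forall>a\<in>dom M. b \<prec> a \<longrightarrow> P (case_sum (\<lambda>_. a) id)"
    proof
      fix P assume "P \<in> Q"
      then obtain \<phi> F where P: "wf_fm L \<phi>" "P = w \<phi> F" using Q(1) by (auto simp: \<Sigma>_def)
      obtain z' where z': "z' \<in> dom M" "W \<phi> F z z'" using scheme_W[OF P(1) z] by blast
      obtain b where "b \<in> dom M" "z' \<prec> b" "d \<prec> b" using upper_bound[of "{z', d}"] z'(1) d by auto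
      then show "\<exists>b\<in>dom M. \<forall>a\<in>dom M. b \<prec> a \<longrightarrow> P (case_sum (\<lambda>_. a) id)"
        using W_mono[OF z'(2) z z z'(1)] z' d trans[of d b] trans[of z' b]
        by (intro bexI[of _ b]) (auto simp: P w_def)
    qed
    then obtain b where b: "\<And>P. P \<in> Q \<Longrightarrow> b P \<in> dom M"
      "\<And>P a. P \<in> Q \<Longrightarrow> a \<in> dom M \<Longrightarrow> b P \<prec> a \<Longrightarrow> P (case_sum (\<lambda>_. a) id)" by metis
    obtain a where "a \<in> dom M" "\<forall>c\<in>b ` Q. c \<prec> a" using upper_bound[of "b ` Q"] Q(2) b(1) by auto
    then show "\<exists>a\<in>dom M. \<forall>P\<in>Q. P (case_sum (\<lambda>_. a) id)" using b(2) by (intro bexI[of _ a]) auto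
  qed (use z d in auto)
  then obtain a where a: "a \<in> dom M" "\<forall>P\<in>\<Sigma>. P (case_sum (\<lambda>_. a) id)" by blast
  have "w \<phi> F (case_sum (\<lambda>_. a) id)" if "wf_fm L \<phi>" for \<phi> F using a(2) that by (auto simp: \<Sigma>_def)
  then have "z \<lless> a" "d \<prec> a"
    unfolding w_def ll_def using wf_fm.simps(1)[of L "Var 0" "Var 0"] by (auto simp del: wf_fm.simps)
  with a(1) show ?thesis by blast
qed

section \<open>Controlling finitely many predicates by one, and copies of a tuple that are
  arbitrarily large\<close>

text \<open>Two distinct elements below \<open>z\<close> suffice to code one bit by equality or
  inequality of two bounded parameters.\<close>

definition wide :: "'a \<Rightarrow> bool" where
  "wide z \<longleftrightarrow> z \<in> dom M \<and> (\<exists>a\<in>below z. \<exists>b\<in>below z. a \<noteq> b)"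

text \<open>\<open>P\<close> ignores indices outside \<open>T'\<close>, so a parameter tuple on
  \<open>T'\<close> may be extended to \<open>T\<close> by an element below \<open>z\<close>, which
  \<open>wide\<close> provides.\<close>

lemma E_change_block:
  assumes "E T P x y z" "dfn (Inl ` V \<union> Inr ` T') P" "x ` V \<subseteq> dom M" "y ` V \<subseteq> dom M" "wide z"
  shows "E T' P x y z"
  unfolding E_def
proof (intro allI impI)
  fix t assume t: "t ` T' \<subseteq> below z"
  obtain a where a: "a \<in> below z" using assms(5) by (auto simp: wide_def)
  define t' where "t' i = (if i \<in> T' then t i else a)" for i
  have "P (case_sum x t) = P (case_sum x t')" "P (case_sum y t) = P (case_sum y t')"
    using assms(3,4) t by (auto intro!: dfn_support[OF assms(2)] simp: t'_def)
  moreover have "P (case_sum x t') = P (case_sum y t')"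
    using t a by (intro ED[OF assms(1)]) (auto simp: t'_def)
  ultimately show "P (case_sum x t) = P (case_sum y t)" by simp
qed

text \<open>The index set of the parameters is left existential because it differs from one member
  of \<open>\<P>\<close> to another; \<open>E_change_block\<close> brings back the wanted
  one.\<close>

definition controls ::
  "'x set \<Rightarrow> 't set \<Rightarrow> (('x + 't \<Rightarrow> 'a) \<Rightarrow> bool) \<Rightarrow> (('x + 't \<Rightarrow> 'a) \<Rightarrow> bool) set \<Rightarrow> bool" where
  "controls V T Q \<P> \<longleftrightarrow> (\<forall>x y z P. x ` V \<subseteq> dom M \<longrightarrow> y ` V \<subseteq> dom M \<longrightarrow> wide z \<longrightarrow> E T Q x y z \<longrightarrow>
     P \<in> \<P> \<longrightarrow> (\<exists>T. dfn (Inl ` V \<union> Inr ` T) P \<and> E T P x y z))"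

lemma controlsD:
  "controls V T Q \<P> \<Longrightarrow> x ` V \<subseteq> dom M \<Longrightarrow> y ` V \<subseteq> dom M \<Longrightarrow> wide z \<Longrightarrow> E T Q x y z \<Longrightarrow>
    P \<in> \<P> \<Longrightarrow> \<exists>T. dfn (Inl ` V \<union> Inr ` T) P \<and> E T P x y z"
  by (simp add: controls_def)

text \<open>Finitely many predicates are handled by a single one, which selects among them according to
  which of some auxiliary variables are equal; this needs two elements below \<open>z\<close>.\<close>

lemma combine:
  fixes \<P> :: "(('x + 'a \<Rightarrow> 'a) \<Rightarrow> bool) set"
  assumes "finite \<P>" "\<And>P. P \<in> \<P> \<Longrightarrow> \<exists>T. finite T \<and> dfn (Inl ` V \<union> Inr ` T) P"
  shows "\<exists>(Q :: ('x + 'a \<Rightarrow> 'a) \<Rightarrow> bool) T. finite T \<and> dfn (Inl ` V \<union> Inr ` T) Q \<and>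
    controls V T Q \<P>"
  using assms
proof (induction \<P> rule: finite_induct)
  case empty
  show ?case by (intro exI[of _ "\<lambda>_. True"] exI[of _ "{}"]) (simp add: dfn_True controls_def)
next
  case (insert P \<P>)
  have "\<exists>(Q :: ('x + 'a \<Rightarrow> 'a) \<Rightarrow> bool) T. finite T \<and> dfn (Inl ` V \<union> Inr ` T) Q \<and>
    controls V T Q \<P>"
    by (rule insert.IH, rule insert.prems) simp
  then obtain Q :: "('x + 'a \<Rightarrow> 'a) \<Rightarrow> bool" and T2 where
    Q: "finite T2" "dfn (Inl ` V \<union> Inr ` T2) Q" "controls V T2 Q \<P>"
    by blast
  obtain T1 where P: "finite T1" "dfn (Inl ` V \<union> Inr ` T1) P" using insert.prems by blast
  have fresh: "\<exists>s. s \<notin> S" if "finite S" for S :: "'a set"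
    using infinite_UNIV that ex_new_if_finite by blast
  obtain s where s: "s \<notin> T1 \<union> T2" using fresh[of "T1 \<union> T2"] P Q by auto
  obtain s' where s': "s' \<notin> insert s (T1 \<union> T2)" using fresh[of "insert s (T1 \<union> T2)"] P Q by auto
  define T where "T = {s, s'} \<union> T1 \<union> T2"
  define R where "R e \<longleftrightarrow> (e (Inr s) = e (Inr s') \<longrightarrow> P e) \<and> (e (Inr s) \<noteq> e (Inr s') \<longrightarrow> Q e)" for e :: "'x + 'a \<Rightarrow> 'a"
  have "dfn (Inl ` V \<union> Inr ` T) R"
    unfolding R_def
    by (intro dfn_conj dfn_imp dfn_not dfn_eq dfn_mono[OF P(2)] dfn_mono[OF Q(2)]) (auto simp: T_def)
  moreover have "controls V T R (insert P \<P>)"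
    unfolding controls_def
  proof (intro allI impI)
    fix x y z P' assume xy: "x ` V \<subseteq> dom M" "y ` V \<subseteq> dom M" and z: "wide z" and E: "E T R x y z"
      and P': "P' \<in> insert P \<P>"
    obtain a b where ab: "a \<in> below z" "b \<in> below z" "a \<noteq> b" using z unfolding wide_def by blast
    have "E T1 P x y z"
      unfolding E_def
    proof (intro allI impI)
      fix t assume t: "t ` T1 \<subseteq> below z"
      define t' where "t' i = (if i \<in> T1 then t i else a)" for i
      have "P (case_sum x t) = P (case_sum x t')" "P (case_sum y t) = P (case_sum y t')"
        using xy t by (auto intro!: dfn_support[OF P(2)] simp: t'_def)
      moreover have "R (case_sum x t') = R (case_sum y t')"
        using t ab by (intro ED[OF E]) (auto simp: t'_def)
      moreover have "t' s = t' s'" using s s' by (simp add: t'_def)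
      ultimately show "P (case_sum x t) = P (case_sum y t)" by (simp add: R_def)
    qed
    moreover have "E T2 Q x y z"
      unfolding E_def
    proof (intro allI impI)
      fix t assume t: "t ` T2 \<subseteq> below z"
      define t' where "t' i = (if i \<in> T2 then t i else if i = s then a else b)" for i
      have "Q (case_sum x t) = Q (case_sum x t')" "Q (case_sum y t) = Q (case_sum y t')"
        using xy t by (auto intro!: dfn_support[OF Q(2)] simp: t'_def)
      moreover have "R (case_sum x t') = R (case_sum y t')"
        using t ab by (intro ED[OF E]) (auto simp: t'_def)
      moreover have "t' s \<noteq> t' s'" using s s' ab by (auto simp: t'_def)
      ultimately show "Q (case_sum x t) = Q (case_sum y t)" by (simp add: R_def)
    qed
    ultimately show "\<exists>T. dfn (Inl ` V \<union> Inr ` T) P' \<and> E T P' x y z"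
      using controlsD[OF Q(3) xy z, of P'] P' P(2) by blast
  qed
  moreover have "finite T" using P Q by (simp add: T_def)
  ultimately show ?case by (intro exI[of _ R] exI[of _ T]) blast
qed

text \<open>Suppose that no copy of \<open>x\<close> over the elements below \<open>m\<close> lies
  above \<open>d\<close>. Since \<open>m \<lless> z1\<close>, there is a copy \<open>e\<close> below
  \<open>z1\<close>. That no copy of \<open>e\<close> exceeds \<open>d\<close> is a statement about
  \<open>d\<close> with parameters \<open>e\<close> and \<open>m\<close> below \<open>z1\<close>, so
  by \<open>z1 \<lless> z2\<close> it also holds of some \<open>d'\<close> below \<open>z2\<close>.
  But \<open>x\<close> is a copy of \<open>e\<close> above \<open>z2\<close>.\<close>

lemma unbounded:
  fixes P :: "('x + 't \<Rightarrow> 'a) \<Rightarrow> bool"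
  assumes ll: "m \<lless> z1" "z1 \<lless> z2" and dom: "m \<in> dom M" "z1 \<in> dom M" "z2 \<in> dom M" "d \<in> dom M"
    and P: "dfn (Inl ` V \<union> Inr ` T) P" "finite V" "finite T"
    and x: "x ` V \<subseteq> dom M" "\<And>v. v \<in> V \<Longrightarrow> z2 \<prec> x v"
  shows "\<exists>X. X ` V \<subseteq> dom M \<and> E T P x X m \<and> (\<forall>v\<in>V. d \<prec> X v)"
proof (rule ccontr)
  assume no: "\<not> ?thesis"
  \<comment> \<open>Index \<open>None\<close> carries \<open>m\<close>, the indices
    \<open>Some v\<close> carry the copy, and the left index carries the bound, the only coordinate
    that will be replaced.\<close>
  define \<theta> where "\<theta> e \<longleftrightarrow> \<not> (\<exists>X. X ` V \<subseteq> dom M \<and>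
    (E T P X (\<lambda>v. e (Inr (Some v))) (e (Inr None)) \<and> (\<forall>v\<in>V. e (Inl ()) \<prec> X v)))" for e :: "unit + 'x option \<Rightarrow> 'a"
  let ?C = "range Inl \<union> Inr ` insert None (Some ` V)"
  have "dfn (Inl ` ?C \<union> Inr ` V) (\<lambda>e. E T P (\<lambda>v. e (Inr v)) (\<lambda>v. e (Inl (Inr (Some v)))) (e (Inl (Inr None))) \<and>
    (\<forall>v\<in>V. e (Inl (Inl ())) \<prec> e (Inr v)))"
    using P by (intro dfn_conj dfn_E[OF P(1)] dfn_Ball dfn_lt) auto
  from dfn_not[OF dfn_ex[OF this]] have \<theta>: "dfn ?C \<theta>"
    by (rule dfn_cong) (simp add: \<theta>_def)
  obtain e where e: "e ` V \<subseteq> below z1" "E T P x e m" using ll_E[OF ll(1) P(1) x(1) dom(1)] by blast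
  define t where "t = case_option m e"
  have t: "t ` insert None (Some ` V) \<subseteq> below z1" using e(1) ll_less[OF ll(1)] dom by (auto simp: t_def)
  obtain d' where d': "d' ` UNIV \<subseteq> below z2" "E (insert None (Some ` V)) \<theta> (\<lambda>_. d) d' z1"
    using ll_E[OF ll(2) \<theta>, of "\<lambda>_. d"] dom by auto
  have "\<theta> (case_sum (\<lambda>_. d) t)"
    unfolding \<theta>_def
  proof
    assume "\<exists>X. X ` V \<subseteq> dom M \<and> (E T P X (\<lambda>v. case_sum (\<lambda>_. d) t (Inr (Some v)))
      (case_sum (\<lambda>_. d) t (Inr None)) \<and> (\<forall>v\<in>V. case_sum (\<lambda>_. d) t (Inl ()) \<prec> X v))"
    then obtain X where X: "X ` V \<subseteq> dom M" "E T P X e m" "\<forall>v\<in>V. d \<prec> X v" by (auto simp: t_def)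
    with E_trans[OF e(2) E_sym[OF X(2)]] no show False by blast
  qed
  then have "\<theta> (case_sum d' t)" using ED[OF d'(2) t] by simp
  moreover have "d' () \<prec> x v" if "v \<in> V" for v
    using d'(1) x(1) x(2)[OF that] that dom trans[of "d' ()" z2 "x v"] by auto
  ultimately show False using x(1) e(2) unfolding \<theta>_def by (auto simp: t_def)
qed

end

section \<open>Coherent approximations of a growing tuple\<close>

context saturated_model
begin

abbreviation R :: "'k rel" where "R \<equiv> \<kappa> - Id"

lemma wf_R: "wf R"
  using card(1) unfolding card_order_on_def well_order_on_def by blast

lemma trans_R: "trans R"
  using card(1) unfolding card_order_on_def well_order_on_def linear_order_on_def
    partial_order_on_def preorder_on_def by (auto intro: trans_diff_Id)

lemma R_trans: "(i, j) \<in> R \<Longrightarrow> (j, k) \<in> R \<Longrightarrow> (i, k) \<in> R"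
  using trans_R by (rule transD)

lemma R_total: "i \<in> Field \<kappa> \<Longrightarrow> j \<in> Field \<kappa> \<Longrightarrow> i = j \<or> (i, j) \<in> R \<or> (j, i) \<in> R"
  using card(1) unfolding card_order_on_def well_order_on_def linear_order_on_def total_on_def by auto

lemma R_Field: "(i, j) \<in> R \<Longrightarrow> i \<in> Field \<kappa> \<and> j \<in> Field \<kappa>"
  by (auto simp: Field_def)

lemma R_unbounded: "i \<in> Field \<kappa> \<Longrightarrow> \<exists>j\<in>Field \<kappa>. (i, j) \<in> R"
  using infinite_Card_order_limit[OF card] by blast

lemma card_R_below: "i \<in> Field \<kappa> \<Longrightarrow> |{j. (j, i) \<in> R}| <o \<kappa>"
  using card_of_underS[OF card(1), of i] by (simp add: underS_def conj_commute)

lemma Times_ordLess: 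
  assumes "|A| <o \<kappa>" "|B| <o \<kappa>"
  shows "|A \<times> B| <o \<kappa>"
proof (cases "finite A \<and> finite B")
  case True
  then show ?thesis by (intro finite_ordLess) simp
next
  case False
  then have inf: "infinite A \<or> infinite B" by blast
  consider "|A| \<le>o |B|" | "|B| \<le>o |A|"
    using ordLeq_total[OF card_of_Well_order card_of_Well_order] by blast
  then show ?thesis
  proof cases
    case 1
    then have "infinite B" using inf card_of_ordLeq_infinite by blast
    then have "|A \<times> B| \<le>o |B|"
      using 1 by (intro card_of_Times_ordLeq_infinite_Field) (simp_all add: Field_card_of card_of_card_order_on card_of_mono1)
    then show ?thesis using assms(2) ordLeq_ordLess_trans by blast
  next
    case 2
    then have "infinite A" using inf card_of_ordLeq_infinite by blast
    then have "|A \<times> B| \<le>o |A|"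
      using 2 by (intro card_of_Times_ordLeq_infinite_Field) (simp_all add: Field_card_of card_of_card_order_on card_of_mono1)
    then show ?thesis using assms(1) ordLeq_ordLess_trans by blast
  qed
qed

text \<open>Iterating \<open>exists_ll\<close> gives a \<open>\<lless>\<close>-chain above
  \<open>b\<close>; each member of \<open>V\<close> is sent to the chain element numbered by its
  rank in \<open>V\<close>.\<close>

lemma grow_above:
  assumes V: "finite V" and b: "b \<in> dom M"
  shows "\<exists>X. X ` V \<subseteq> dom M \<and> (\<forall>v\<in>V. b \<lless> X v) \<and> (\<forall>\<alpha>\<in>V. \<forall>\<beta>\<in>V. (\<alpha>, \<beta>) \<in> R \<longrightarrow> X \<alpha> \<lless> X \<beta>)"
proof -
  have "\<forall>z\<in>dom M. \<exists>z'. z' \<in> dom M \<and> z \<lless> z'" using exists_ll by blast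
  from bchoice[OF this] obtain G where G: "\<And>z. z \<in> dom M \<Longrightarrow> G z \<in> dom M \<and> z \<lless> G z" by blast
  \<comment> \<open>Starting with the first iterate ensures \<open>b \<lless> zs 0\<close>.\<close>
  define zs where "zs n = (G ^^ Suc n) b" for n
  have zs: "zs n \<in> dom M" for n by (induction n) (use b G in \<open>auto simp: zs_def\<close>)
  have zs_Suc: "zs n \<lless> zs (Suc n)" for n using G[OF zs[of n]] by (simp add: zs_def)
  have zs_mono: "zs n \<lless> zs k" if "n < k" for n k
    using that
  proof (induction k)
    case (Suc k)
    show ?case
    proof (cases "n = k")
      case False
      then have "zs n \<prec> zs k" using Suc ll_less by simp
      then show ?thesis using ll_mono[OF zs_Suc[of k] zs zs zs zs, of n "Suc k"] by simp
    qed (simp add: zs_Suc)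
  qed simp
  have b_zs: "b \<lless> zs n" for n
  proof -
    have b0: "b \<lless> zs 0" using G[OF b] by (simp add: zs_def)
    show ?thesis
    proof (cases n)
      case (Suc k)
      then have "zs 0 \<prec> zs n" using zs_mono ll_less by simp
      then show ?thesis using ll_mono[OF b0 b b zs zs, of n] by simp
    qed (simp add: b0)
  qed
  define X where "X v = zs (card {u \<in> V. (u, v) \<in> R})" for v
  have "X \<alpha> \<lless> X \<beta>" if "\<alpha> \<in> V" "\<beta> \<in> V" "(\<alpha>, \<beta>) \<in> R" for \<alpha> \<beta>
  proof -
    have "{u \<in> V. (u, \<alpha>) \<in> R} \<subset> {u \<in> V. (u, \<beta>) \<in> R}"
      using that R_trans by blast
    then show ?thesis unfolding X_def using V by (intro zs_mono psubset_card_mono) auto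
  qed
  then show ?thesis using zs b_zs by (intro exI[of _ X]) (auto simp: X_def)
qed

text \<open>Well-founded recursion on \<open>i\<close>: \<open>x i\<close> realizes the type, in the
  unknowns \<open>J i\<close>, that collects coherence with all earlier tuples, the bound
  \<open>Z i\<close> and the chain condition. For finite satisfiability, let \<open>k\<close> be the
  last earlier stage mentioned. The unknowns in \<open>J k\<close> are filled by a copy of
  \<open>f k\<close> pushed above \<open>Z i\<close> by \<open>unbounded\<close>; the others come
  after these and are filled by \<open>grow_above\<close>.\<close>

lemma coherent_tower:
  fixes m Z :: "'k \<Rightarrow> 'a" and I :: "'k set"
  defines "J \<equiv> \<lambda>i. {\<alpha> \<in> I. (\<alpha>, i) \<in> R}"
  assumes m: "\<And>i. i \<in> Field \<kappa> \<Longrightarrow> wide (m i)"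
    and mono: "\<And>i j. (i, j) \<in> R \<Longrightarrow> m i \<prec> m j \<or> m i = m j"
    and Z: "\<And>i. i \<in> Field \<kappa> \<Longrightarrow> Z i \<in> dom M"
      "\<And>i. i \<in> Field \<kappa> \<Longrightarrow> \<exists>z\<in>dom M. m i \<lless> z \<and> z \<lless> Z i"
  shows "\<exists>x :: 'k \<Rightarrow> 'k \<Rightarrow> 'a. \<forall>i. range (x i) \<subseteq> dom M \<and> (i \<in> Field \<kappa> \<longrightarrow>
    (\<forall>j V T P. (j, i) \<in> R \<longrightarrow> finite V \<longrightarrow> finite T \<longrightarrow> V \<subseteq> J j \<longrightarrow>
       dfn (Inl ` V \<union> Inr ` T) P \<longrightarrow> E (T :: 'a set) P (x i) (x j) (m j)) \<and>
    (\<forall>\<alpha>\<in>J i. Z i \<prec> x i \<alpha>) \<and>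
    (\<forall>\<alpha>\<in>J i. \<forall>\<beta>\<in>J i. (\<alpha>, \<beta>) \<in> R \<longrightarrow> x i \<alpha> \<lless> x i \<beta>))"
proof -
  define PA where "PA f i r \<longleftrightarrow> (\<forall>j V T P. (j, i) \<in> R \<longrightarrow> finite V \<longrightarrow> finite T \<longrightarrow> V \<subseteq> J j \<longrightarrow>
       dfn (Inl ` V \<union> Inr ` T) P \<longrightarrow> E (T :: 'a set) P r (f j) (m j))" for f :: "'k \<Rightarrow> 'k \<Rightarrow> 'a" and i r
  define PB where "PB i r \<longleftrightarrow> (\<forall>\<alpha>\<in>J i. Z i \<prec> r \<alpha>)" for i r
  define PC where "PC i r \<longleftrightarrow> (\<forall>\<alpha>\<in>J i. \<forall>\<beta>\<in>J i. (\<alpha>, \<beta>) \<in> R \<longrightarrow> r \<alpha> \<lless> r \<beta>)" for i r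
  define Pr where "Pr f i r \<longleftrightarrow> range r \<subseteq> dom M \<and> (i \<in> Field \<kappa> \<longrightarrow> PA f i r \<and> PB i r \<and> PC i r)" for f i r
  obtain a0 where a0: "a0 \<in> dom M" using dom_nonempty by blast
  have mdom: "m i \<in> dom M" if "i \<in> Field \<kappa>" for i using m[OF that] by (simp add: wide_def)
  have J_mono: "J j \<subseteq> J i" if "(j, i) \<in> R" for i j using R_trans[OF _ that] by (auto simp: J_def)
  have "\<exists>x. \<forall>i. Pr x i (x i)"
  proof (rule dependent_wf_choice[OF wf_R])
    fix f g :: "'k \<Rightarrow> 'k \<Rightarrow> 'a" and i r
    assume "\<And>j. (j, i) \<in> R \<Longrightarrow> f j = g j"
    then have "PA f i r = PA g i r" unfolding PA_def by simp
    then show "Pr f i r = Pr g i r" by (simp add: Pr_def)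
  next
    fix i and f :: "'k \<Rightarrow> 'k \<Rightarrow> 'a"
    assume IH: "\<And>j. (j, i) \<in> R \<Longrightarrow> Pr f j (f j)"
    show "\<exists>r. Pr f i r"
    proof (cases "i \<in> Field \<kappa>")
      case False
      then show ?thesis using a0 by (intro exI[of _ "\<lambda>_. a0"]) (auto simp: Pr_def)
    next
      case i: True
      define U where "U = {j. (j, i) \<in> R}"
      have U: "|U| <o \<kappa>" unfolding U_def by (rule card_R_below[OF i])
      have UF: "j \<in> Field \<kappa>" if "j \<in> U" for j using that R_Field by (auto simp: U_def)
      have fdom: "f j v \<in> dom M" if "j \<in> U" for j v using IH[of j] that by (auto simp: U_def Pr_def)
      \<comment> \<open>The parameters of the stage: the bound, the earlier \<open>m j\<close> and
        the values \<open>f j v\<close> for earlier \<open>j\<close> and \<open>v\<close>. Their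
        number stays below \<open>\<kappa>\<close> since there are fewer than
        \<open>\<kappa>\<close> earlier stages.\<close>
      define A where "A = insert (Z i) (m ` U \<union> (\<lambda>(j, v). f j v) ` (U \<times> U))"
      have "|m ` U| <o \<kappa>" "|(\<lambda>(j, v). f j v) ` (U \<times> U)| <o \<kappa>" "|{Z i}| <o \<kappa>"
        using U Times_ordLess[OF U U] card_of_image[of m U] card_of_image[of "\<lambda>(j, v). f j v" "U \<times> U"]
          finite_ordLess ordLeq_ordLess_trans by blast+
      then have "|{Z i} \<union> (m ` U \<union> (\<lambda>(j, v). f j v) ` (U \<times> U))| <o \<kappa>"
        using card by (intro card_of_Un_ordLess_infinite_Field)
      then have A: "A \<subseteq> dom M" "|A| <o \<kappa>"
        using Z(1)[OF i] mdom UF fdom by (auto simp: A_def)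
      have JU: "J i \<subseteq> U" by (auto simp: J_def U_def)
      have Jc: "|J i| <o \<kappa>" using U card_of_mono1[OF JU] ordLeq_ordLess_trans by blast
      \<comment> \<open>\<open>pa\<close>, \<open>pb\<close> and \<open>pc\<close> are the
        conditions \<open>PA\<close>, \<open>PB\<close> and \<open>PC\<close> as predicates, the
        last one split into the single conjuncts \<open>W \<phi> F\<close> of
        \<open>\<lless>\<close>.\<close>
      define pa where "pa = (\<lambda>(j, V :: 'k set, T, P) (e :: 'k + 'a \<Rightarrow> 'a).
        E (T :: 'a set) P (\<lambda>v. e (Inl v)) (\<lambda>v. e (Inr (f j v))) (e (Inr (m j))))"
      define pb where "pb = (\<lambda>\<alpha> (e :: 'k + 'a \<Rightarrow> 'a). e (Inr (Z i)) \<prec> e (Inl \<alpha>))"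
      define pc where "pc = (\<lambda>(\<alpha>, \<beta>, \<phi>, F) (e :: 'k + 'a \<Rightarrow> 'a). W \<phi> F (e (Inl \<alpha>)) (e (Inl \<beta>)))"
      define Ka where "Ka = {(j, V, T :: 'a set, P). j \<in> U \<and> finite V \<and> finite T \<and> V \<subseteq> J j \<and> dfn (Inl ` V \<union> Inr ` T) P}"
      define Kc where "Kc = {(\<alpha>, \<beta>, \<phi>, F :: nat set). \<alpha> \<in> J i \<and> \<beta> \<in> J i \<and> (\<alpha>, \<beta>) \<in> R \<and> wf_fm L \<phi>}"
      have "\<exists>X. range X \<subseteq> dom M \<and> (\<forall>P\<in>pa ` Ka \<union> pb ` J i \<union> pc ` Kc. P (case_sum X id))"
      proof (rule realize_tuple[OF A Jc])
        fix P assume "P \<in> pa ` Ka \<union> pb ` J i \<union> pc ` Kc"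
        then consider j V T P' where "(j, V, T, P') \<in> Ka" "P = pa (j, V, T, P')"
          | \<alpha> where "\<alpha> \<in> J i" "P = pb \<alpha>" | \<alpha> \<beta> \<phi> F where "(\<alpha>, \<beta>, \<phi>, F) \<in> Kc" "P = pc (\<alpha>, \<beta>, \<phi>, F)"
          by auto
        then show "dfn (Inl ` J i \<union> Inr ` A) P"
        proof cases
          case 1
          then have j: "(j, i) \<in> R" "j \<in> U" "V \<subseteq> J j" "finite T" "dfn (Inl ` V \<union> Inr ` T) P'"
            by (auto simp: Ka_def U_def)
          have "V \<subseteq> U" using j(3) J_mono[OF j(1)] JU by blast
          then have "f j v \<in> A" if "v \<in> V" for v
            using that j(2) unfolding A_def by (intro insertI2 UnI2 image_eqI[of _ _ "(j, v)"]) auto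
          moreover have "m j \<in> A" using j(2) by (simp add: A_def)
          ultimately show ?thesis
            unfolding 1(2) pa_def prod.case using j J_mono[OF j(1)]
            by (intro dfn_E[OF j(5,4)]) auto
        next
          case 2
          then show ?thesis unfolding pb_def by (auto simp: A_def intro!: dfn_lt)
        next
          case 3
          then show ?thesis unfolding pc_def by (auto simp: Kc_def intro!: dfn_W)
        qed
      next
        fix Q assume Q: "Q \<subseteq> pa ` Ka \<union> pb ` J i \<union> pc ` Kc" "finite Q"
        obtain Ka' where Ka': "Ka' \<subseteq> Ka" "finite Ka'" "Q \<inter> pa ` Ka = pa ` Ka'"
          using finite_subset_image[of "Q \<inter> pa ` Ka" pa Ka] Q(2) by blast
        obtain Kb' where Kb': "Kb' \<subseteq> J i" "finite Kb'" "Q \<inter> pb ` J i = pb ` Kb'"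
          using finite_subset_image[of "Q \<inter> pb ` J i" pb "J i"] Q(2) by blast
        obtain Kc' where Kc': "Kc' \<subseteq> Kc" "finite Kc'" "Q \<inter> pc ` Kc = pc ` Kc'"
          using finite_subset_image[of "Q \<inter> pc ` Kc" pc Kc] Q(2) by blast
        define Vs where "Vs = (\<Union>(j, V, T, P)\<in>Ka'. V) \<union> Kb' \<union> (\<Union>(\<alpha>, \<beta>, \<phi>, F)\<in>Kc'. {\<alpha>, \<beta>})"
        have Ka'D: "j \<in> U" "(j, i) \<in> R" "finite V" "finite T" "V \<subseteq> J j" "V \<subseteq> J i" "dfn (Inl ` V \<union> Inr ` T) P"
          if "(j, V, T, P) \<in> Ka'" for j V T P
        proof -
          have "(j, V, T, P) \<in> Ka" using Ka'(1) that by (rule subsetD)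
          then show *: "j \<in> U" "(j, i) \<in> R" "finite V" "finite T" "V \<subseteq> J j" "dfn (Inl ` V \<union> Inr ` T) P"
            by (simp_all add: Ka_def U_def)
          show "V \<subseteq> J i" using *(5) J_mono[OF *(2)] by (rule subset_trans)
        qed
        have Kc'D: "\<alpha> \<in> J i" "\<beta> \<in> J i" "(\<alpha>, \<beta>) \<in> R" "wf_fm L \<phi>" if "(\<alpha>, \<beta>, \<phi>, F) \<in> Kc'" for \<alpha> \<beta> \<phi> F
        proof -
          have "(\<alpha>, \<beta>, \<phi>, F) \<in> Kc" using Kc'(1) that by (rule subsetD)
          then show "\<alpha> \<in> J i" "\<beta> \<in> J i" "(\<alpha>, \<beta>) \<in> R" "wf_fm L \<phi>" by (simp_all add: Kc_def)
        qed
        have Vs: "finite Vs" "Vs \<subseteq> J i"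
        proof -
          show "finite Vs" unfolding Vs_def using Ka'(2) Kb'(2) Kc'(2) Ka'D(3)
            by (intro finite_UnI finite_UN_I) (auto split: prod.splits)
          show "Vs \<subseteq> J i" unfolding Vs_def using Kb'(1)
            by (intro Un_least UN_least) (auto dest: Ka'D(6) Kc'D(1,2) split: prod.splits)
        qed
        \<comment> \<open>First the unknowns subject to coherence conditions: \<open>V1\<close>
          contains them and is an initial segment of \<open>Vs\<close>, so that the rest can be
          placed further up.\<close>
        have "\<exists>V1 X. V1 \<subseteq> Vs \<and> X ` V1 \<subseteq> dom M \<and> (\<forall>v\<in>V1. Z i \<prec> X v) \<and>
          (\<forall>(j, V, T, P)\<in>Ka'. V \<subseteq> V1 \<and> E T P X (f j) (m j)) \<and>
          (\<forall>(\<alpha>, \<beta>, \<phi>, F)\<in>Kc'. \<alpha> \<in> V1 \<longrightarrow> \<beta> \<in> V1 \<longrightarrow> W \<phi> F (X \<alpha>) (X \<beta>)) \<and>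
          (\<forall>u\<in>V1. \<forall>v\<in>Vs - V1. (u, v) \<in> R)"
        proof (cases "Ka' = {}")
          case True
          then show ?thesis by (intro exI[of _ "{}"]) auto
        next
          case False
          have js: "fst ` Ka' \<subseteq> U" using Ka'D(1) by auto
          have "total_on (fst ` Ka') R" using js UF R_total unfolding total_on_def by blast
          then obtain k where k: "k \<in> fst ` Ka'" "\<And>j. j \<in> fst ` Ka' \<Longrightarrow> j = k \<or> (j, k) \<in> R"
            using finite_greatest[of "fst ` Ka'" R] Ka'(2) False trans_R by auto
          have kU: "k \<in> U" "(k, i) \<in> R" "k \<in> Field \<kappa>" using k(1) js UF by (auto simp: U_def)
          have fk: "range (f k) \<subseteq> dom M" "PA f k (f k)" "PB k (f k)" "PC k (f k)"
            using IH[OF kU(2)] kU(3) by (auto simp: Pr_def)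
          define V1 where "V1 = Vs \<inter> J k"
          have VV1: "V \<subseteq> V1" "finite V" "V \<subseteq> J j" "finite T" "dfn (Inl ` V \<union> Inr ` T) P" "j = k \<or> (j, k) \<in> R"
            "j \<in> Field \<kappa>"
            if "(j, V, T, P) \<in> Ka'" for j V T P
          proof -
            note * = Ka'D[OF that]
            show "finite V" "finite T" "V \<subseteq> J j" "dfn (Inl ` V \<union> Inr ` T) P" by fact+
            show "j \<in> Field \<kappa>" using UF[OF *(1)] .
            show jk: "j = k \<or> (j, k) \<in> R" using k(2)[of j] that by force
            then have "V \<subseteq> J k" using *(5) J_mono[of j k] by blast
            moreover have "V \<subseteq> Vs" using that by (auto simp: Vs_def)
            ultimately show "V \<subseteq> V1" by (simp add: V1_def)
          qed
          \<comment> \<open>The chain conditions within \<open>V1\<close> enter \<open>\<P>\<close>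
            beside the coherence predicates, so that the copy \<open>X\<close> inherits them from
            \<open>f k\<close>.\<close>
          define w where "w = (\<lambda>(\<alpha>, \<beta>, \<phi>, F) (e :: 'k + 'a \<Rightarrow> 'a). W \<phi> F (e (Inl \<alpha>)) (e (Inl \<beta>)))"
          define Kw where "Kw = {(\<alpha>, \<beta>, \<phi>, F) \<in> Kc'. \<alpha> \<in> V1 \<and> \<beta> \<in> V1}"
          define \<P> where "\<P> = (\<lambda>(j, V, T, P). P) ` Ka' \<union> w ` Kw"
          have "finite Kw" by (rule finite_subset[OF _ Kc'(2)]) (auto simp: Kw_def)
          then have "finite \<P>" using Ka'(2) by (simp add: \<P>_def)
          moreover have "\<exists>T. finite T \<and> dfn (Inl ` V1 \<union> Inr ` T) P" if PP: "P \<in> \<P>" for P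
          proof -
            consider q where "q \<in> Ka'" "P = (\<lambda>(j, V, T, P). P) q" | q where "q \<in> Kw" "P = w q"
              using PP unfolding \<P>_def by blast
            then consider j V T where "(j, V, T, P) \<in> Ka'"
              | \<alpha> \<beta> \<phi> F where "(\<alpha>, \<beta>, \<phi>, F) \<in> Kw" "P = w (\<alpha>, \<beta>, \<phi>, F)"
            proof cases
              case (1 q)
              obtain j V T P' where "q = (j, V, T, P')" by (metis prod_cases4)
              then show ?thesis using 1 by (intro that(1)[of j V T]) simp
            next
              case (2 q)
              obtain \<alpha> \<beta> \<phi> F where "q = (\<alpha>, \<beta>, \<phi>, F)" by (metis prod_cases4)
              then show ?thesis using 2 by (intro that(2)[of \<alpha> \<beta> \<phi> F]) simp_all
            qed
            then show ?thesis
            proof cases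
              case 1
              have "dfn (Inl ` V1 \<union> Inr ` T) P"
                by (rule dfn_mono[OF VV1(5)[OF 1]]) (use VV1(1)[OF 1] in auto)
              with VV1(4)[OF 1] show ?thesis by (intro exI[of _ T] conjI)
            next
              case 2
              then have "dfn (Inl ` V1 \<union> Inr ` {}) P"
                unfolding 2(2) w_def prod.case by (intro dfn_W) (auto simp: Kw_def dest: Kc'D(4))
              then show ?thesis by (intro exI[of _ "{}"]) simp
            qed
          qed
          \<comment> \<open>\<open>unbounded\<close> handles a single predicate, hence the passage
            from \<open>\<P>\<close> to \<open>S\<close>.\<close>
          ultimately have "\<exists>S T. finite T \<and> dfn (Inl ` V1 \<union> Inr ` T) S \<and> controls V1 T S \<P>"
            by (rule combine)
          then obtain S T where S: "finite T" "dfn (Inl ` V1 \<union> Inr ` T) S" "controls V1 T S \<P>"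
            by (elim exE conjE)
          obtain z where z: "z \<in> dom M" "m k \<lless> z" "z \<lless> Z k" using Z(2)[OF kU(3)] by blast
          have V1: "finite V1" "\<And>v. v \<in> V1 \<Longrightarrow> Z k \<prec> f k v" "f k ` V1 \<subseteq> dom M" "V1 \<subseteq> Vs"
            using Vs(1) fk(1,3) by (auto simp: V1_def PB_def)
          have "\<exists>X. X ` V1 \<subseteq> dom M \<and> E T S (f k) X (m k) \<and> (\<forall>v\<in>V1. Z i \<prec> X v)"
            by (rule unbounded[OF z(2,3) mdom[OF kU(3)] z(1) Z(1)[OF kU(3)] Z(1)[OF i] S(2) V1(1) S(1) V1(3)])
              (rule V1(2))
          then obtain X where X: "X ` V1 \<subseteq> dom M" "E T S (f k) X (m k)" "\<forall>v\<in>V1. Z i \<prec> X v"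
            by (elim exE conjE)
          have same: "\<exists>T. dfn (Inl ` V1 \<union> Inr ` T) P \<and> E T P (f k) X (m k)" if "P \<in> \<P>" for P
            using controlsD[OF S(3) V1(3) X(1) m[OF kU(3)] X(2) that] .
          \<comment> \<open>\<open>X\<close> is like \<open>f k\<close> over the elements below
            \<open>m k\<close>, hence over those below \<open>m j\<close>, and there
            \<open>f k\<close> is like \<open>f j\<close> by the induction hypothesis at
            \<open>k\<close>.\<close>
          have EE: "E T' P X (f j) (m j)" if "(j, V, T', P) \<in> Ka'" for j V T' P
          proof -
            note V = VV1[OF that]
            have "P \<in> \<P>" unfolding \<P>_def by (intro UnI1 image_eqI[OF _ that]) simp
            from same[OF this] obtain T'' where T'': "E T'' P (f k) X (m k)" by (elim exE conjE)
            moreover have "dfn (Inl ` V1 \<union> Inr ` T') P"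
              by (rule dfn_mono[OF V(5)]) (use V(1) in auto)
            ultimately have "E T' P (f k) X (m k)"
              by (rule E_change_block) (fact V1(3) X(1) m[OF kU(3)])+
            then have "E T' P (f k) X (m j)"
              by (rule E_mono) (use mdom V(6,7) kU(3) mono in auto)
            moreover have "E T' P (f k) (f j) (m j)"
            proof (cases "j = k")
              case False
              then show ?thesis using fk(2)[unfolded PA_def, rule_format, of j V T' P] V by simp
            qed (simp add: E_def)
            ultimately show ?thesis using E_trans[OF E_sym] by blast
          qed
          have WW: "W \<phi> F (X \<alpha>) (X \<beta>)" if "(\<alpha>, \<beta>, \<phi>, F) \<in> Kc'" "\<alpha> \<in> V1" "\<beta> \<in> V1" for \<alpha> \<beta> \<phi> F
          proof -
            have "w (\<alpha>, \<beta>, \<phi>, F) \<in> \<P>" using that by (auto simp: \<P>_def Kw_def)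
            from same[OF this] obtain T where T: "E T (w (\<alpha>, \<beta>, \<phi>, F)) (f k) X (m k)" by (elim exE conjE)
            obtain a where "a \<in> below (m k)" using m[OF kU(3)] by (auto simp: wide_def)
            then have "w (\<alpha>, \<beta>, \<phi>, F) (case_sum (f k) (\<lambda>_. a)) = w (\<alpha>, \<beta>, \<phi>, F) (case_sum X (\<lambda>_. a))"
              by (intro ED[OF T]) auto
            moreover note Kc'D(3,4)[OF that(1)]
            moreover have "\<alpha> \<in> J k" "\<beta> \<in> J k" using that by (auto simp: V1_def)
            ultimately show ?thesis using fk(4) by (simp add: PC_def w_def ll_def)
          qed
          \<comment> \<open>Members of \<open>V1\<close> precede \<open>k\<close>, while unknowns
            outside \<open>J k\<close> are \<open>k\<close> itself or come after it.\<close>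
          have RR: "(u, v) \<in> R" if "u \<in> V1" "v \<in> Vs - V1" for u v
          proof -
            have "(u, k) \<in> R" "v \<in> J i" "v \<notin> J k" using that Vs(2) by (auto simp: V1_def J_def)
            moreover from this have "v = k \<or> (k, v) \<in> R"
              using R_total[of v k] kU R_Field[of v i] by (auto simp: J_def)
            ultimately show ?thesis using R_trans by blast
          qed
          have "\<forall>(j, V, T, P)\<in>Ka'. V \<subseteq> V1 \<and> E T P X (f j) (m j)"
            by clarify (rule conjI, erule VV1(1), erule EE)
          moreover have "\<forall>(\<alpha>, \<beta>, \<phi>, F)\<in>Kc'. \<alpha> \<in> V1 \<longrightarrow> \<beta> \<in> V1 \<longrightarrow> W \<phi> F (X \<alpha>) (X \<beta>)"
            by clarify (rule WW)
          moreover have "\<forall>u\<in>V1. \<forall>v\<in>Vs - V1. (u, v) \<in> R"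
            using RR by blast
          ultimately show ?thesis
            using X(1,3) V1(4) by (intro exI[of _ V1] exI[of _ X] conjI)
        qed
        then obtain V1 X where V1: "V1 \<subseteq> Vs" "X ` V1 \<subseteq> dom M" "\<forall>v\<in>V1. Z i \<prec> X v"
          and KA: "\<forall>(j, V, T, P)\<in>Ka'. V \<subseteq> V1 \<and> E T P X (f j) (m j)"
          and KC: "\<forall>(\<alpha>, \<beta>, \<phi>, F)\<in>Kc'. \<alpha> \<in> V1 \<longrightarrow> \<beta> \<in> V1 \<longrightarrow> W \<phi> F (X \<alpha>) (X \<beta>)"
          and split: "\<forall>u\<in>V1. \<forall>v\<in>Vs - V1. (u, v) \<in> R"
          by (elim exE conjE)
        have "finite V1" using V1(1) Vs(1) finite_subset by blast
        \<comment> \<open>\<open>b\<close> is above \<open>Z i\<close> and all values used so far;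
          the remaining unknowns are placed \<open>\<lless>\<close>-above it.\<close>
        then obtain b where b: "b \<in> dom M" "Z i \<prec> b" "\<forall>v\<in>V1. X v \<prec> b"
          using upper_bound[of "insert (Z i) (X ` V1)"] V1(2) Z(1)[OF i] by auto
        have "finite (Vs - V1)" using Vs(1) by simp
        from grow_above[OF this b(1)] obtain Y where Y: "Y ` (Vs - V1) \<subseteq> dom M" "\<forall>v\<in>Vs - V1. b \<lless> Y v"
          "\<forall>\<alpha>\<in>Vs - V1. \<forall>\<beta>\<in>Vs - V1. (\<alpha>, \<beta>) \<in> R \<longrightarrow> Y \<alpha> \<lless> Y \<beta>" by blast
        define H where "H v = (if v \<in> V1 then X v else if v \<in> Vs then Y v else a0)" for v
        have Hdom: "H v \<in> dom M" for v using V1(1,2) Y(1) a0 by (auto simp: H_def)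
        have HZ: "Z i \<prec> H v" if "v \<in> Vs" for v
        proof (cases "v \<in> V1")
          case False
          then have "b \<prec> Y v" using Y(2) that ll_less by blast
          then show ?thesis using False that b Y(1) Z(1)[OF i] trans[of "Z i" b "Y v"] by (auto simp: H_def)
        qed (use V1(3) in \<open>simp add: H_def\<close>)
        have "pa q (case_sum H id)" if "q \<in> Ka'" for q
        proof -
          obtain j V T P where q: "q = (j, V, T, P)" by (metis prod_cases4)
          note j = Ka'D(2,1,7)[OF that[unfolded q]]
          have V: "V \<subseteq> V1" "E T P X (f j) (m j)" using bspec[OF KA that] q by auto
          have "E T P H (f j) (m j)"
            by (rule E_support[OF j(3) _ _ _ _ V(2)]) (use V V1(2) fdom[OF j(2)] in \<open>auto simp: H_def\<close>)
          then show ?thesis by (simp add: q pa_def)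
        qed
        moreover have "pb \<alpha> (case_sum H id)" if "\<alpha> \<in> Kb'" for \<alpha>
          using HZ[of \<alpha>] that by (auto simp: pb_def Vs_def)
        moreover have "pc q (case_sum H id)" if "q \<in> Kc'" for q
        proof -
          obtain \<alpha> \<beta> \<phi> F where q: "q = (\<alpha>, \<beta>, \<phi>, F)" by (metis prod_cases4)
          note * = Kc'D(3,4)[OF that[unfolded q]]
          have in_Vs: "\<alpha> \<in> Vs" "\<beta> \<in> Vs" using that q by (force simp: Vs_def)+
          have notR: "(\<beta>, \<alpha>) \<notin> R" using *(1) R_trans by blast
          \<comment> \<open>If \<open>\<beta>\<close> lies in the initial segment \<open>V1\<close>,
            so does \<open>\<alpha>\<close>. Otherwise the value at \<open>\<beta>\<close> comes
            from \<open>grow_above\<close>, and the value at \<open>\<alpha>\<close> is below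
            \<open>b\<close> or belongs to the same chain.\<close>
          have "W \<phi> F (H \<alpha>) (H \<beta>)"
          proof (cases "\<beta> \<in> V1")
            case True
            then have "\<alpha> \<in> V1" using split in_Vs notR by blast
            then show ?thesis using True bspec[OF KC that] q by (simp add: H_def)
          next
            case \<beta>: False
            have "H \<alpha> \<lless> Y \<beta>"
            proof (cases "\<alpha> \<in> V1")
              case True
              have "b \<lless> Y \<beta>" using Y(2) in_Vs \<beta> by blast
              then have "X \<alpha> \<lless> Y \<beta>"
                by (rule ll_mono) (use True b V1(2) Y(1) in_Vs \<beta> in auto)
              then show ?thesis using True by (simp add: H_def)
            next
              case False
              then show ?thesis using Y(3) \<beta> in_Vs *(1) by (simp add: H_def)
            qed
            then show ?thesis using \<beta> in_Vs *(2) by (simp add: H_def ll_def)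
          qed
          then show ?thesis by (simp add: q pc_def)
        qed
        ultimately have "\<forall>P\<in>pa ` Ka' \<union> pb ` Kb' \<union> pc ` Kc'. P (case_sum H id)"
          unfolding ball_Un by simp
        moreover have "Q \<subseteq> pa ` Ka' \<union> pb ` Kb' \<union> pc ` Kc'"
          unfolding Ka'(3)[symmetric] Kb'(3)[symmetric] Kc'(3)[symmetric] using Q(1) by blast
        ultimately have "\<forall>P\<in>Q. P (case_sum H id)" by (meson subsetD)
        then show "\<exists>X. X ` J i \<subseteq> dom M \<and> (\<forall>P\<in>Q. P (case_sum X id))" using Hdom by blast
      qed
      then obtain X where X: "range X \<subseteq> dom M"
        and \<Sigma>: "\<forall>P\<in>pa ` Ka \<union> pb ` J i \<union> pc ` Kc. P (case_sum X id)"
        by (elim exE conjE)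
      have XA: "pa q (case_sum X id)" if "q \<in> Ka" for q using \<Sigma> that unfolding ball_Un by simp
      have XB: "pb \<alpha> (case_sum X id)" if "\<alpha> \<in> J i" for \<alpha> using \<Sigma> that unfolding ball_Un by simp
      have XC: "pc q (case_sum X id)" if "q \<in> Kc" for q using \<Sigma> that unfolding ball_Un by simp
      have "PA f i X"
        unfolding PA_def
      proof (intro allI impI)
        fix j V P and T :: "'a set"
        assume "(j, i) \<in> R" "finite V" "finite T" "V \<subseteq> J j" "dfn (Inl ` V \<union> Inr ` T) P"
        then have "(j, V, T, P) \<in> Ka" by (simp add: Ka_def U_def)
        from XA[OF this] show "E T P X (f j) (m j)" by (simp add: pa_def)
      qed
      moreover have "PB i X" using XB by (simp add: PB_def pb_def)
      moreover have "PC i X"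
        unfolding PC_def ll_def
      proof (intro ballI allI impI)
        fix \<alpha> \<beta> \<phi> F assume "\<alpha> \<in> J i" "\<beta> \<in> J i" "(\<alpha>, \<beta>) \<in> R" "wf_fm L \<phi>"
        then have "(\<alpha>, \<beta>, \<phi>, F) \<in> Kc" by (simp add: Kc_def)
        from XC[OF this] show "W \<phi> F (X \<alpha>) (X \<beta>)" by (simp add: pc_def)
      qed
      ultimately show ?thesis using X unfolding Pr_def by (intro exI[of _ X] conjI impI)
    qed
  qed
  then show ?thesis unfolding Pr_def PA_def PB_def PC_def .
qed

end

section \<open>Limits modulo eventual equality\<close>

context saturated_model
begin

definition ev :: "('k \<Rightarrow> bool) \<Rightarrow> bool" where
  "ev P \<longleftrightarrow> (\<exists>i\<in>Field \<kappa>. \<forall>j. (i, j) \<in> R \<longrightarrow> P j)"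

lemma R_upper:
  assumes "finite B" "B \<subseteq> Field \<kappa>"
  shows "\<exists>j\<in>Field \<kappa>. \<forall>i\<in>B. (i, j) \<in> R"
proof (cases "B = {}")
  case True
  then show ?thesis using card(2) by (metis ball_empty ex_in_conv finite.emptyI)
next
  case False
  have "total_on B R" using assms(2) R_total unfolding total_on_def by blast
  then obtain b where b: "b \<in> B" "\<forall>c\<in>B. c = b \<or> (c, b) \<in> R"
    using finite_greatest[OF assms(1) False trans_R] by blast
  then obtain j where j: "j \<in> Field \<kappa>" "(b, j) \<in> R" using R_unbounded assms(2) by blast
  have "(i, j) \<in> R" if "i \<in> B" for i
    using b(2) that j(2) R_trans[of i b j] by metis
  with j(1) show ?thesis by blast
qed

lemma ev_mono: "ev P \<Longrightarrow> (\<And>i. P i \<Longrightarrow> Q i) \<Longrightarrow> ev Q"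
  unfolding ev_def by blast

lemma ev_above: "i \<in> Field \<kappa> \<Longrightarrow> ev (\<lambda>j. (i, j) \<in> R)"
  unfolding ev_def by blast

lemma ev_True: "ev (\<lambda>i. True)"
  unfolding ev_def using card(2) by (metis ex_in_conv finite.emptyI)

lemma ev_conj: "ev P \<Longrightarrow> ev Q \<Longrightarrow> ev (\<lambda>i. P i \<and> Q i)"
  unfolding ev_def
proof -
  assume "\<exists>i\<in>Field \<kappa>. \<forall>j. (i, j) \<in> R \<longrightarrow> P j" "\<exists>i\<in>Field \<kappa>. \<forall>j. (i, j) \<in> R \<longrightarrow> Q j"
  then obtain i i' where i: "i \<in> Field \<kappa>" "\<forall>j. (i, j) \<in> R \<longrightarrow> P j" "i' \<in> Field \<kappa>" "\<forall>j. (i', j) \<in> R \<longrightarrow> Q j"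
    by blast
  then obtain k where "k \<in> Field \<kappa>" "(i, k) \<in> R" "(i', k) \<in> R" using R_upper[of "{i, i'}"] by auto
  then show "\<exists>i\<in>Field \<kappa>. \<forall>j. (i, j) \<in> R \<longrightarrow> P j \<and> Q j"
    using i(2,4) R_trans[of i k] R_trans[of i' k] by (intro bexI[of _ k]) simp_all
qed

lemma ev_Ball: "finite B \<Longrightarrow> (\<And>b. b \<in> B \<Longrightarrow> ev (P b)) \<Longrightarrow> ev (\<lambda>i. \<forall>b\<in>B. P b i)"
  by (induction B rule: finite_induct) (auto simp: ev_True intro: ev_conj)

lemma ev_False: "\<not> ev (\<lambda>i. False)"
  unfolding ev_def using R_unbounded by blast

lemma ev_cong: "ev (\<lambda>i. P i = Q i) \<Longrightarrow> ev P = ev Q"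
proof
  assume "ev (\<lambda>i. P i = Q i)" "ev P" from ev_conj[OF this] show "ev Q" by (rule ev_mono) blast
next
  assume "ev (\<lambda>i. P i = Q i)" "ev Q" from ev_conj[OF this] show "ev P" by (rule ev_mono) blast
qed

lemma ev_const: "ev (\<lambda>i. c) = c"
  using ev_True ev_False by (cases c) auto

end

text \<open>\<open>D\<close> is a set of names in the carrier type and \<open>val\<close> gives the
  functions they name. By \<open>val_inj\<close> each class of eventual equality has at most one
  name; \<open>decided\<close> replaces the ultrafilter of an ultraproduct, and
  \<open>skolem\<close> with \<open>closed\<close> provides witnesses of existential
  formulas.\<close>

locale limit_model = saturated_model L M \<kappa> for L and M :: "'a struc" and \<kappa> :: "'k rel" +
  fixes D :: "'a set" and val :: "'a \<Rightarrow> 'k \<Rightarrow> 'a"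
  assumes D_nonempty: "D \<noteq> {}"
    and val_dom: "b \<in> D \<Longrightarrow> val b i \<in> dom M"
    and val_inj: "b \<in> D \<Longrightarrow> b' \<in> D \<Longrightarrow> ev (\<lambda>i. val b i = val b' i) \<Longrightarrow> b = b'"
    and closed: "wf_trm L \<tau> \<Longrightarrow> range e \<subseteq> D \<Longrightarrow> \<exists>b\<in>D. ev (\<lambda>i. val b i = eval M (\<lambda>v. val (e v) i) \<tau>)"
    and decided: "wf_fm L \<phi> \<Longrightarrow> range e \<subseteq> D \<Longrightarrow>
      ev (\<lambda>i. sat M (\<lambda>v. val (e v) i) \<phi>) \<or> ev (\<lambda>i. \<not> sat M (\<lambda>v. val (e v) i) \<phi>)"
    and skolem: "wf_fm L \<phi> \<Longrightarrow> \<exists>\<tau>. wf_trm L \<tau> \<and> (\<forall>e. asg M e \<longrightarrow>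
      (\<exists>a\<in>dom M. sat M (e(y := a)) \<phi>) \<longrightarrow> sat M (e(y := eval M e \<tau>)) \<phi>)"
begin

definition N :: "'a struc" where
  "N = \<lparr>dom = D,
     funi = \<lambda>f bs. SOME b. b \<in> D \<and> ev (\<lambda>i. val b i = funi M f (map (\<lambda>b. val b i) bs)),
     reli = \<lambda>r bs. ev (\<lambda>i. reli M r (map (\<lambda>b. val b i) bs))\<rparr>"

lemma dom_N: "dom N = D"
  by (simp add: N_def)

lemma lt_N: "lt L N a b \<longleftrightarrow> ev (\<lambda>i. val a i \<prec> val b i)"
  by (simp add: N_def lt_def)

lemma funi_N:
  assumes "f \<in> funs L" "length bs = farity L f" "set bs \<subseteq> D"
  shows "funi N f bs \<in> D \<and> ev (\<lambda>i. val (funi N f bs) i = funi M f (map (\<lambda>b. val b i) bs))"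
proof -
  obtain b0 where b0: "b0 \<in> D" using D_nonempty by blast
  \<comment> \<open>\<open>closed\<close> is applied to the term \<open>f\<close> of the first
    \<open>length bs\<close> variables; all other variables get the default
    \<open>b0\<close>.\<close>
  define e where "e v = (if v < length bs then bs ! v else b0)" for v
  have "range e \<subseteq> D" using assms(3) b0 by (auto simp: e_def)
  moreover have "wf_trm L (Fn f (map Var [0..<length bs]))" using assms by auto
  ultimately obtain b where b: "b \<in> D"
    "ev (\<lambda>i. val b i = eval M (\<lambda>v. val (e v) i) (Fn f (map Var [0..<length bs])))"
    using closed by blast
  moreover have "map (eval M (\<lambda>v. val (e v) i)) (map Var [0..<length bs]) = map (\<lambda>b. val b i) bs" for i
    by (rule nth_equalityI) (auto simp: e_def)
  ultimately have "\<exists>b. b \<in> D \<and> ev (\<lambda>i. val b i = funi M f (map (\<lambda>b. val b i) bs))" by auto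
  from someI_ex[OF this] show ?thesis by (simp add: N_def)
qed

lemma is_struc_N: "is_struc L N"
  using funi_N D_nonempty by (simp add: is_struc_def dom_N)

lemma eval_N:
  assumes "range e \<subseteq> D"
  shows "wf_trm L \<tau> \<Longrightarrow> eval N e \<tau> \<in> D \<and> ev (\<lambda>i. val (eval N e \<tau>) i = eval M (\<lambda>v. val (e v) i) \<tau>)"
proof (induction \<tau>)
  case (Var v)
  then show ?case using assms by (auto simp: ev_True)
next
  case (Fn f ts)
  let ?bs = "map (eval N e) ts"
  have IH: "eval N e t \<in> D" "ev (\<lambda>i. val (eval N e t) i = eval M (\<lambda>v. val (e v) i) t)" if "t \<in> set ts" for t
    using Fn that by auto
  have 1: "funi N f ?bs \<in> D" "ev (\<lambda>i. val (funi N f ?bs) i = funi M f (map (\<lambda>b. val b i) ?bs))"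
    using funi_N[of f ?bs] Fn.prems IH(1) by auto
  have 2: "ev (\<lambda>i. \<forall>t\<in>set ts. val (eval N e t) i = eval M (\<lambda>v. val (e v) i) t)"
    using IH(2) by (intro ev_Ball) auto
  have "ev (\<lambda>i. val (funi N f ?bs) i = funi M f (map (eval M (\<lambda>v. val (e v) i)) ts))"
    using ev_conj[OF 1(2) 2]
  proof (rule ev_mono)
    fix i assume i: "val (funi N f ?bs) i = funi M f (map (\<lambda>b. val b i) ?bs) \<and>
      (\<forall>t\<in>set ts. val (eval N e t) i = eval M (\<lambda>v. val (e v) i) t)"
    have m: "map (\<lambda>b. val b i) ?bs = map (eval M (\<lambda>v. val (e v) i)) ts" using i by simp
    show "val (funi N f ?bs) i = funi M f (map (eval M (\<lambda>v. val (e v) i)) ts)"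
      using conjunct1[OF i] unfolding m .
  qed
  with 1(1) show ?case by simp
qed

text \<open>The induction known from ultraproducts. Equality rests on \<open>val_inj\<close> and
  negation on \<open>decided\<close>; for a quantifier a Skolem term produces witnesses uniformly in
  \<open>i\<close>, and their class has a name by \<open>closed\<close>.\<close>

theorem Los:
  "wf_fm L \<phi> \<Longrightarrow> range e \<subseteq> D \<Longrightarrow> sat N e \<phi> \<longleftrightarrow> ev (\<lambda>i. sat M (\<lambda>v. val (e v) i) \<phi>)"
proof (induction \<phi> arbitrary: e)
  case (Eq s t)
  note s = eval_N[OF Eq(2), of s] and t = eval_N[OF Eq(2), of t]
  have "sat N e (Eq s t) \<longleftrightarrow> ev (\<lambda>i. val (eval N e s) i = val (eval N e t) i)"
    using s t Eq(1) val_inj ev_True by auto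
  also have "\<dots> \<longleftrightarrow> ev (\<lambda>i. sat M (\<lambda>v. val (e v) i) (Eq s t))"
  proof (rule ev_cong)
    have "ev (\<lambda>i. val (eval N e s) i = eval M (\<lambda>v. val (e v) i) s \<and>
      val (eval N e t) i = eval M (\<lambda>v. val (e v) i) t)"
      using s t Eq(1) by (intro ev_conj) auto
    then show "ev (\<lambda>i. (val (eval N e s) i = val (eval N e t) i) = sat M (\<lambda>v. val (e v) i) (Eq s t))"
      by (rule ev_mono) auto
  qed
  finally show ?case .
next
  case (Rel r ts)
  have "ev (\<lambda>i. \<forall>t\<in>set ts. val (eval N e t) i = eval M (\<lambda>v. val (e v) i) t)"
    using eval_N[OF Rel(2)] Rel(1) by (intro ev_Ball) auto
  then have "ev (\<lambda>i. reli M r (map (\<lambda>b. val b i) (map (eval N e) ts)) =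
    reli M r (map (eval M (\<lambda>v. val (e v) i)) ts))"
  proof (rule ev_mono)
    fix i assume "\<forall>t\<in>set ts. val (eval N e t) i = eval M (\<lambda>v. val (e v) i) t"
    then have "map (\<lambda>b. val b i) (map (eval N e) ts) = map (eval M (\<lambda>v. val (e v) i)) ts" by simp
    then show "reli M r (map (\<lambda>b. val b i) (map (eval N e) ts)) =
      reli M r (map (eval M (\<lambda>v. val (e v) i)) ts)" by (rule arg_cong)
  qed
  from ev_cong[OF this] show ?case by (simp add: N_def)
next
  case (Neg \<phi>)
  have IH: "sat N e \<phi> \<longleftrightarrow> ev (\<lambda>i. sat M (\<lambda>v. val (e v) i) \<phi>)" using Neg by simp
  have "\<not> (ev (\<lambda>i. sat M (\<lambda>v. val (e v) i) \<phi>) \<and> ev (\<lambda>i. \<not> sat M (\<lambda>v. val (e v) i) \<phi>))"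
    using ev_conj[of "\<lambda>i. sat M (\<lambda>v. val (e v) i) \<phi>" "\<lambda>i. \<not> sat M (\<lambda>v. val (e v) i) \<phi>"] ev_False by auto
  then show ?case using IH decided[of \<phi> e] Neg.prems by auto
next
  case (Conj \<phi> \<psi>)
  have "ev (\<lambda>i. sat M (\<lambda>v. val (e v) i) \<phi> \<and> sat M (\<lambda>v. val (e v) i) \<psi>) \<longleftrightarrow>
    ev (\<lambda>i. sat M (\<lambda>v. val (e v) i) \<phi>) \<and> ev (\<lambda>i. sat M (\<lambda>v. val (e v) i) \<psi>)"
    by (auto elim: ev_mono intro: ev_conj)
  then show ?case using Conj by simp
next
  case (Ex y \<phi>)
  have upd: "(\<lambda>v. val ((e(y := b)) v) i) = (\<lambda>v. val (e v) i)(y := val b i)" for b i by auto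
  have asg: "asg M (\<lambda>v. val (e v) i)" for i using Ex.prems(2) val_dom by (auto simp: asg_def)
  have IH: "sat N (e(y := b)) \<phi> \<longleftrightarrow> ev (\<lambda>i. sat M ((\<lambda>v. val (e v) i)(y := val b i)) \<phi>)" if "b \<in> D" for b
  proof -
    have "sat N (e(y := b)) \<phi> \<longleftrightarrow> ev (\<lambda>i. sat M (\<lambda>v. val ((e(y := b)) v) i) \<phi>)"
      using Ex.prems that by (intro Ex.IH) auto
    then show ?thesis unfolding upd .
  qed
  have "(\<exists>b\<in>D. ev (\<lambda>i. sat M ((\<lambda>v. val (e v) i)(y := val b i)) \<phi>)) \<longleftrightarrow>
    ev (\<lambda>i. \<exists>a\<in>dom M. sat M ((\<lambda>v. val (e v) i)(y := a)) \<phi>)"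
  proof
    assume "\<exists>b\<in>D. ev (\<lambda>i. sat M ((\<lambda>v. val (e v) i)(y := val b i)) \<phi>)"
    then obtain b where b: "b \<in> D" "ev (\<lambda>i. sat M ((\<lambda>v. val (e v) i)(y := val b i)) \<phi>)" by blast
    from b(2) show "ev (\<lambda>i. \<exists>a\<in>dom M. sat M ((\<lambda>v. val (e v) i)(y := a)) \<phi>)"
      by (rule ev_mono) (rule bexI[OF _ val_dom[OF b(1)]])
  next
    assume *: "ev (\<lambda>i. \<exists>a\<in>dom M. sat M ((\<lambda>v. val (e v) i)(y := a)) \<phi>)"
    obtain \<tau> where \<tau>: "wf_trm L \<tau>" "\<And>e. asg M e \<Longrightarrow> \<exists>a\<in>dom M. sat M (e(y := a)) \<phi> \<Longrightarrow>
      sat M (e(y := eval M e \<tau>)) \<phi>" using skolem[of \<phi> y] Ex.prems(1) by auto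
    obtain b where b: "b \<in> D" "ev (\<lambda>i. val b i = eval M (\<lambda>v. val (e v) i) \<tau>)"
      using closed[OF \<tau>(1) Ex.prems(2)] by blast
    have "ev (\<lambda>i. sat M ((\<lambda>v. val (e v) i)(y := val b i)) \<phi>)"
      using ev_conj[OF * b(2)]
    proof (rule ev_mono)
      fix i assume i: "(\<exists>a\<in>dom M. sat M ((\<lambda>v. val (e v) i)(y := a)) \<phi>) \<and> val b i = eval M (\<lambda>v. val (e v) i) \<tau>"
      show "sat M ((\<lambda>v. val (e v) i)(y := val b i)) \<phi>"
        unfolding conjunct2[OF i] by (rule \<tau>(2)[OF asg conjunct1[OF i]])
    qed
    with b(1) show "\<exists>b\<in>D. ev (\<lambda>i. sat M ((\<lambda>v. val (e v) i)(y := val b i)) \<phi>)" by blast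
  qed
  then show ?case using IH by (simp add: dom_N)
qed

end

section \<open>Cardinality of the set of terms with parameters\<close>

instance trm :: countable
  by countable_datatype

text \<open>Induction on \<open>n\<close> bounds the lists of length \<open>n\<close> by
  \<open>|A|\<close>; then a countable union is taken.\<close>

lemma card_of_lists_ordLeq:
  assumes "infinite A"
  shows "|lists A| \<le>o |A|"
proof -
  have r: "infinite (Field |A| )" "Card_order |A|"
    using assms by (simp_all add: Field_card_of card_of_card_order_on)
  have len: "|{l \<in> lists A. length l = n}| \<le>o |A|" for n
  proof (induction n)
    case 0
    have l0: "{l \<in> lists A. length l = 0} = {[]}" by auto
    have "A \<noteq> {}" using assms by auto
    then show ?case unfolding l0 by (rule card_of_singl_ordLeq)
  next
    case (Suc n)
    have "{l \<in> lists A. length l = Suc n} \<subseteq> (\<lambda>(a, l). a # l) ` (A \<times> {l \<in> lists A. length l = n})"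
      by (auto simp: length_Suc_conv image_iff)
    then have "|{l \<in> lists A. length l = Suc n}| \<le>o |(\<lambda>(a, l). a # l) ` (A \<times> {l \<in> lists A. length l = n})|"
      by (rule card_of_mono1)
    also have "|(\<lambda>(a, l). a # l) ` (A \<times> {l \<in> lists A. length l = n})| \<le>o |A \<times> {l \<in> lists A. length l = n}|"
      by (rule card_of_image)
    also have "|A \<times> {l \<in> lists A. length l = n}| \<le>o |A|"
      by (rule card_of_Times_ordLeq_infinite_Field[OF r(1) _ Suc r(2)]) (simp add: card_of_mono1)
    finally show ?case .
  qed
  have "lists A = (\<Union>n. {l \<in> lists A. length l = n})" by auto
  moreover have "|\<Union>n. {l \<in> lists A. length l = n}| \<le>o |A|"
    using len assms by (intro card_of_UNION_ordLeq_infinite_Field[OF r]) (auto simp: infinite_iff_card_of_nat)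
  ultimately show ?thesis by simp
qed

section \<open>The end extension generated by a coherent tower\<close>

text \<open>The output of the recursion together with the data it was run on. \<open>I\<close> will
  be a copy of \<open>lam\<close> inside \<open>\<kappa>\<close>; having no greatest element, it can
  index a strictly increasing cofinal sequence of the extension.\<close>

locale tower = saturated_model L M \<kappa> for L and M :: "'a struc" and \<kappa> :: "'k rel" +
  fixes m Z :: "'k \<Rightarrow> 'a" and I :: "'k set" and x :: "'k \<Rightarrow> 'k \<Rightarrow> 'a" and J :: "'k \<Rightarrow> 'k set"
  defines "J \<equiv> \<lambda>i. {\<alpha> \<in> I. (\<alpha>, i) \<in> R}"
  assumes I: "I \<subseteq> Field \<kappa>" "I \<noteq> {}" "\<And>\<alpha>. \<alpha> \<in> I \<Longrightarrow> \<exists>\<beta>\<in>I. (\<alpha>, \<beta>) \<in> R"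
    and card_I: "|I| \<le>o |dom M|"
    and m: "\<And>i. i \<in> Field \<kappa> \<Longrightarrow> wide (m i)"
    and mono: "\<And>i j. (i, j) \<in> R \<Longrightarrow> m i \<prec> m j \<or> m i = m j"
    and cofinal: "\<And>a. a \<in> dom M \<Longrightarrow> \<exists>j\<in>Field \<kappa>. a \<prec> m j"
    and Z: "\<And>i. i \<in> Field \<kappa> \<Longrightarrow> Z i \<in> dom M"
      "\<And>i. i \<in> Field \<kappa> \<Longrightarrow> \<exists>z\<in>dom M. m i \<lless> z \<and> z \<lless> Z i"
    and x_dom: "\<And>i \<alpha>. x i \<alpha> \<in> dom M"
    and coherent: "\<And>i j V T P. (j, i) \<in> R \<Longrightarrow> finite V \<Longrightarrow> finite T \<Longrightarrow> V \<subseteq> J j \<Longrightarrow>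
       dfn (Inl ` V \<union> Inr ` T) P \<Longrightarrow> E (T :: 'a set) P (x i) (x j) (m j)"
    and x_above: "\<And>i \<alpha>. i \<in> Field \<kappa> \<Longrightarrow> \<alpha> \<in> J i \<Longrightarrow> Z i \<prec> x i \<alpha>"
    and x_ll: "\<And>i \<alpha> \<beta>. i \<in> Field \<kappa> \<Longrightarrow> \<alpha> \<in> J i \<Longrightarrow> \<beta> \<in> J i \<Longrightarrow> (\<alpha>, \<beta>) \<in> R \<Longrightarrow> x i \<alpha> \<lless> x i \<beta>"
    and skolem: "\<And>\<phi> y. wf_fm L \<phi> \<Longrightarrow> \<exists>\<tau>. wf_trm L \<tau> \<and> (\<forall>e. asg M e \<longrightarrow>
      (\<exists>a\<in>dom M. sat M (e(y := a)) \<phi>) \<longrightarrow> sat M (e(y := eval M e \<tau>)) \<phi>)"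
begin

definition X :: "'k \<Rightarrow> 'k + 'a \<Rightarrow> 'a" where
  "X i = case_sum (x i) id"

definition K :: "('k + 'a) set" where
  "K = Inl ` I \<union> Inr ` dom M"

text \<open>\<open>gen \<tau> s\<close> is the function \<open>i \<mapsto> \<tau> (x i, a)\<close>;
  \<open>s\<close> attaches the variables of \<open>\<tau>\<close> to coordinates of the tuple or to
  elements of \<open>M\<close>.\<close>

definition gen :: "trm \<Rightarrow> (nat \<Rightarrow> 'k + 'a) \<Rightarrow> 'k \<Rightarrow> 'a" where
  "gen \<tau> s i = eval M (\<lambda>v. X i (s v)) \<tau>"

definition G :: "('k \<Rightarrow> 'a) set" where
  "G = {gen \<tau> s |\<tau> s. wf_trm L \<tau> \<and> range s \<subseteq> K}"

lemma X_simps [simp]: "X i (Inl \<alpha>) = x i \<alpha>" "X i (Inr a) = a"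
  by (simp_all add: X_def)

lemma X_dom: "k \<in> K \<Longrightarrow> X i k \<in> dom M"
  by (auto simp: K_def x_dom)

lemma m_dom: "i \<in> Field \<kappa> \<Longrightarrow> m i \<in> dom M"
  using m by (simp add: wide_def)

lemma coherent_X:
  assumes "dfn (Inl ` V \<union> Inr ` T) P" "finite V" "finite T" "V \<subseteq> J j" "T \<subseteq> below (m j)" "(j, i) \<in> R"
  shows "P (X i) = P (X j)"
  using ED[OF coherent[OF assms(6,2,3,4,1)], of id] assms(5) by (simp add: X_def)

text \<open>Upper bounds in \<open>\<kappa>\<close> take care of the finitely many coordinates,
  cofinality of \<open>m\<close> of the finitely many parameters.\<close>

lemma capture:
  assumes "finite V" "V \<subseteq> I" "finite T" "T \<subseteq> dom M" "k \<in> Field \<kappa>"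
  shows "\<exists>j\<in>Field \<kappa>. (k, j) \<in> R \<and> V \<subseteq> J j \<and> T \<subseteq> below (m j)"
proof -
  have "\<forall>a\<in>T. \<exists>j. j \<in> Field \<kappa> \<and> a \<prec> m j" using cofinal assms(4) by blast
  from bchoice[OF this] obtain f where f: "\<And>a. a \<in> T \<Longrightarrow> f a \<in> Field \<kappa> \<and> a \<prec> m (f a)" by blast
  have "finite (insert k (V \<union> f ` T))" "insert k (V \<union> f ` T) \<subseteq> Field \<kappa>"
    using assms I(1) f by auto
  from R_upper[OF this] obtain j where j: "j \<in> Field \<kappa>" "\<forall>i\<in>insert k (V \<union> f ` T). (i, j) \<in> R" by blast
  have "a \<prec> m j" if "a \<in> T" for a
  proof -
    have "(f a, j) \<in> R" using j(2) that by simp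
    from mono[OF this] show ?thesis
      using f[OF that] trans[of a "m (f a)" "m j"] m_dom j(1) assms(4) that by auto
  qed
  then show ?thesis using j assms(2,4) by (intro bexI[of _ j]) (auto simp: J_def)
qed

text \<open>Once a stage captures the finite set \<open>C\<close>, coherence fixes the truth value
  at all later stages. This is the source of \<open>decided\<close>.\<close>

lemma stable:
  assumes P: "dfn C P" and C: "finite C" "C \<subseteq> K"
  shows "ev (\<lambda>i. P (X i)) \<or> ev (\<lambda>i. \<not> P (X i))"
proof -
  define V T where "V = Inl -` C" and "T = Inr -` C"
  have VT: "finite V" "finite T" "V \<subseteq> I" "T \<subseteq> dom M" "C = Inl ` V \<union> Inr ` T"
    using C by (auto simp: V_def T_def K_def finite_vimageI)
  obtain k where k: "k \<in> Field \<kappa>" using I by blast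
  obtain j where j: "j \<in> Field \<kappa>" "V \<subseteq> J j" "T \<subseteq> below (m j)"
    using capture[OF VT(1,3,2,4) k] by blast
  have "P (X i) = P (X j)" if "(j, i) \<in> R" for i
    using coherent_X[OF P[unfolded VT(5)] VT(1,2) j(2,3) that] .
  then have "ev (\<lambda>i. P (X i) = P (X j))" using j(1) unfolding ev_def by blast
  then show ?thesis by (cases "P (X j)") auto
qed

text \<open>The value of each term is named by an existentially quantified index, so terms are never
  substituted below a quantifier of \<open>\<phi>\<close>.\<close>

lemma dfn_sat_terms:
  assumes "wf_fm L \<phi>" "\<And>v. wf_trm L (\<tau> v)"
  shows "dfn (\<Union>v\<in>fv \<phi>. s v ` fv_trm (\<tau> v)) (\<lambda>e. sat M (\<lambda>v. eval M (\<lambda>u. e (s v u)) (\<tau> v)) \<phi>)"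
proof -
  let ?C = "\<Union>v\<in>fv \<phi>. s v ` fv_trm (\<tau> v)"
  have "dfn (Inl ` ?C \<union> Inr ` fv \<phi>) (\<lambda>e. (\<forall>v\<in>fv \<phi>. e (Inr v) = eval M (\<lambda>u. e (Inl (s v u))) (\<tau> v)) \<and>
    sat M (e \<circ> Inr) \<phi>)"
    using assms by (intro dfn_conj dfn_Ball dfn_eval_eq dfn_sat finite_fv) auto
  from dfn_ex[OF this] show ?thesis
  proof (rule dfn_cong)
    fix e assume e: "e ` ?C \<subseteq> dom M"
    define t where "t v = eval M (\<lambda>u. e (s v u)) (\<tau> v)" for v
    have t_dom: "t v \<in> dom M" if "v \<in> fv \<phi>" for v
      unfolding t_def using e that by (intro eval_in_dom[OF struc assms(2)]) auto
    have "(\<exists>t'. t' ` fv \<phi> \<subseteq> dom M \<and> (\<forall>v\<in>fv \<phi>. t' v = t v) \<and> sat M t' \<phi>) \<longleftrightarrow> sat M t \<phi>"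
    proof
      assume "\<exists>t'. t' ` fv \<phi> \<subseteq> dom M \<and> (\<forall>v\<in>fv \<phi>. t' v = t v) \<and> sat M t' \<phi>"
      then obtain t' where t': "\<forall>v\<in>fv \<phi>. t' v = t v" "sat M t' \<phi>" by blast
      have "sat M t' \<phi> = sat M t \<phi>" using t'(1) by (intro sat_cong) simp
      with t'(2) show "sat M t \<phi>" by simp
    next
      assume "sat M t \<phi>"
      then show "\<exists>t'. t' ` fv \<phi> \<subseteq> dom M \<and> (\<forall>v\<in>fv \<phi>. t' v = t v) \<and> sat M t' \<phi>"
        using t_dom by (intro exI[of _ t]) auto
    qed
    then show "(\<exists>t. t ` fv \<phi> \<subseteq> dom M \<and> (\<forall>v\<in>fv \<phi>. case_sum e t (Inr v) =
      eval M (\<lambda>u. case_sum e t (Inl (s v u))) (\<tau> v)) \<and> sat M (case_sum e t \<circ> Inr) \<phi>) =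
      sat M (\<lambda>v. eval M (\<lambda>u. e (s v u)) (\<tau> v)) \<phi>"
      unfolding t_def by (simp add: o_def)
  qed
qed

lemma G_dom: "g \<in> G \<Longrightarrow> g i \<in> dom M"
  unfolding G_def gen_def using X_dom by (force intro!: eval_in_dom[OF struc])

lemma G_choice:
  assumes "\<And>v. g v \<in> G"
  obtains \<tau> s where "\<And>v. wf_trm L (\<tau> v)" "\<And>v. range (s v) \<subseteq> K" "\<And>v. g v = gen (\<tau> v) (s v)"
proof -
  have "\<forall>v. \<exists>\<tau> s. wf_trm L \<tau> \<and> range s \<subseteq> K \<and> g v = gen \<tau> s" using assms unfolding G_def by blast
  then show ?thesis using that by metis
qed

lemma G_decided:
  assumes "wf_fm L \<phi>" "\<And>v. g v \<in> G"
  shows "ev (\<lambda>i. sat M (\<lambda>v. g v i) \<phi>) \<or> ev (\<lambda>i. \<not> sat M (\<lambda>v. g v i) \<phi>)"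
proof -
  obtain \<tau> s where *: "\<And>v. wf_trm L (\<tau> v)" "\<And>v. range (s v) \<subseteq> K" "\<And>v. g v = gen (\<tau> v) (s v)"
    using G_choice assms(2) by metis
  have "finite (\<Union>v\<in>fv \<phi>. s v ` fv_trm (\<tau> v))" "(\<Union>v\<in>fv \<phi>. s v ` fv_trm (\<tau> v)) \<subseteq> K"
    using *(2) by (auto simp: finite_fv finite_fv_trm)
  from stable[OF dfn_sat_terms[OF assms(1) *(1)] this] show ?thesis by (simp add: *(3) gen_def)
qed

lemma G_closed:
  assumes "wf_trm L \<tau>" "\<And>v. g v \<in> G"
  shows "(\<lambda>i. eval M (\<lambda>v. g v i) \<tau>) \<in> G"
proof -
  obtain \<sigma> s where *: "\<And>v. wf_trm L (\<sigma> v)" "\<And>v. range (s v) \<subseteq> K" "\<And>v. g v = gen (\<sigma> v) (s v)"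
    using G_choice assms(2) by metis
  \<comment> \<open>Pairing with \<open>v\<close> keeps the variables of the different terms
    \<open>\<sigma> v\<close> apart, and \<open>s'\<close> decodes them again.\<close>
  define \<tau>' where "\<tau>' = subst_trm (\<lambda>v. subst_trm (\<lambda>u. Var (prod_encode (v, u))) (\<sigma> v)) \<tau>"
  define s' where "s' n = (case prod_decode n of (v, u) \<Rightarrow> s v u)" for n
  have "wf_trm L \<tau>'" unfolding \<tau>'_def using assms(1) *(1) by (intro wf_subst_trm) auto
  moreover have "range s' \<subseteq> K" using *(2) by (force simp: s'_def split: prod.split)
  moreover have "(\<lambda>i. eval M (\<lambda>v. g v i) \<tau>) = gen \<tau>' s'"
    by (simp add: fun_eq_iff *(3) gen_def \<tau>'_def s'_def eval_subst_trm)
  ultimately show ?thesis unfolding G_def by blast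
qed

lemma G_const: "a \<in> dom M \<Longrightarrow> (\<lambda>i. a) \<in> G"
  unfolding G_def by (intro CollectI exI[of _ "Var 0"] exI[of _ "\<lambda>_. Inr a"]) (auto simp: gen_def K_def)

lemma G_x: "\<alpha> \<in> I \<Longrightarrow> (\<lambda>i. x i \<alpha>) \<in> G"
  unfolding G_def by (intro CollectI exI[of _ "Var 0"] exI[of _ "\<lambda>_. Inl \<alpha>"]) (auto simp: gen_def K_def)

lemma infinite_dom: "infinite (dom M)"
  using upper_bound[of "dom M"] irrefl by blast

text \<open>A member of \<open>G\<close> is determined by one of countably many terms and a finite
  list over \<open>K\<close>, since only the finitely many variables of the term matter; and
  \<open>K\<close> is no larger than \<open>dom M\<close>.\<close>

lemma card_G: "|G| \<le>o |dom M|"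
proof -
  have dM: "infinite (Field |dom M| )" "Card_order |dom M|"
    using infinite_dom by (simp_all add: Field_card_of card_of_card_order_on)
  have "|Inl ` I :: ('k + 'a) set| \<le>o |dom M|" "|Inr ` dom M :: ('k + 'a) set| \<le>o |dom M|"
    using card_of_image[of Inl I] card_of_image[of Inr "dom M"] card_I ordLeq_transitive by blast+
  then have K: "|K| \<le>o |dom M|"
    unfolding K_def by (rule card_of_Un_ordLeq_infinite_Field[OF dM(1) _ _ dM(2)])
  have "Inr ` dom M \<subseteq> K" "infinite (Inr ` dom M :: ('k + 'a) set)"
    using infinite_dom by (auto simp: K_def finite_image_iff)
  then have "infinite K" using finite_subset by blast
  then have lists: "|lists K| \<le>o |dom M|"
    using card_of_lists_ordLeq K ordLeq_transitive by blast
  have "|UNIV :: trm set| \<le>o |UNIV :: nat set|"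
    by (rule card_of_ordLeqI[of to_nat]) auto
  moreover have "|UNIV :: nat set| \<le>o |dom M|" using infinite_dom by (simp add: infinite_iff_card_of_nat)
  ultimately have trms: "|UNIV :: trm set| \<le>o |dom M|" using ordLeq_transitive by blast
  have prod: "|(UNIV :: trm set) \<times> lists K| \<le>o |dom M|"
    by (rule card_of_Times_ordLeq_infinite_Field[OF dM(1) trms lists dM(2)])
  have "G \<subseteq> (\<lambda>(\<tau>, l). gen \<tau> (\<lambda>v. l ! v)) ` (UNIV \<times> lists K)"
  proof
    fix g assume "g \<in> G"
    then obtain \<tau> s where g: "g = gen \<tau> s" "range s \<subseteq> K" unfolding G_def by blast
    obtain n where n: "\<forall>v\<in>fv_trm \<tau>. v < n"
      using finite_nat_set_iff_bounded finite_fv_trm by blast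
    have "g = (\<lambda>(\<tau>, l). gen \<tau> (\<lambda>v. l ! v)) (\<tau>, map s [0..<n])"
      unfolding g(1) gen_def prod.case using n by (intro ext eval_cong) auto
    moreover have "(\<tau>, map s [0..<n]) \<in> UNIV \<times> lists K" using g(2) by (auto simp: image_subset_iff)
    ultimately show "g \<in> (\<lambda>(\<tau>, l). gen \<tau> (\<lambda>v. l ! v)) ` (UNIV \<times> lists K)" by (rule image_eqI)
  qed
  then have "|G| \<le>o |(\<lambda>(\<tau>, l). gen \<tau> (\<lambda>v. l ! v)) ` ((UNIV :: trm set) \<times> lists K)|"
    by (rule card_of_mono1)
  then show ?thesis
    by (rule ordLeq_transitive[OF _ ordLeq_transitive[OF card_of_image prod]])
qed

text \<open>As \<open>G\<close> is no larger than \<open>dom M\<close>, elements of \<open>M\<close>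
  can name its members; keeping one name per class of eventual equality gives \<open>D\<close>. Thus
  the extension stays in the carrier type and its cardinality is at most that of
  \<open>M\<close>.\<close>

lemma representatives:
  obtains D val where "limit_model L M \<kappa> D val" "D \<subseteq> dom M" "\<And>b. b \<in> D \<Longrightarrow> val b \<in> G"
    "\<And>g. g \<in> G \<Longrightarrow> \<exists>b\<in>D. ev (\<lambda>i. val b i = g i)"
proof -
  obtain a0 where a0: "a0 \<in> dom M" using dom_nonempty by blast
  have "G \<noteq> {}" using G_const[OF a0] by blast
  then obtain p where p: "p ` dom M = G" using card_G card_of_ordLeq2[of G "dom M"] by blast
  have pG: "p b \<in> G" if "b \<in> dom M" for b using p that by blast
  define eq where "eq b b' \<longleftrightarrow> ev (\<lambda>i. p b i = p b' i)" for b b'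
  have eq_refl: "eq b b" for b by (simp add: eq_def ev_True)
  have eq_sym: "eq b b'" if "eq b' b" for b b' using that unfolding eq_def by (rule ev_mono) simp
  have eq_trans: "eq b c" if "eq b b'" "eq b' c" for b b' c
    using ev_conj[OF that[unfolded eq_def]] unfolding eq_def by (rule ev_mono) simp
  \<comment> \<open>The choice depends only on the predicate \<open>eq b\<close>, hence equivalent
    names get the same representative.\<close>
  define c where "c b = (SOME b'. b' \<in> dom M \<and> eq b b')" for b
  have c: "c b \<in> dom M \<and> eq b (c b)" if "b \<in> dom M" for b
    unfolding c_def by (rule someI[of _ b]) (simp add: that eq_refl)
  have c_eq: "c b = c b'" if "eq b b'" for b b'
  proof -
    have "eq b = eq b'" using eq_trans[OF that] eq_trans[OF eq_sym[OF that]] by (intro ext iffI) simp_all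
    then show ?thesis by (simp add: c_def)
  qed
  define D where "D = c ` dom M"
  have D: "D \<subseteq> dom M" using c by (auto simp: D_def)
  have rep: "\<exists>b\<in>D. ev (\<lambda>i. p b i = g i)" if gG: "g \<in> G" for g
  proof -
    have "g \<in> p ` dom M" using gG by (simp only: p)
    then obtain b where b: "g = p b" "b \<in> dom M" by (rule imageE)
    have "eq (c b) b" using eq_sym[of b "c b"] c[OF b(2)] by simp
    then have "ev (\<lambda>i. p (c b) i = g i)" by (simp only: eq_def b(1))
    moreover have "c b \<in> D" using b(2) by (simp add: D_def)
    ultimately show ?thesis by (rule bexI)
  qed
  have "limit_model L M \<kappa> D p"
  proof
    show "D \<noteq> {}" using a0 by (auto simp: D_def)
    show "p b i \<in> dom M" if "b \<in> D" for b i using that D pG G_dom by blast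
    show "b = b'" if b: "b \<in> D" "b' \<in> D" "ev (\<lambda>i. p b i = p b' i)" for b b'
    proof -
      obtain d d' where d: "d \<in> dom M" "b = c d" "d' \<in> dom M" "b' = c d'" using b by (auto simp: D_def)
      have 1: "eq (c d) (c d')" using b(3) d by (simp add: eq_def)
      have 2: "eq (c d') d'" by (rule eq_sym[OF conjunct2[OF c[OF d(3)]]])
      have "eq d d'" by (rule eq_trans[OF eq_trans[OF conjunct2[OF c[OF d(1)]] 1] 2])
      then show ?thesis using c_eq d by simp
    qed
    show "\<exists>b\<in>D. ev (\<lambda>i. p b i = eval M (\<lambda>v. p (e v) i) \<tau>)" if "wf_trm L \<tau>" "range e \<subseteq> D" for \<tau> e
    proof -
      have "p (e v) \<in> G" for v using that(2) D pG by blast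
      from rep[OF G_closed[OF that(1) this]] show ?thesis .
    qed
    show "ev (\<lambda>i. sat M (\<lambda>v. p (e v) i) \<phi>) \<or> ev (\<lambda>i. \<not> sat M (\<lambda>v. p (e v) i) \<phi>)"
      if "wf_fm L \<phi>" "range e \<subseteq> D" for \<phi> e
    proof -
      have "p (e v) \<in> G" for v using that(2) D pG by blast
      from G_decided[OF that(1) this] show ?thesis .
    qed
  qed (rule skolem)
  then show ?thesis using that D pG rep by blast
qed

text \<open>Let \<open>\<beta>\<close> be above all coordinates occurring in \<open>\<tau>\<close>
  and \<open>\<gamma>\<close> above \<open>\<beta>\<close>. At late \<open>i\<close> all arguments
  of \<open>\<tau>\<close> lie below \<open>x i \<beta>\<close>, and
  \<open>x i \<beta> \<lless> x i \<gamma>\<close> gives a copy of the value below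
  \<open>x i \<gamma>\<close>. For the predicate stating that an element equals
  \<open>\<tau>\<close> of its arguments, the copy can only be the value itself.\<close>

lemma x_bounds_terms:
  assumes \<tau>: "wf_trm L \<tau>" and s: "range s \<subseteq> K"
  shows "\<exists>\<beta>\<in>I. ev (\<lambda>i. gen \<tau> s i \<prec> x i \<beta>)"
proof -
  define V T where "V = Inl -` (s ` fv_trm \<tau>)" and "T = Inr -` (s ` fv_trm \<tau>)"
  have VT: "finite V" "finite T" "V \<subseteq> I" "T \<subseteq> dom M"
    using s finite_fv_trm[of \<tau>] unfolding V_def T_def by (auto intro!: finite_vimageI simp: K_def)
  have "\<exists>\<beta>\<in>I. \<forall>\<alpha>\<in>V. (\<alpha>, \<beta>) \<in> R"
  proof (cases "V = {}")
    case False
    have "total_on V R" using VT(3) I(1) R_total unfolding total_on_def by blast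
    then obtain b where b: "b \<in> V" "\<forall>c\<in>V. c = b \<or> (c, b) \<in> R"
      using finite_greatest[OF VT(1) False trans_R] by blast
    then obtain \<beta> where \<beta>: "\<beta> \<in> I" "(b, \<beta>) \<in> R" using I(3) VT(3) by blast
    have "(\<alpha>, \<beta>) \<in> R" if "\<alpha> \<in> V" for \<alpha>
      using b(2) that \<beta>(2) R_trans[of \<alpha> b \<beta>] by metis
    with \<beta>(1) show ?thesis by blast
  qed (use I(2) in blast)
  then obtain \<beta> where \<beta>: "\<beta> \<in> I" "\<forall>\<alpha>\<in>V. (\<alpha>, \<beta>) \<in> R" by blast
  obtain \<gamma> where \<gamma>: "\<gamma> \<in> I" "(\<beta>, \<gamma>) \<in> R" using I(3)[OF \<beta>(1)] by blast
  obtain k where k: "k \<in> Field \<kappa>" using I by blast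
  obtain j where j: "j \<in> Field \<kappa>" "{\<beta>, \<gamma>} \<union> V \<subseteq> J j" "T \<subseteq> below (m j)"
    using capture[of "{\<beta>, \<gamma>} \<union> V" T k] VT \<beta> \<gamma> k by auto
  have "gen \<tau> s i \<prec> x i \<gamma>" if ji: "(j, i) \<in> R" for i
  proof -
    have i: "i \<in> Field \<kappa>" using R_Field[OF ji] by blast
    have Ji: "\<beta> \<in> J i" "\<gamma> \<in> J i" "V \<subseteq> J i" using j(2) R_trans[OF _ ji] by (auto simp: J_def)
    have ll: "x i \<beta> \<lless> x i \<gamma>" using x_ll[OF i Ji(1,2) \<gamma>(2)] .
    have small: "X i (s v) \<prec> x i \<beta>" if v: "v \<in> fv_trm \<tau>" for v
    proof (cases "s v")
      case (Inl \<alpha>)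
      then have "\<alpha> \<in> V" using v by (auto simp: V_def intro: rev_image_eqI)
      then show ?thesis using Inl x_ll[OF i _ Ji(1)] Ji(3) \<beta>(2) ll_less by auto
    next
      case (Inr a)
      then have "a \<in> T" using v by (auto simp: T_def intro: rev_image_eqI)
      then have a: "a \<in> dom M" "a \<prec> m j" using j(3) by auto
      \<comment> \<open>Parameters are bounded through
        \<open>a \<prec> m i \<prec> z \<prec> Z i \<prec> x i \<beta>\<close>.\<close>
      obtain z where z: "z \<in> dom M" "m i \<lless> z" "z \<lless> Z i" using Z(2)[OF i] by blast
      have "a \<prec> m i" using mono[OF ji] a trans[of a "m j" "m i"] m_dom i j(1) by auto
      then have "a \<prec> z" using trans[of a "m i" z] a z m_dom[OF i] ll_less by blast
      then have "a \<prec> Z i" using trans[of a z "Z i"] a z Z(1)[OF i] ll_less by blast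
      then have "a \<prec> x i \<beta>" using trans[of a "Z i" "x i \<beta>"] a Z(1)[OF i] x_dom x_above[OF i Ji(1)] by blast
      then show ?thesis using Inr by simp
    qed
    define P where "P e \<longleftrightarrow> e (Inl ()) = eval M (\<lambda>v. e (Inr v)) \<tau>" for e :: "unit + nat \<Rightarrow> 'a"
    have P: "dfn (Inl ` UNIV \<union> Inr ` fv_trm \<tau>) P"
      unfolding P_def by (rule dfn_eval_eq[OF \<tau>]) auto
    have "gen \<tau> s \<in> G" using \<tau> s unfolding G_def by blast
    then have "gen \<tau> s i \<in> dom M" by (rule G_dom)
    then obtain x' where x': "x' ` UNIV \<subseteq> below (x i \<gamma>)" "E (fv_trm \<tau>) P (\<lambda>_. gen \<tau> s i) x' (x i \<beta>)"
      using ll_E[OF ll P, of "\<lambda>_. gen \<tau> s i"] x_dom by auto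
    have "(\<lambda>v. X i (s v)) ` fv_trm \<tau> \<subseteq> below (x i \<beta>)" using small X_dom s by (simp add: image_subset_iff)
    from ED[OF x'(2) this] have "x' () = gen \<tau> s i" by (simp add: P_def gen_def)
    then show ?thesis using x'(1) by auto
  qed
  then show ?thesis using \<gamma>(1) j(1) unfolding ev_def by blast
qed

text \<open>The equation between the value \<open>u\<close> at stage \<open>j\<close> and the term
  has all its parameters, \<open>u\<close> included, below \<open>m j\<close>. It holds at
  \<open>j\<close>, hence at every later stage by coherence.\<close>

lemma bounded_terms:
  assumes \<tau>: "wf_trm L \<tau>" and s: "range s \<subseteq> K" and a: "a \<in> dom M" and lt: "ev (\<lambda>i. gen \<tau> s i \<prec> a)"
  shows "\<exists>u\<in>dom M. ev (\<lambda>i. gen \<tau> s i = u)"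
proof -
  obtain k where k: "k \<in> Field \<kappa>" "\<And>i. (k, i) \<in> R \<Longrightarrow> gen \<tau> s i \<prec> a" using lt unfolding ev_def by blast
  \<comment> \<open>Adding \<open>a\<close> to the parameters makes the captured stage satisfy
    \<open>a \<prec> m j\<close>, which forces \<open>u \<prec> m j\<close>.\<close>
  define V T where "V = Inl -` (s ` fv_trm \<tau>)" and "T = insert a (Inr -` (s ` fv_trm \<tau>))"
  have VT: "finite V" "finite T" "V \<subseteq> I" "T \<subseteq> dom M"
    using s finite_fv_trm[of \<tau>] a unfolding V_def T_def by (auto intro!: finite_vimageI simp: K_def)
  obtain j where j: "j \<in> Field \<kappa>" "(k, j) \<in> R" "V \<subseteq> J j" "T \<subseteq> below (m j)"
    using capture[OF VT(1,3,2,4) k(1)] by blast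
  define u where "u = gen \<tau> s j"
  have u: "u \<in> dom M" using G_dom[of "gen \<tau> s" j] \<tau> s unfolding u_def G_def by blast
  have "u \<prec> a" using k(2)[OF j(2)] by (simp add: u_def)
  then have "u \<prec> m j" using j(4) trans[of u a "m j"] u a m_dom[OF j(1)] by (simp add: T_def)
  then have T: "insert u T \<subseteq> below (m j)" using j(4) u by simp
  have "s v \<in> Inl ` V \<union> Inr ` insert u T" if "v \<in> fv_trm \<tau>" for v
    using that by (cases "s v") (auto simp: V_def T_def intro!: imageI intro: rev_image_eqI)
  then have P: "dfn (Inl ` V \<union> Inr ` insert u T) (\<lambda>e. e (Inr u) = eval M (\<lambda>v. e (s v)) \<tau>)"
    by (intro dfn_eval_eq[OF \<tau>]) auto
  have "gen \<tau> s i = u" if "(j, i) \<in> R" for i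
    using coherent_X[OF P VT(1) _ j(3) T that] VT(2) by (simp add: u_def gen_def)
  then show ?thesis using u j(1) unfolding ev_def by blast
qed

text \<open>\<open>h\<close> sends an element to the class of its constant function, and
  \<open>y\<close> lists the classes of the coordinates. The facts on \<open>y\<close> are exported
  because the cofinality is computed along \<open>lam\<close>, which lives on another type.\<close>

theorem end_extension:
  "\<exists>(N :: 'a struc) h y. elem_end_ext L M N h \<and> |dom N| =o |dom M| \<and>
    (\<forall>a\<in>dom N. \<not> lt L N a a) \<and>
    (\<forall>a\<in>dom N. \<forall>b\<in>dom N. \<forall>c\<in>dom N. lt L N a b \<longrightarrow> lt L N b c \<longrightarrow> lt L N a c) \<and>
    (\<forall>\<alpha>\<in>I. y \<alpha> \<in> dom N) \<and> (\<forall>\<alpha>\<in>I. \<forall>\<beta>\<in>I. (\<alpha>, \<beta>) \<in> R \<longrightarrow> lt L N (y \<alpha>) (y \<beta>)) \<and>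
    (\<forall>b\<in>dom N. \<exists>\<alpha>\<in>I. lt L N b (y \<alpha>))"
proof -
  obtain D val where lim: "limit_model L M \<kappa> D val" and D: "D \<subseteq> dom M"
    and valG: "\<And>b. b \<in> D \<Longrightarrow> val b \<in> G" and rep: "\<And>g. g \<in> G \<Longrightarrow> \<exists>b\<in>D. ev (\<lambda>i. val b i = g i)"
    by (rule representatives) (rule that)
  interpret N: limit_model L M \<kappa> D val by (rule lim)
  define r where "r g = (SOME b. b \<in> D \<and> ev (\<lambda>i. val b i = g i))" for g
  have r: "r g \<in> D" "ev (\<lambda>i. val (r g) i = g i)" if "g \<in> G" for g
    using someI_ex[of "\<lambda>b. b \<in> D \<and> ev (\<lambda>i. val b i = g i)"] rep[OF that] unfolding r_def by blast+
  have r_eq: "r g = b" if "g \<in> G" "b \<in> D" "ev (\<lambda>i. val b i = g i)" for g b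
  proof (rule N.val_inj[OF r(1)[OF that(1)] that(2)])
    show "ev (\<lambda>i. val (r g) i = val b i)"
      using ev_conj[OF r(2)[OF that(1)] that(3)] by (rule ev_mono) simp
  qed
  define h where "h a = r (\<lambda>_. a)" for a
  define y where "y \<alpha> = r (\<lambda>i. x i \<alpha>)" for \<alpha>
  have h: "h a \<in> D" "ev (\<lambda>i. val (h a) i = a)" if "a \<in> dom M" for a
    using r[OF G_const[OF that]] by (simp_all add: h_def)
  have y: "y \<alpha> \<in> D" "ev (\<lambda>i. val (y \<alpha>) i = x i \<alpha>)" if "\<alpha> \<in> I" for \<alpha>
    using r[OF G_x[OF that]] by (simp_all add: y_def)
  have "elem_end_ext L M N.N h"
    unfolding elem_end_ext_def N.dom_N
  proof (intro conjI allI impI ballI N.is_struc_N)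
    show "h ` dom M \<subseteq> D" using h(1) by blast
    fix \<phi> e assume \<phi>: "wf_fm L \<phi> \<and> asg M e"
    then have e: "e v \<in> dom M" for v by (auto simp: asg_def)
    have "ev (\<lambda>i. \<forall>v\<in>fv \<phi>. val ((h \<circ> e) v) i = e v)"
      using h(2)[OF e] by (intro ev_Ball finite_fv) simp
    then have "ev (\<lambda>i. sat M (\<lambda>v. val ((h \<circ> e) v) i) \<phi> = sat M e \<phi>)"
      by (rule ev_mono) (rule sat_cong, simp)
    then have "ev (\<lambda>i. sat M (\<lambda>v. val ((h \<circ> e) v) i) \<phi>) = ev (\<lambda>i. sat M e \<phi>)" by (rule ev_cong)
    moreover have "sat N.N (h \<circ> e) \<phi> = ev (\<lambda>i. sat M (\<lambda>v. val ((h \<circ> e) v) i) \<phi>)"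
      using \<phi> h(1)[OF e] by (intro N.Los) auto
    ultimately show "sat M e \<phi> = sat N.N (h \<circ> e) \<phi>" by (simp add: ev_const)
  next
    fix b a assume b: "b \<in> D" and a: "a \<in> dom M" and lt: "lt L N.N b (h a)"
    obtain \<tau> s where \<tau>: "wf_trm L \<tau>" "range s \<subseteq> K" "val b = gen \<tau> s" using valG[OF b] unfolding G_def by blast
    have "ev (\<lambda>i. gen \<tau> s i \<prec> a)"
      using ev_conj[OF lt[unfolded N.lt_N] h(2)[OF a]] by (rule ev_mono) (auto simp: \<tau>(3))
    from bounded_terms[OF \<tau>(1,2) a this] obtain u where "u \<in> dom M" "ev (\<lambda>i. val b i = u)"
      unfolding \<tau>(3) by blast
    then have "h u = b" "u \<in> dom M" using r_eq[OF G_const b] by (auto simp: h_def)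
    then show "b \<in> h ` dom M" by blast
  qed
  moreover have "|dom N.N| =o |dom M|"
  proof -
    have "inj_on h (dom M)"
    proof (rule inj_onI)
      fix a b assume ab: "a \<in> dom M" "b \<in> dom M" "h a = h b"
      have "ev (\<lambda>i. a = b)" using ev_conj[OF h(2)[OF ab(1)] h(2)[OF ab(2)]] by (rule ev_mono) (auto simp: ab(3))
      then show "a = b" by (simp add: ev_const)
    qed
    then have "|dom M| \<le>o |D|" using h(1) by (intro card_of_ordLeqI) auto
    moreover have "|D| \<le>o |dom M|" using D by (rule card_of_mono1)
    ultimately show ?thesis unfolding N.dom_N by (simp add: ordIso_iff_ordLeq)
  qed
  moreover have "\<forall>a\<in>dom N.N. \<not> lt L N.N a a"
    using irrefl[OF N.val_dom] ev_False by (simp add: N.lt_N N.dom_N)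
  moreover have "lt L N.N a c" if "a \<in> dom N.N" "b \<in> dom N.N" "c \<in> dom N.N" "lt L N.N a b" "lt L N.N b c" for a b c
    using ev_conj[OF that(4,5)[unfolded N.lt_N]] unfolding N.lt_N
    by (rule ev_mono) (use that(1-3) trans[OF N.val_dom N.val_dom N.val_dom] N.dom_N in blast)
  then have "\<forall>a\<in>dom N.N. \<forall>b\<in>dom N.N. \<forall>c\<in>dom N.N. lt L N.N a b \<longrightarrow> lt L N.N b c \<longrightarrow> lt L N.N a c"
    by blast
  moreover have "\<forall>\<alpha>\<in>I. y \<alpha> \<in> dom N.N" using y(1) by (simp add: N.dom_N)
  moreover have "\<forall>\<alpha>\<in>I. \<forall>\<beta>\<in>I. (\<alpha>, \<beta>) \<in> R \<longrightarrow> lt L N.N (y \<alpha>) (y \<beta>)"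
  proof (intro ballI impI)
    fix \<alpha> \<beta> assume \<alpha>\<beta>: "\<alpha> \<in> I" "\<beta> \<in> I" "(\<alpha>, \<beta>) \<in> R"
    \<comment> \<open>The chain condition on \<open>x i\<close> covers \<open>\<alpha>\<close> and
      \<open>\<beta>\<close> when \<open>i\<close> is beyond both, which holds eventually.\<close>
    have "ev (\<lambda>i. (\<beta>, i) \<in> R)" using \<alpha>\<beta>(2) I(1) by (intro ev_above) blast
    from ev_conj[OF this ev_conj[OF y(2)[OF \<alpha>\<beta>(1)] y(2)[OF \<alpha>\<beta>(2)]]] show "lt L N.N (y \<alpha>) (y \<beta>)"
      unfolding N.lt_N
    proof (rule ev_mono)
      fix i assume i: "(\<beta>, i) \<in> R \<and> val (y \<alpha>) i = x i \<alpha> \<and> val (y \<beta>) i = x i \<beta>"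
      have "\<alpha> \<in> J i" "\<beta> \<in> J i" "i \<in> Field \<kappa>"
        using i \<alpha>\<beta> R_trans[OF \<alpha>\<beta>(3)] R_Field[of \<beta> i] by (auto simp: J_def)
      then show "val (y \<alpha>) i \<prec> val (y \<beta>) i" using i ll_less[OF x_ll[OF _ _ _ \<alpha>\<beta>(3)]] by simp
    qed
  qed
  moreover have "\<forall>b\<in>dom N.N. \<exists>\<alpha>\<in>I. lt L N.N b (y \<alpha>)"
  proof
    fix b assume b: "b \<in> dom N.N"
    obtain \<tau> s where \<tau>: "wf_trm L \<tau>" "range s \<subseteq> K" "val b = gen \<tau> s"
      using valG b unfolding N.dom_N G_def by blast
    obtain \<beta> where \<beta>: "\<beta> \<in> I" "ev (\<lambda>i. gen \<tau> s i \<prec> x i \<beta>)" using x_bounds_terms[OF \<tau>(1,2)] by blast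
    have "lt L N.N b (y \<beta>)"
      using ev_conj[OF \<beta>(2) y(2)[OF \<beta>(1)]] unfolding N.lt_N by (rule ev_mono) (auto simp: \<tau>(3))
    with \<beta>(1) show "\<exists>\<alpha>\<in>I. lt L N.N b (y \<alpha>)" by blast
  qed
  ultimately show ?thesis by (intro exI[of _ N.N] exI[of _ h] exI[of _ y] conjI)
qed

end

section \<open>Cofinality of the extension and the conclusion\<close>

lemma ordLeq_strict_embedding:
  assumes "r \<le>o r'"
  obtains f where "f ` Field r \<subseteq> Field r'" "\<And>a b. (a, b) \<in> r \<Longrightarrow> a \<noteq> b \<Longrightarrow> (f a, f b) \<in> r' - Id"
proof -
  obtain f where f: "Well_order r" "Well_order r'" "embed r r' f"
    using assms unfolding ordLeq_def by blast
  have inj: "inj_on f (Field r)" using embed_inj_on f by blast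
  have "(f a, f b) \<in> r' - Id" if ab: "(a, b) \<in> r" "a \<noteq> b" for a b
  proof -
    have "(f a, f b) \<in> r'" using embed_compat[of r r' f] f ab(1) unfolding compat_def by blast
    moreover have "a \<in> Field r" "b \<in> Field r" using ab(1) by (auto simp: Field_def)
    ultimately show ?thesis using inj ab(2) by (auto dest: inj_onD)
  qed
  moreover have "f ` Field r \<subseteq> Field r'" using embed_Field f by blast
  ultimately show ?thesis using that by blast
qed

text \<open>By regularity, a sequence of length less than \<open>r\<close> is bounded by a member of the increasing
  cofinal sequence \<open>y\<close>.\<close>

lemma cof_isI:
  assumes r: "regular_cardinal r"
    and irrefl: "\<And>a. a \<in> dom N \<Longrightarrow> \<not> lt L N a a"
    and trans: "\<And>a b c. a \<in> dom N \<Longrightarrow> b \<in> dom N \<Longrightarrow> c \<in> dom N \<Longrightarrow> lt L N a b \<Longrightarrow> lt L N b c \<Longrightarrow> lt L N a c"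
    and y: "\<And>l. l \<in> Field r \<Longrightarrow> y l \<in> dom N"
      "\<And>l l'. (l, l') \<in> r \<Longrightarrow> l \<noteq> l' \<Longrightarrow> lt L N (y l) (y l')"
      "\<And>b. b \<in> dom N \<Longrightarrow> \<exists>l\<in>Field r. lt L N b (y l)"
  shows "cof_is L N r"
proof -
  have co: "Card_order r" and inf: "infinite (Field r)" and reg: "regularCard r"
    using r by (auto simp: regular_cardinal_def)
  have total: "l = l' \<or> (l, l') \<in> r \<or> (l', l) \<in> r" if "l \<in> Field r" "l' \<in> Field r" for l l'
    using co that unfolding card_order_on_def well_order_on_def linear_order_on_def total_on_def by blast
  have rtrans: "trans r"
    using co unfolding card_order_on_def well_order_on_def linear_order_on_def partial_order_on_def
      preorder_on_def by blast
  have "\<not> incr_cofinal_seq L N |A|" if A: "A \<subseteq> Field r" "|A| <o r" for A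
  proof
    assume "incr_cofinal_seq L N |A|"
    then obtain g where g: "g ` A \<subseteq> dom N" "\<forall>b\<in>dom N. \<exists>i\<in>A. b = g i \<or> lt L N b (g i)"
      unfolding incr_cofinal_seq_def Field_card_of by blast
    \<comment> \<open>Each member of the short sequence is dominated by some \<open>y l\<close>; the
      indices so chosen form a cofinal subset of \<open>r\<close> of smaller cardinality, against
      regularity.\<close>
    have "\<forall>i\<in>A. \<exists>l. l \<in> Field r \<and> lt L N (g i) (y l)" using g(1) y(3) by blast
    from bchoice[OF this] obtain k where k: "\<And>i. i \<in> A \<Longrightarrow> k i \<in> Field r \<and> lt L N (g i) (y (k i))"
      by blast
    have "cofinal (k ` A) r"
      unfolding cofinal_def
    proof
      fix l assume l: "l \<in> Field r"
      obtain i where i: "i \<in> A" "y l = g i \<or> lt L N (y l) (g i)" using g(2) y(1)[OF l] by blast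
      have gi: "g i \<in> dom N" using g(1) i(1) by blast
      have ki: "k i \<in> Field r" "lt L N (g i) (y (k i))" using k[OF i(1)] by auto
      have lt: "lt L N (y l) (y (k i))"
        using i(2) ki(2) trans[OF y(1)[OF l] gi y(1)[OF ki(1)]] by auto
      have "l \<noteq> k i" using lt irrefl[OF y(1)[OF l]] by auto
      moreover have "(k i, l) \<notin> r"
        using trans[OF y(1)[OF l] y(1)[OF ki(1)] y(1)[OF l] lt] y(2)[of "k i" l] irrefl[OF y(1)[OF l]]
          \<open>l \<noteq> k i\<close> by auto
      ultimately show "\<exists>b\<in>k ` A. l \<noteq> b \<and> (l, b) \<in> r" using total[OF l ki(1)] i(1) by blast
    qed
    moreover have "k ` A \<subseteq> Field r" using k by blast
    ultimately have "|k ` A| =o r" using reg unfolding regularCard_def by blast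
    moreover have "|k ` A| <o r" using card_of_image A(2) by (rule ordLeq_ordLess_trans)
    ultimately show False using not_ordLess_ordIso by blast
  qed
  moreover have "incr_cofinal_seq L N r"
    unfolding incr_cofinal_seq_def using y by (intro exI[of _ y]) blast
  ultimately show ?thesis using co unfolding cof_is_def by blast
qed

theorem theorem1p3:
  fixes L :: lang and T :: "fm set" and M :: "'a struc" and \<kappa> :: "'k rel"
  assumes "language L"
    and "complete_theory TYPE('a) L T"
    and "has_skolem TYPE('a) L T"
    and "lt_linear TYPE('a) L T"
    and "inaccessibility TYPE('a) L T"
    and "regular_cardinal \<kappa>"
    and "is_model L T M"
    and "saturated L \<kappa> M"
    and "cof_is L M \<kappa>"
  shows "\<forall>lam :: 'l rel. regular_cardinal lam \<and> ordLeq3 lam \<kappa> \<longrightarrow>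
           (\<exists>(N :: 'a struc) h. elem_end_ext L M N h \<and>
              ordIso2 (card_of (dom N)) (card_of (dom M)) \<and> cof_is L N lam)"
proof (intro allI impI, elim conjE)
  fix lam :: "'l rel"
  assume lam: "regular_cardinal lam" and le: "lam \<le>o \<kappa>"
  have lin: "\<And>a. a \<in> dom M \<Longrightarrow> \<not> lt L M a a"
    "\<And>a b c. a \<in> dom M \<Longrightarrow> b \<in> dom M \<Longrightarrow> c \<in> dom M \<Longrightarrow> lt L M a b \<Longrightarrow> lt L M b c \<Longrightarrow> lt L M a c"
    "\<And>a b. a \<in> dom M \<Longrightarrow> b \<in> dom M \<Longrightarrow> lt L M a b \<or> a = b \<or> lt L M b a"
    using assms(4,7) unfolding lt_linear_def by blast+
  interpret saturated_model L M \<kappa>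
  proof
    show "is_struc L M" using assms(7) by (simp add: is_model_def)
    show "Card_order \<kappa>" "infinite (Field \<kappa>)" using assms(6) by (simp_all add: regular_cardinal_def)
    show "\<exists>z1\<in>dom M. lt L M z0 z1 \<and>
          (\<forall>ys0. length ys0 = length xs \<and> set ys0 \<subseteq> dom M \<longrightarrow>
             (\<exists>ys1. length ys1 = length xs \<and> set ys1 \<subseteq> dom M \<and> (\<forall>y\<in>set ys1. lt L M y z1) \<and>
                 E_phi L M \<phi> xs ts ys0 ys1 z0))"
      if "wf_fm L \<phi>" "distinct (xs @ ts)" "fv \<phi> \<subseteq> set xs \<union> set ts" "z0 \<in> dom M" for \<phi> xs ts z0
      using assms(5)[unfolded inaccessibility_def, rule_format, of \<phi> xs ts M z0] assms(7) that by simp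
  qed (fact assms(1) assms(8) lin)+
  obtain f where f: "f ` Field \<kappa> \<subseteq> dom M" "\<And>i j. (i, j) \<in> R \<Longrightarrow> f i \<prec> f j"
    "\<And>a. a \<in> dom M \<Longrightarrow> \<exists>i\<in>Field \<kappa>. a = f i \<or> a \<prec> f i"
  proof -
    obtain f where f: "f ` Field \<kappa> \<subseteq> dom M" "\<forall>i j. (i, j) \<in> \<kappa> \<and> i \<noteq> j \<longrightarrow> f i \<prec> f j"
      "\<forall>a\<in>dom M. \<exists>i\<in>Field \<kappa>. a = f i \<or> a \<prec> f i"
      using assms(9) unfolding cof_is_def incr_cofinal_seq_def by (elim conjE exE)
    show ?thesis using f(2,3) by (intro that[of f] f(1)) simp_all
  qed
  have f_dom: "f i \<in> dom M" if "i \<in> Field \<kappa>" for i using f(1) that by blast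
  \<comment> \<open>Two elements below \<open>c\<close> make every element from \<open>c\<close> on
    \<open>wide\<close>.\<close>
  obtain a b c where abc: "a \<in> dom M" "b \<in> dom M" "c \<in> dom M" "a \<prec> b" "b \<prec> c"
  proof -
    obtain a where a: "a \<in> dom M" using dom_nonempty by blast
    obtain b where b: "b \<in> dom M" "a \<prec> b" using upper_bound[of "{a}"] a by auto
    obtain c where "c \<in> dom M" "b \<prec> c" using upper_bound[of "{b}"] b by auto
    with a b show ?thesis using that by blast
  qed
  have wide: "wide z" if "z \<in> dom M" "c \<prec> z \<or> z = c" for z
  proof -
    have "c \<prec> z \<Longrightarrow> b \<prec> z" using trans[of b c z] abc that(1) by blast
    then have "b \<prec> z" using that(2) abc(5) by blast
    moreover have "a \<prec> z" using trans[of a b z] abc that(1) calculation by blast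
    moreover have "a \<noteq> b" using abc irrefl by blast
    ultimately show ?thesis using abc that(1) unfolding wide_def by blast
  qed
  \<comment> \<open>Values below \<open>c\<close> are raised to \<open>c\<close>, which makes all of
    them \<open>wide\<close>; the sequence is then known to increase weakly, and it is still
    cofinal.\<close>
  define m where "m i = (if f i \<prec> c then c else f i)" for i
  have m: "wide (m i)" "f i \<prec> m i \<or> f i = m i" "m i \<in> dom M" if "i \<in> Field \<kappa>" for i
    using wide[of "m i"] total[OF f_dom[OF that] abc(3)] f_dom[OF that] abc(3) by (auto simp: m_def)
  have mono: "m i \<prec> m j \<or> m i = m j" if "(i, j) \<in> R" for i j
    using f(2)[OF that] total[OF f_dom abc(3), of j] trans[OF f_dom f_dom abc(3), of i j] f_dom abc(3)
      R_Field[OF that] by (auto simp: m_def)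
  have cofinal: "\<exists>j\<in>Field \<kappa>. a \<prec> m j" if a: "a \<in> dom M" for a
  proof -
    obtain i where i: "i \<in> Field \<kappa>" "a = f i \<or> a \<prec> f i" using f(3)[OF a] by blast
    obtain j where j: "j \<in> Field \<kappa>" "(i, j) \<in> R" using R_unbounded[OF i(1)] by blast
    have "a \<prec> f j" using i f(2)[OF j(2)] trans[OF a f_dom[OF i(1)] f_dom[OF j(1)]] by blast
    then have "a \<prec> m j" using m[OF j(1)] trans[OF a f_dom[OF j(1)] m(3)[OF j(1)]] by auto
    with j(1) show ?thesis by blast
  qed
  \<comment> \<open>\<open>unbounded\<close> needs two \<open>\<lless>\<close>-steps above
    \<open>m i\<close>.\<close>
  have "\<forall>i\<in>Field \<kappa>. \<exists>Z. Z \<in> dom M \<and> (\<exists>z\<in>dom M. m i \<lless> z \<and> z \<lless> Z)"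
  proof
    fix i assume i: "i \<in> Field \<kappa>"
    obtain z where z: "z \<in> dom M" "m i \<lless> z" using exists_ll[OF m(3)[OF i] m(3)[OF i]] by blast
    obtain Z where "Z \<in> dom M" "z \<lless> Z" using exists_ll[OF z(1) z(1)] by blast
    with z show "\<exists>Z. Z \<in> dom M \<and> (\<exists>z\<in>dom M. m i \<lless> z \<and> z \<lless> Z)" by blast
  qed
  from bchoice[OF this] obtain Z where
    Z: "\<And>i. i \<in> Field \<kappa> \<Longrightarrow> Z i \<in> dom M" "\<And>i. i \<in> Field \<kappa> \<Longrightarrow> \<exists>z\<in>dom M. m i \<lless> z \<and> z \<lless> Z i" by blast
  \<comment> \<open>The image of \<open>lam\<close> in \<open>\<kappa>\<close> indexes the
    coordinates; it has no greatest element because an infinite cardinal has none.\<close>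
  obtain \<epsilon> where \<epsilon>: "\<epsilon> ` Field lam \<subseteq> Field \<kappa>" "\<And>l l'. (l, l') \<in> lam \<Longrightarrow> l \<noteq> l' \<Longrightarrow> (\<epsilon> l, \<epsilon> l') \<in> R"
    using ordLeq_strict_embedding[OF le] by metis
  define I where "I = \<epsilon> ` Field lam"
  have lam': "Card_order lam" "infinite (Field lam)" using lam by (simp_all add: regular_cardinal_def)
  have I: "I \<subseteq> Field \<kappa>" "I \<noteq> {}" using \<epsilon>(1) lam'(2) by (auto simp: I_def)
  have I_unbounded: "\<exists>\<beta>\<in>I. (\<alpha>, \<beta>) \<in> R" if \<alpha>: "\<alpha> \<in> I" for \<alpha>
  proof -
    obtain l where l: "l \<in> Field lam" "\<alpha> = \<epsilon> l" using \<alpha> unfolding I_def by blast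
    obtain l' where l': "l' \<in> Field lam" "l \<noteq> l'" "(l, l') \<in> lam"
      using infinite_Card_order_limit[OF lam' l(1)] by blast
    show ?thesis using \<epsilon>(2)[OF l'(3,2)] l'(1) unfolding I_def l(2) by blast
  qed
  \<comment> \<open>A strictly increasing sequence is injective, so \<open>\<kappa>\<close> and
    hence \<open>I\<close> is no larger than \<open>M\<close>; this bounds the number of generators
    of \<open>N\<close>.\<close>
  have "inj_on f (Field \<kappa>)"
  proof (rule inj_onI)
    fix i j assume ij: "i \<in> Field \<kappa>" "j \<in> Field \<kappa>" "f i = f j"
    then show "i = j" using R_total[OF ij(1,2)] f(2)[of i j] f(2)[of j i] irrefl[OF f_dom] by auto
  qed
  then have "|Field \<kappa>| \<le>o |dom M|" using f(1) by (intro card_of_ordLeqI) auto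
  then have card_I: "|I| \<le>o |dom M|"
    using card_of_mono1[of I "Field \<kappa>"] \<epsilon>(1) ordLeq_transitive unfolding I_def by blast
  have "\<exists>x :: 'k \<Rightarrow> 'k \<Rightarrow> 'a. \<forall>i. range (x i) \<subseteq> dom M \<and> (i \<in> Field \<kappa> \<longrightarrow>
    (\<forall>j V T P. (j, i) \<in> R \<longrightarrow> finite V \<longrightarrow> finite T \<longrightarrow> V \<subseteq> {\<alpha> \<in> I. (\<alpha>, j) \<in> R} \<longrightarrow>
       dfn (Inl ` V \<union> Inr ` T) P \<longrightarrow> E (T :: 'a set) P (x i) (x j) (m j)) \<and>
    (\<forall>\<alpha>\<in>{\<alpha> \<in> I. (\<alpha>, i) \<in> R}. Z i \<prec> x i \<alpha>) \<and>
    (\<forall>\<alpha>\<in>{\<alpha> \<in> I. (\<alpha>, i) \<in> R}. \<forall>\<beta>\<in>{\<alpha> \<in> I. (\<alpha>, i) \<in> R}. (\<alpha>, \<beta>) \<in> R \<longrightarrow> x i \<alpha> \<lless> x i \<beta>))"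
    (is "\<exists>x. \<forall>i. ?Q x i")
    by (rule coherent_tower) (fact m(1) mono Z)+
  then obtain x where x: "\<forall>i. ?Q x i" by (elim exE)
  have x_dom: "x i \<alpha> \<in> dom M" for i \<alpha> using conjunct1[OF spec[OF x, of i]] by blast
  note x_tower = mp[OF conjunct2[OF spec[OF x]]]
  have skolem: "\<exists>\<tau>. wf_trm L \<tau> \<and> (\<forall>e. asg M e \<longrightarrow>
      (\<exists>a\<in>dom M. sat M (e(y := a)) \<phi>) \<longrightarrow> sat M (e(y := eval M e \<tau>)) \<phi>)" if "wf_fm L \<phi>" for \<phi> y
    using assms(3)[unfolded has_skolem_def, rule_format, OF that, of y] assms(7) by blast
  have tower: "tower L M \<kappa> m Z I x"
  proof
    show "E T P (x i) (x j) (m j)" if "(j, i) \<in> R" "finite V" "finite T" "V \<subseteq> {\<alpha> \<in> I. (\<alpha>, j) \<in> R}"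
      "dfn (Inl ` V \<union> Inr ` T) P" for i j V P and T :: "'a set"
      using conjunct1[OF x_tower[of i], rule_format, OF _ that] R_Field[OF that(1)] by simp
    show "Z i \<prec> x i \<alpha>" if "i \<in> Field \<kappa>" "\<alpha> \<in> {\<alpha> \<in> I. (\<alpha>, i) \<in> R}" for i \<alpha>
      using conjunct1[OF conjunct2[OF x_tower[OF that(1)]], rule_format, OF that(2)] .
    show "x i \<alpha> \<lless> x i \<beta>" if "i \<in> Field \<kappa>" "\<alpha> \<in> {\<alpha> \<in> I. (\<alpha>, i) \<in> R}"
      "\<beta> \<in> {\<alpha> \<in> I. (\<alpha>, i) \<in> R}" "(\<alpha>, \<beta>) \<in> R" for i \<alpha> \<beta>
      using conjunct2[OF conjunct2[OF x_tower[OF that(1)]], rule_format, OF that(2-4)] .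
  qed (fact I I_unbounded card_I m(1) mono cofinal Z x_dom skolem)+
  obtain N :: "'a struc" and h y where N: "elem_end_ext L M N h" "|dom N| =o |dom M|"
    "\<forall>a\<in>dom N. \<not> lt L N a a"
    "\<forall>a\<in>dom N. \<forall>b\<in>dom N. \<forall>c\<in>dom N. lt L N a b \<longrightarrow> lt L N b c \<longrightarrow> lt L N a c"
    "\<forall>\<alpha>\<in>I. y \<alpha> \<in> dom N" "\<forall>\<alpha>\<in>I. \<forall>\<beta>\<in>I. (\<alpha>, \<beta>) \<in> R \<longrightarrow> lt L N (y \<alpha>) (y \<beta>)"
    "\<forall>b\<in>dom N. \<exists>\<alpha>\<in>I. lt L N b (y \<alpha>)"
    using tower.end_extension[OF tower] by (elim exE conjE)
  \<comment> \<open>The classes \<open>y\<close>, read along the embedding of \<open>lam\<close>,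
    form the cofinal sequence.\<close>
  have "cof_is L N lam"
  proof (rule cof_isI[OF lam, where y = "y \<circ> \<epsilon>"])
    show "lt L N ((y \<circ> \<epsilon>) l) ((y \<circ> \<epsilon>) l')" if "(l, l') \<in> lam" "l \<noteq> l'" for l l'
      using N(6) \<epsilon>(2)[OF that] that(1) unfolding I_def by (auto simp: Field_def)
    show "(y \<circ> \<epsilon>) l \<in> dom N" if "l \<in> Field lam" for l using N(5) that by (simp add: I_def)
    show "\<exists>l\<in>Field lam. lt L N b ((y \<circ> \<epsilon>) l)" if "b \<in> dom N" for b using N(7) that by (auto simp: I_def)
  qed (use N(3,4) in blast)+
  with N(1,2) show "\<exists>(N :: 'a struc) h. elem_end_ext L M N h \<and> |dom N| =o |dom M| \<and> cof_is L N lam"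
    by blast
qed

end
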